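(* For all ordinals $\zeta\leqslant\xi<\omega_1$, $\mathbf{g}_{\xi,1+\zeta}\bigl(C_0(\omega^{\omega^\xi})\widehat{\otimes}_\pi C_0(\omega^{\omega^\zeta})\bigr)\geqslant1$.
   Context: General notation. $\mathbb{N}=\{1,2,\ldots\}$; $\omega_1$ is the first uncountable ordinal. Banach spaces are over $\mathbb{K}\in\{\mathbb{R},\mathbb{C}\}$; $B_X$ is the closed unit ball of $X$; operators are bounded and linear; $I_U$ is the identity of $U$. $[\mathbb{N}]^{<\omega}$ (resp. $[\mathbb{N}]$) is the set of finite (resp. infinite) subsets of $\mathbb{N}$; for $L\in[\mathbb{N}]$, $[L]^{<\omega}$ and $[L]$ are the finite and infinite subsets of $L$. Subsets of $\mathbb{N}$ are identified with strictly increasing sequences. $E\preceq F$ means $E$ is an initial segment of $F$, $E\prec F$ that it is a proper one. $E<F$ means $E=\varnothing$ or $F=\varnothing$ or $\max E<\min F$; $E<n$ means $E<\{n\}$ and $n\leqslant E$ means $n\leqslant\min E$. $E\frown F$ is concatenation. Schreier families. $\mathcal{S}_0=\{\varnothing\}\cup\{\{n\}:n\in\mathbb{N}\}$; $\mathcal{S}_{\xi+1}=\{\varnothing\}\cup\{\bigcup_{n=1}^mE_n:E_1<\cdots<E_m,\ \varnothing\neq E_n\in\mathcal{S}_\xi,\ m\leqslant E_1\}$; for each countable limit ordinal $\xi$ a sequence $\xi_n\uparrow\xi$ (the characteristic sequence of $\xi$) with $\mathcal{S}_{\xi_n+1}\subset\mathcal{S}_{\xi_{n+1}}$ for all $n$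 is fixed, and $\mathcal{S}_\xi=\{\varnothing\}\cup\{E\neq\varnothing:E\in\mathcal{S}_{\xi_{\min E}+1}\}$. For $\xi,\zeta<\omega_1$, $\mathcal{S}_\zeta[\mathcal{S}_\xi]=\{\varnothing\}\cup\{\bigcup_{n=1}^mE_n:E_1<\cdots<E_m,\ \varnothing\neq E_n\in\mathcal{S}_\xi,\ (\min E_n)_{n=1}^m\in\mathcal{S}_\zeta\}$; one has $\mathcal{S}_{\zeta+1}[\mathcal{S}_\xi]=\mathcal{S}_1[\mathcal{S}_\zeta[\mathcal{S}_\xi]]$ (same formula as $\mathcal{S}_{\xi+1}$ with $\mathcal{S}_\zeta[\mathcal{S}_\xi]$ in place of $\mathcal{S}_\xi$). $MAX(\cdot)$ is the set of $\preceq$-maximal (equivalently, inclusion-maximal) members. For $\mathcal{F}=\mathcal{S}_\xi$ or $\mathcal{S}_\zeta[\mathcal{S}_\xi]$: every $M\in[\mathbb{N}]$ is uniquely $M=\bigcup_kF_k$ with $F_1<F_2<\cdots$ in $MAX(\mathcal{F})$, and every non-empty finite $E$ is uniquely $E=\bigcup_{n=1}^lF_n$ with $F_1<\cdots<F_l$, $F_n\in MAX(\mathcal{F})$ for $n<l$, $\varnothing\ne F_l\in\mathcal{F}$ (the $\mathcal{F}$-decomposition). Write $M|_{\xi,\zeta,n}$ for the union of the first $n$ sets of the $\mathcal{S}_\zeta[\mathcal{S}_\xi]$-decomposition of $M$, with $M|_{\xi,\zeta,0}=\varnothing$. Weights. $p^0_E=1$ for $\varnothing\ne E\in\mathcal{S}_0$;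 if $\varnothing\neq E\in\mathcal{S}_{\xi+1}$ has $\mathcal{S}_\xi$-decomposition $F_1<\cdots<F_l$, $p^{\xi+1}_E=p^\xi_{F_l}/\min E$; for $\xi$ limit and $\varnothing\neq E\in\mathcal{S}_\xi$, $p^\xi_E=p^{\xi_{\min E}+1}_E$. For arbitrary non-empty finite $E$ with $\mathcal{S}_\xi$-decomposition $E_1<\cdots<E_n$, $p^\xi_E=p^\xi_{E_n}$. Next, $q^{\xi,0}_E=1$ for $\varnothing\neq E\in\mathcal{S}_\xi$; if $\varnothing\neq E\in\mathcal{S}_{\zeta+1}[\mathcal{S}_\xi]$ has $\mathcal{S}_\zeta[\mathcal{S}_\xi]$-decomposition $F_1<\cdots<F_l$, $q^{\xi,\zeta+1}_E=q^{\xi,\zeta}_{F_l}/\sqrt{\min E}$; for $\zeta$ limit with characteristic sequence $(\zeta_n)$ and $\varnothing\neq E\in\mathcal{S}_\zeta[\mathcal{S}_\xi]$, $q^{\xi,\zeta}_E=q^{\xi,\zeta_{\min E}+1}_E$. For arbitrary non-empty finite $E$ with $\mathcal{S}_\zeta[\mathcal{S}_\xi]$-decomposition $F_1<\cdots<F_l$, $q^{\xi,\zeta}_E=q^{\xi,\zeta}_{F_l}$. Averages. A collection $\mathbf{u}=(u_E)_{E\in[\mathbb{N}]^{<\omega}\setminus\{\varnothing\}}$ in a Banach space $U$ is weakly null if for each $E\in[\mathbb{N}]^{<\omega}$ the sequence $(u_{E\frown(k)})_{k>E}$ is weakly null. For $M\in[\mathbb{N}]$, $n\in\mathbb{N}$,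 $\mathbb{E}^{(2)}_{\xi,\zeta,M}\mathbf{u}(n)=\sum_{M|_{\xi,\zeta,n-1}\prec E\preceq M|_{\xi,\zeta,n}}q^{\xi,\zeta}_Ep^\xi_Eu_E$, and $A\mathbb{E}^{(2)}_{\xi,\zeta,M}\mathbf{u}=(A\mathbb{E}^{(2)}_{\xi,\zeta,M}\mathbf{u}(n))_{n=1}^\infty$ for an operator $A$. For a sequence $(e_i)$ in a Banach space $E$, $\|(e_i)\|^w_1=\sup_{e^*\in B_{E^*}}\sum_i|\langle e^*,e_i\rangle|$. Properties. An operator $A:U\to V$ has the $\gamma$-$G_{\xi,\zeta}$ Property ($\gamma\geqslant0$) if for every weakly null collection $\mathbf{u}$ in $B_U$ and every $L\in[\mathbb{N}]$ there is $M\in[L]$ with $\|A\mathbb{E}^{(2)}_{\xi,\zeta,M}\mathbf{u}\|_1^w\leqslant\gamma$. $\mathbf{g}_{\xi,\zeta}(A)$ is the infimum of those $\gamma\geqslant 0$ for which $A$ has the $\gamma$-$G_{\xi,\zeta}$ Property, and $\infty$ if there is none. For a Banach space $U$, $\mathbf{g}_{\xi,\zeta}(U)=\mathbf{g}_{\xi,\zeta}(I_U)$. Function spaces. $C(\alpha)$ is the sup-normed space of continuous scalar functions on the ordinal interval $[0,\alpha]$ (order topology); $C_0(\omega^{\omega^\xi})=\{f\in C(\omega^{\omega^\xi}):f(\omega^{\omega^\xi})=0\}$. $\widehat{\otimes}_\pi$ is the completed projective tensor product. *)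

theory Defs
  imports "HOL-Analysis.Analysis" "HOL-Algebra.Module"
begin

section \<open>Countable ordinals\<close>

text \<open>
  The ordinals below \<open>\<omega>\<^sub>1\<close> are the elements of the successor cardinal of \<open>\<aleph>\<^sub>0\<close>, which the
  library provides as a well-order of minimal length among those of uncountable cardinality.
\<close>

typedef omega1 = "Field (cardSuc natLeq)"
proof -
  have "infinite (Field (cardSuc natLeq))"
    using cardSuc_finite[OF natLeq_Card_order] Field_natLeq by simp
  then show ?thesis by (metis finite.emptyI ex_in_conv)
qed

lemma cardSuc_natLeq_Well_order: "Well_order (cardSuc natLeq)"
  by (rule cardSuc_Well_order[OF natLeq_Card_order])

instantiation omega1 :: linorder
begin

definition less_eq_omega1 :: "omega1 \<Rightarrow> omega1 \<Rightarrow> bool" where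
  "\<alpha> \<le> \<beta> \<longleftrightarrow> (Rep_omega1 \<alpha>, Rep_omega1 \<beta>) \<in> cardSuc natLeq"

definition less_omega1 :: "omega1 \<Rightarrow> omega1 \<Rightarrow> bool" where
  "\<alpha> < \<beta> \<longleftrightarrow> \<alpha> \<le> \<beta> \<and> \<alpha> \<noteq> (\<beta>::omega1)"

instance
proof
  have W: "Refl (cardSuc natLeq)" "trans (cardSuc natLeq)" "antisym (cardSuc natLeq)"
    "Total (cardSuc natLeq)"
    using cardSuc_natLeq_Well_order
    by (auto simp: well_order_on_def linear_order_on_def partial_order_on_def preorder_on_def)
  fix x y z :: omega1
  show "x \<le> x"
    using W(1) Rep_omega1[of x] by (auto simp: less_eq_omega1_def refl_on_def)
  show antis: "x = y" if "x \<le> y" "y \<le> x"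
    using antisymD[OF W(3)] that by (simp add: less_eq_omega1_def flip: Rep_omega1_inject)
  show "x \<le> z" if "x \<le> y" "y \<le> z"
    using W(2) that unfolding less_eq_omega1_def trans_def by blast
  show "x < y \<longleftrightarrow> x \<le> y \<and> \<not> y \<le> x"
    using antisymD[OF W(3), of "Rep_omega1 x" "Rep_omega1 y"] \<open>x \<le> x\<close>
    by (auto simp: less_omega1_def less_eq_omega1_def Rep_omega1_inject)
  show "x \<le> y \<or> y \<le> x"
    using W(4) \<open>x \<le> x\<close> Rep_omega1[of x] Rep_omega1[of y]
    unfolding less_eq_omega1_def total_on_def by metis
qed

end

instance omega1 :: wellorder
proof
  have wf: "wf (cardSuc natLeq - Id)"
    using cardSuc_natLeq_Well_order by (simp add: well_order_on_def)
  have eq: "{(x, y::omega1). x < y} \<subseteq> inv_image (cardSuc natLeq - Id) Rep_omega1"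
    by (auto simp: less_omega1_def less_eq_omega1_def Rep_omega1_inject)
  have "wf {(x, y::omega1). x < y}"
    using wf_subset[OF wf_inv_image[OF wf] eq] .
  then show "P a" if "\<And>x. (\<And>y. y < x \<Longrightarrow> P y) \<Longrightarrow> P x" for P and a :: omega1
    using that by (metis (no_types, lifting) case_prodI mem_Collect_eq wf_def)
qed

lemma countable_atMost_omega1:
  includes cardinal_syntax
  shows "countable {..\<alpha>::omega1}"
proof -
  let ?r = "cardSuc natLeq"
  have C: "Card_order ?r" by (rule cardSuc_Card_order[OF natLeq_Card_order])
  have "|underS ?r (Rep_omega1 \<alpha>)| <o ?r"
    by (rule card_of_underS[OF C Rep_omega1])
  then have "|underS ?r (Rep_omega1 \<alpha>)| \<le>o natLeq"
    using cardSuc_ordLeq_ordLess[OF card_of_Card_order natLeq_Card_order] natLeq_Card_order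
    by (metis cardSuc_ordLeq_ordLess card_of_Card_order)
  then have "countable (underS ?r (Rep_omega1 \<alpha>))"
    by (metis card_of_nat card_of_ordLeq countableI ordIso_symmetric ordLeq_ordIso_trans)
  moreover have "Rep_omega1 ` {..<\<alpha>} \<subseteq> underS ?r (Rep_omega1 \<alpha>)"
    by (auto simp: underS_def less_omega1_def less_eq_omega1_def Rep_omega1_inject)
  ultimately have "countable {..<\<alpha>}"
    by (meson countable_image_inj_on countable_subset inj_onI Rep_omega1_inject)
  moreover have "{..\<alpha>} = insert \<alpha> {..<\<alpha>}" by auto
  ultimately show ?thesis by simp
qed

lemma uncountable_omega1:
  includes cardinal_syntax
  shows "uncountable (UNIV :: omega1 set)"
proof
  let ?r = "cardSuc natLeq"
  assume "countable (UNIV :: omega1 set)"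
  then have "countable (Rep_omega1 ` UNIV)" by (rule countable_image)
  then have "countable (Field ?r)"
    using type_definition.Rep_range[OF type_definition_omega1] by simp
  then have "|Field ?r| \<le>o natLeq"
    by (metis card_of_nat card_of_ordLeqI countableE top_greatest UNIV_I ordLeq_ordIso_trans)
  moreover have "|Field ?r| =o ?r"
    using card_of_Field_ordIso cardSuc_Card_order natLeq_Card_order by blast
  ultimately have "?r \<le>o natLeq"
    by (meson ordIso_ordLeq_trans ordIso_symmetric)
  then show False
    using cardSuc_greater[OF natLeq_Card_order] not_ordLess_ordLeq by blast
qed

lemma bdd_above_countable_omega1:
  fixes A :: "omega1 set"
  assumes "countable A"
  shows "\<exists>\<beta>. \<forall>\<alpha>\<in>A. \<alpha> < \<beta>"
proof (rule ccontr)
  assume "\<not> ?thesis"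
  then have "(UNIV :: omega1 set) = (\<Union>\<alpha>\<in>A. {..\<alpha>})"
    by (force simp: not_less)
  moreover have "countable (\<Union>\<alpha>\<in>A. {..\<alpha>})"
    using assms countable_atMost_omega1 by blast
  ultimately show False
    using uncountable_omega1 by simp
qed

instantiation omega1 :: conditionally_complete_linorder
begin

definition Sup_omega1 :: "omega1 set \<Rightarrow> omega1" where
  "Sup A = (LEAST \<beta>::omega1. \<forall>\<alpha>\<in>A. \<alpha> \<le> \<beta>)"

definition Inf_omega1 :: "omega1 set \<Rightarrow> omega1" where
  "Inf A = (LEAST \<alpha>::omega1. \<alpha> \<in> A)"

definition inf_omega1 :: "omega1 \<Rightarrow> omega1 \<Rightarrow> omega1" where "inf_omega1 = min"

definition sup_omega1 :: "omega1 \<Rightarrow> omega1 \<Rightarrow> omega1" where "sup_omega1 = max"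

instance
proof
  fix x y z :: omega1 and X :: "omega1 set"
  show "inf x y \<le> x" "inf x y \<le> y" "x \<le> y \<Longrightarrow> x \<le> z \<Longrightarrow> x \<le> inf y z"
    "x \<le> sup x y" "y \<le> sup x y" "y \<le> x \<Longrightarrow> z \<le> x \<Longrightarrow> sup y z \<le> x"
    by (auto simp: inf_omega1_def sup_omega1_def)
  show "Inf X \<le> x" if "x \<in> X"
    using that by (auto simp: Inf_omega1_def intro: Least_le)
  show "z \<le> Inf X" if "X \<noteq> {}" "\<And>x. x \<in> X \<Longrightarrow> z \<le> x"
    using that by (metis Inf_omega1_def LeastI ex_in_conv)
  show "x \<le> Sup X" if "x \<in> X" "bdd_above X"
    using that LeastI_ex[of "\<lambda>\<beta>. \<forall>\<alpha>\<in>X. \<alpha> \<le> \<beta>"]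
    unfolding bdd_above_def Sup_omega1_def by blast
  show "Sup X \<le> z" if "\<And>x. x \<in> X \<Longrightarrow> x \<le> z"
    using that by (auto simp: Sup_omega1_def intro: Least_le)
qed

end

instantiation omega1 :: linorder_topology
begin

definition open_omega1 :: "omega1 set \<Rightarrow> bool" where
  "open_omega1 = generate_topology (range (\<lambda>\<alpha>. {..<\<alpha>}) \<union> range (\<lambda>\<alpha>. {\<alpha><..}))"

instance by standard (simp add: open_omega1_def)

end

definition osucc :: "omega1 \<Rightarrow> omega1" where
  "osucc \<alpha> = (LEAST \<beta>. \<alpha> < \<beta>)"

lemma less_osucc: "\<alpha> < osucc \<alpha>"
  unfolding osucc_def
  using bdd_above_countable_omega1[of "{\<alpha>}"] by (metis LeastI_ex countable_insert countable_empty insertI1)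

lemma osucc_le_iff: "osucc \<alpha> \<le> \<beta> \<longleftrightarrow> \<alpha> < \<beta>"
  using less_osucc[of \<alpha>] by (auto simp: osucc_def intro: Least_le order_less_le_trans)

lemma osucc_inject: "osucc \<alpha> = osucc \<beta> \<longleftrightarrow> \<alpha> = \<beta>"
  by (metis linorder_less_linear not_le order_refl osucc_le_iff)

instantiation omega1 :: "{zero, one}"
begin

definition zero_omega1 :: omega1 where "0 = (LEAST \<alpha>::omega1. True)"
definition one_omega1 :: omega1 where "1 = osucc 0"

instance ..

end

lemma omega1_zero_le: "(0::omega1) \<le> \<alpha>"
  by (simp add: zero_omega1_def Least_le)

lemma osucc_neq_zero: "osucc \<alpha> \<noteq> 0"
  by (metis leD less_osucc omega1_zero_le)

definition limit_ord :: "omega1 \<Rightarrow> bool" where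
  "limit_ord \<alpha> \<longleftrightarrow> \<alpha> \<noteq> 0 \<and> (\<forall>\<beta>. \<alpha> \<noteq> osucc \<beta>)"

lemma osucc_less_limit: "limit_ord \<alpha> \<Longrightarrow> \<beta> < \<alpha> \<Longrightarrow> osucc \<beta> < \<alpha>"
  using osucc_le_iff[of \<beta> \<alpha>] by (auto simp: limit_ord_def order_less_le)

text \<open>
  Transfinite recursion: the value at \<open>0\<close>, the step at successors (given the predecessor and the
  value there), and the step at limits (given the limit and the function of all smaller values).
\<close>

definition ord_rec ::
  "'b \<Rightarrow> (omega1 \<Rightarrow> 'b \<Rightarrow> 'b) \<Rightarrow> (omega1 \<Rightarrow> (omega1 \<Rightarrow> 'b) \<Rightarrow> 'b) \<Rightarrow> omega1 \<Rightarrow> 'b" where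
  "ord_rec z s l = wfrec {(\<alpha>, \<beta>). \<alpha> < \<beta>} (\<lambda>f \<alpha>.
     if \<alpha> = 0 then z
     else if limit_ord \<alpha> then l \<alpha> f
     else (let \<beta> = (THE \<beta>. \<alpha> = osucc \<beta>) in s \<beta> (f \<beta>)))"

lemma ord_rec_zero: "ord_rec z s l 0 = z"
  unfolding ord_rec_def by (subst wfrec[OF wf]) simp

lemma ord_rec_osucc: "ord_rec z s l (osucc \<alpha>) = s \<alpha> (ord_rec z s l \<alpha>)"
proof -
  have "(THE \<beta>. osucc \<alpha> = osucc \<beta>) = \<alpha>" by (auto simp: osucc_inject)
  then show ?thesis
    unfolding ord_rec_def
    by (subst wfrec[OF wf]) (auto simp: osucc_neq_zero limit_ord_def less_osucc cut_def)
qed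

lemma ord_rec_limit:
  assumes "limit_ord \<alpha>" and "\<And>f g. (\<And>\<beta>. \<beta> < \<alpha> \<Longrightarrow> f \<beta> = g \<beta>) \<Longrightarrow> l \<alpha> f = l \<alpha> g"
  shows "ord_rec z s l \<alpha> = l \<alpha> (ord_rec z s l)"
  using assms(1) unfolding ord_rec_def
  by (subst wfrec[OF wf]) (auto simp: limit_ord_def cut_def intro!: assms(2))

instantiation omega1 :: "{plus, times}"
begin

definition plus_omega1 :: "omega1 \<Rightarrow> omega1 \<Rightarrow> omega1" where
  "\<alpha> + \<beta> = ord_rec \<alpha> (\<lambda>_ \<gamma>. osucc \<gamma>) (\<lambda>\<delta> f. SUP \<eta>\<in>{..<\<delta>}. f \<eta>) \<beta>"

definition times_omega1 :: "omega1 \<Rightarrow> omega1 \<Rightarrow> omega1" where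
  "\<alpha> * \<beta> = ord_rec 0 (\<lambda>_ \<gamma>. \<gamma> + \<alpha>) (\<lambda>\<delta> f. SUP \<eta>\<in>{..<\<delta>}. f \<eta>) \<beta>"

instance ..

end

text \<open>Ordinal exponentiation; the base is assumed to be non-zero.\<close>

definition opow :: "omega1 \<Rightarrow> omega1 \<Rightarrow> omega1" where
  "opow \<alpha> \<beta> = ord_rec 1 (\<lambda>_ \<gamma>. \<gamma> * \<alpha>) (\<lambda>\<delta> f. SUP \<eta>\<in>{..<\<delta>}. f \<eta>) \<beta>"

definition omega :: omega1 where
  "omega = (LEAST \<alpha>. limit_ord \<alpha>)"


section \<open>Families of finite sets of positive integers\<close>

text \<open>Throughout, \<open>\<nat>\<close> is \<open>{1, 2, \<dots>}\<close>, so the natural number \<open>0\<close> is excluded explicitly.\<close>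

definition fin_sets :: "nat set set" where
  "fin_sets = {E. finite E \<and> 0 \<notin> E}"

definition inf_subsets :: "nat set \<Rightarrow> nat set set" where
  "inf_subsets L = {M. M \<subseteq> L \<and> infinite M}"

definition set_less :: "nat set \<Rightarrow> nat set \<Rightarrow> bool" where
  "set_less E F \<longleftrightarrow> (\<forall>m\<in>E. \<forall>n\<in>F. m < n)"

definition init_seg :: "nat set \<Rightarrow> nat set \<Rightarrow> bool" where
  "init_seg E F \<longleftrightarrow> E \<subseteq> F \<and> (\<forall>m\<in>E. \<forall>n\<in>F. n \<le> m \<longrightarrow> n \<in> E)"

definition proper_init_seg :: "nat set \<Rightarrow> nat set \<Rightarrow> bool" where
  "proper_init_seg E F \<longleftrightarrow> init_seg E F \<and> E \<noteq> F"

definition maximal_sets :: "nat set set \<Rightarrow> nat set set" where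
  "maximal_sets \<F> = {E \<in> \<F>. \<forall>F\<in>\<F>. init_seg E F \<longrightarrow> F = E}"

definition schreier_step :: "nat set set \<Rightarrow> nat set set" where
  "schreier_step \<F> = {{}} \<union> {\<Union>(set Es) | Es. Es \<noteq> [] \<and> sorted_wrt set_less Es \<and>
     (\<forall>E\<in>set Es. E \<noteq> {} \<and> E \<in> \<F>) \<and> length Es \<le> Min (hd Es)}"

text \<open>
  \<open>\<kappa> \<xi>\<close> is the characteristic sequence \<open>(\<xi>\<^sub>n)\<close> of the limit ordinal \<open>\<xi>\<close>; its values at
  non-limit \<open>\<xi>\<close> and at the index \<open>n = 0\<close> are irrelevant.
\<close>

definition schreier :: "(omega1 \<Rightarrow> nat \<Rightarrow> omega1) \<Rightarrow> omega1 \<Rightarrow> nat set set" where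
  "schreier \<kappa> = ord_rec
     ({{}} \<union> {{n} | n. n \<ge> 1})
     (\<lambda>_ \<F>. schreier_step \<F>)
     (\<lambda>\<xi> S. {{}} \<union> {E \<in> fin_sets. E \<noteq> {} \<and> E \<in> S (osucc (\<kappa> \<xi> (Min E)))})"

definition characteristic_sequences :: "(omega1 \<Rightarrow> nat \<Rightarrow> omega1) \<Rightarrow> bool" where
  "characteristic_sequences \<kappa> \<longleftrightarrow> (\<forall>\<xi>. limit_ord \<xi> \<longrightarrow>
     (\<forall>n\<ge>1. \<kappa> \<xi> n < \<kappa> \<xi> (Suc n) \<and> \<kappa> \<xi> n < \<xi>) \<and>
     (SUP n\<in>{1..}. \<kappa> \<xi> n) = \<xi> \<and>
     (\<forall>n\<ge>1. schreier \<kappa> (osucc (\<kappa> \<xi> n)) \<subseteq> schreier \<kappa> (\<kappa> \<xi> (Suc n))))"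

definition fam_comp :: "nat set set \<Rightarrow> nat set set \<Rightarrow> nat set set" where
  "fam_comp \<G> \<F> = {{}} \<union> {\<Union>(set Es) | Es. Es \<noteq> [] \<and> sorted_wrt set_less Es \<and>
     (\<forall>E\<in>set Es. E \<noteq> {} \<and> E \<in> \<F>) \<and> Min ` set Es \<in> \<G>}"

text \<open>\<open>schreier2 \<kappa> \<xi> \<zeta>\<close> is \<open>S\<^sub>\<zeta>[S\<^sub>\<xi>]\<close>; the outer index \<open>\<zeta>\<close> comes second, as in the weights.\<close>

definition schreier2 :: "(omega1 \<Rightarrow> nat \<Rightarrow> omega1) \<Rightarrow> omega1 \<Rightarrow> omega1 \<Rightarrow> nat set set" where
  "schreier2 \<kappa> \<xi> \<zeta> = fam_comp (schreier \<kappa> \<zeta>) (schreier \<kappa> \<xi>)"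

definition decomp :: "nat set set \<Rightarrow> nat set \<Rightarrow> nat set list" where
  "decomp \<F> E = (THE Fs. Fs \<noteq> [] \<and> sorted_wrt set_less Fs \<and> \<Union>(set Fs) = E \<and>
     set (butlast Fs) \<subseteq> maximal_sets \<F> \<and> last Fs \<in> \<F> \<and> last Fs \<noteq> {})"

text \<open>For infinite \<open>M\<close> the decomposition \<open>F\<^sub>1 < F\<^sub>2 < \<dots>\<close> is indexed from \<open>0\<close>.\<close>

definition inf_decomp :: "nat set set \<Rightarrow> nat set \<Rightarrow> nat \<Rightarrow> nat set" where
  "inf_decomp \<F> M = (THE F. (\<forall>k. F k \<in> maximal_sets \<F>) \<and> (\<forall>j k. j < k \<longrightarrow> set_less (F j) (F k)) \<and>
     (\<Union>k. F k) = M)"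

definition segment ::
  "(omega1 \<Rightarrow> nat \<Rightarrow> omega1) \<Rightarrow> omega1 \<Rightarrow> omega1 \<Rightarrow> nat set \<Rightarrow> nat \<Rightarrow> nat set" where
  "segment \<kappa> \<xi> \<zeta> M n = (\<Union>k<n. inf_decomp (schreier2 \<kappa> \<xi> \<zeta>) M k)"

lemma schreier_zero: "schreier \<kappa> 0 = {{}} \<union> {{n} | n. n \<ge> 1}"
  by (simp add: schreier_def ord_rec_zero)

lemma schreier_osucc: "schreier \<kappa> (osucc \<xi>) = schreier_step (schreier \<kappa> \<xi>)"
  by (simp add: schreier_def ord_rec_osucc)

lemma schreier_limit:
  assumes "limit_ord \<xi>" and "\<And>n. n \<ge> 1 \<Longrightarrow> \<kappa> \<xi> n < \<xi>"
  shows "schreier \<kappa> \<xi> =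
    {{}} \<union> {E \<in> fin_sets. E \<noteq> {} \<and> E \<in> schreier \<kappa> (osucc (\<kappa> \<xi> (Min E)))}"
proof -
  have *: "osucc (\<kappa> \<xi> (Min E)) < \<xi>" if "E \<in> fin_sets" "E \<noteq> {}" for E
  proof -
    have "Min E \<in> E" "0 \<notin> E" using that by (auto simp: fin_sets_def)
    then have "Min E \<noteq> 0" by metis
    then show ?thesis by (intro osucc_less_limit assms) simp_all
  qed
  show ?thesis
    unfolding schreier_def
    by (subst ord_rec_limit[OF assms(1)])
      (use * in \<open>blast intro: arg_cong[where f = "\<lambda>S. _ \<in> S"]
          | (intro arg_cong2[where f = "(\<union>)"] Collect_cong refl, metis)\<close>)+
qed


section \<open>Weights\<close>

text \<open>
  The functions with suffix \<open>0\<close> are meaningful for non-empty members of the respective family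
  only; the others extend them to all non-empty finite sets.
\<close>

definition pw0 :: "(omega1 \<Rightarrow> nat \<Rightarrow> omega1) \<Rightarrow> omega1 \<Rightarrow> nat set \<Rightarrow> real" where
  "pw0 \<kappa> = ord_rec
     (\<lambda>E. 1)
     (\<lambda>\<xi> p E. p (last (decomp (schreier \<kappa> \<xi>) E)) / real (Min E))
     (\<lambda>\<xi> P E. P (osucc (\<kappa> \<xi> (Min E))) E)"

definition pw :: "(omega1 \<Rightarrow> nat \<Rightarrow> omega1) \<Rightarrow> omega1 \<Rightarrow> nat set \<Rightarrow> real" where
  "pw \<kappa> \<xi> E = pw0 \<kappa> \<xi> (last (decomp (schreier \<kappa> \<xi>) E))"

definition qw0 :: "(omega1 \<Rightarrow> nat \<Rightarrow> omega1) \<Rightarrow> omega1 \<Rightarrow> omega1 \<Rightarrow> nat set \<Rightarrow> real" where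
  "qw0 \<kappa> \<xi> = ord_rec
     (\<lambda>E. 1)
     (\<lambda>\<zeta> q E. q (last (decomp (schreier2 \<kappa> \<xi> \<zeta>) E)) / sqrt (real (Min E)))
     (\<lambda>\<zeta> Q E. Q (osucc (\<kappa> \<zeta> (Min E))) E)"

definition qw :: "(omega1 \<Rightarrow> nat \<Rightarrow> omega1) \<Rightarrow> omega1 \<Rightarrow> omega1 \<Rightarrow> nat set \<Rightarrow> real" where
  "qw \<kappa> \<xi> \<zeta> E = qw0 \<kappa> \<xi> \<zeta> (last (decomp (schreier2 \<kappa> \<xi> \<zeta>) E))"


section \<open>Normed spaces over a scalar field\<close>

text \<open>
  A normed space over the scalar field \<open>'k\<close> (below, \<open>real\<close> or \<open>complex\<close>) is a record of carrier,
  vector space operations and norm. The ring multiplication and unit inherited from the module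
  record play no role.
\<close>

record ('k, 'a) nspace = "('k, 'a) module" +
  nrm :: "'a \<Rightarrow> real"

definition bounded_functionals :: "('k::real_normed_field, 'a) nspace \<Rightarrow> ('a \<Rightarrow> 'k) set" where
  "bounded_functionals U = {\<phi>.
     (\<forall>x\<in>carrier U. \<forall>y\<in>carrier U. \<phi> (x \<oplus>\<^bsub>U\<^esub> y) = \<phi> x + \<phi> y) \<and>
     (\<forall>c. \<forall>x\<in>carrier U. \<phi> (c \<odot>\<^bsub>U\<^esub> x) = c * \<phi> x) \<and>
     (\<exists>C. \<forall>x\<in>carrier U. norm (\<phi> x) \<le> C * nrm U x)}"

definition dual_ball :: "('k::real_normed_field, 'a) nspace \<Rightarrow> ('a \<Rightarrow> 'k) set" where
  "dual_ball U = {\<phi> \<in> bounded_functionals U. \<forall>x\<in>carrier U. norm (\<phi> x) \<le> nrm U x}"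

definition weakly_null_seq :: "('k::real_normed_field, 'a) nspace \<Rightarrow> (nat \<Rightarrow> 'a) \<Rightarrow> bool" where
  "weakly_null_seq U x \<longleftrightarrow> (\<forall>\<phi>\<in>bounded_functionals U. (\<lambda>k. \<phi> (x k)) \<longlonglongrightarrow> 0)"

definition weak_l1_norm :: "('k::real_normed_field, 'a) nspace \<Rightarrow> (nat \<Rightarrow> 'a) \<Rightarrow> ennreal" where
  "weak_l1_norm U e = (SUP \<phi>\<in>dual_ball U. \<Sum>i. ennreal (norm (\<phi> (e i))))"


section \<open>Averages and the G property\<close>

text \<open>For fixed \<open>E\<close>, weak nullity only concerns large \<open>k\<close>, so the values at \<open>k \<le> max E\<close> do not matter.\<close>

definition weakly_null_collection ::
  "('k::real_normed_field, 'a) nspace \<Rightarrow> (nat set \<Rightarrow> 'a) \<Rightarrow> bool" where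
  "weakly_null_collection U u \<longleftrightarrow>
     (\<forall>E\<in>fin_sets. weakly_null_seq U (\<lambda>k. u (insert k E)))"

definition collection_in_ball :: "('k, 'a) nspace \<Rightarrow> (nat set \<Rightarrow> 'a) \<Rightarrow> bool" where
  "collection_in_ball U u \<longleftrightarrow>
     (\<forall>E\<in>fin_sets - {{}}. u E \<in> carrier U \<and> nrm U (u E) \<le> 1)"

text \<open>\<open>avg2\<close> is \<open>\<bbbE>\<^sup>(\<^sup>2\<^sup>)\<close>; its index \<open>n\<close> ranges over \<open>n \<ge> 1\<close>.\<close>

definition avg2 ::
  "(omega1 \<Rightarrow> nat \<Rightarrow> omega1) \<Rightarrow> omega1 \<Rightarrow> omega1 \<Rightarrow> ('k::real_normed_field, 'a) nspace \<Rightarrow>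
   nat set \<Rightarrow> (nat set \<Rightarrow> 'a) \<Rightarrow> nat \<Rightarrow> 'a" where
  "avg2 \<kappa> \<xi> \<zeta> U M u n =
     (\<Oplus>\<^bsub>U\<^esub>E\<in>{E. proper_init_seg (segment \<kappa> \<xi> \<zeta> M (n - 1)) E \<and> init_seg E (segment \<kappa> \<xi> \<zeta> M n)}.
        of_real (qw \<kappa> \<xi> \<zeta> E * pw \<kappa> \<xi> E) \<odot>\<^bsub>U\<^esub> u E)"

text \<open>Here \<open>U\<close>, \<open>V\<close> are meant to be Banach spaces and \<open>A\<close> a bounded linear operator from \<open>U\<close> to \<open>V\<close>.\<close>

definition G_property ::
  "(omega1 \<Rightarrow> nat \<Rightarrow> omega1) \<Rightarrow> omega1 \<Rightarrow> omega1 \<Rightarrow> ('k::real_normed_field, 'a) nspace \<Rightarrow>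
   ('k, 'b) nspace \<Rightarrow> ('a \<Rightarrow> 'b) \<Rightarrow> real \<Rightarrow> bool" where
  "G_property \<kappa> \<xi> \<zeta> U V A \<gamma> \<longleftrightarrow>
     (\<forall>u. weakly_null_collection U u \<and> collection_in_ball U u \<longrightarrow>
       (\<forall>L\<in>inf_subsets {1..}. \<exists>M\<in>inf_subsets L.
          weak_l1_norm V (\<lambda>i. A (avg2 \<kappa> \<xi> \<zeta> U M u (Suc i))) \<le> ennreal \<gamma>))"

text \<open>The infimum is taken in \<open>[0, \<infinity>]\<close>, where the infimum of the empty set is \<open>\<infinity>\<close>.\<close>

definition g_op ::
  "(omega1 \<Rightarrow> nat \<Rightarrow> omega1) \<Rightarrow> omega1 \<Rightarrow> omega1 \<Rightarrow> ('k::real_normed_field, 'a) nspace \<Rightarrow>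
   ('k, 'b) nspace \<Rightarrow> ('a \<Rightarrow> 'b) \<Rightarrow> ennreal" where
  "g_op \<kappa> \<xi> \<zeta> U V A = Inf {ennreal \<gamma> | \<gamma>. \<gamma> \<ge> 0 \<and> G_property \<kappa> \<xi> \<zeta> U V A \<gamma>}"

definition g_space ::
  "(omega1 \<Rightarrow> nat \<Rightarrow> omega1) \<Rightarrow> omega1 \<Rightarrow> omega1 \<Rightarrow> ('k::real_normed_field, 'a) nspace \<Rightarrow> ennreal" where
  "g_space \<kappa> \<xi> \<zeta> U = g_op \<kappa> \<xi> \<zeta> U U (\<lambda>x. x)"


section \<open>Spaces of continuous functions on ordinal intervals\<close>

text \<open>
  Functions on \<open>[0, \<alpha>]\<close> are represented by their extensions by \<open>0\<close>. The order topology of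
  \<open>[0, \<alpha>]\<close> is the one induced from \<open>omega1\<close>.
\<close>

definition C_space :: "omega1 \<Rightarrow> ('k::real_normed_field, omega1 \<Rightarrow> 'k) nspace" where
  "C_space \<alpha> = \<lparr>
     carrier = {f. continuous_on {..\<alpha>} f \<and> (\<forall>\<beta>. \<alpha> < \<beta> \<longrightarrow> f \<beta> = 0)},
     mult = undefined, one = undefined,
     zero = (\<lambda>\<beta>. 0),
     add = (\<lambda>f g \<beta>. f \<beta> + g \<beta>),
     smult = (\<lambda>c f \<beta>. c * f \<beta>),
     nrm = (\<lambda>f. SUP \<beta>\<in>{..\<alpha>}. norm (f \<beta>)) \<rparr>"

definition C0_space :: "omega1 \<Rightarrow> ('k::real_normed_field, omega1 \<Rightarrow> 'k) nspace" where
  "C0_space \<alpha> = (C_space \<alpha>)\<lparr>carrier := {f \<in> carrier (C_space \<alpha>). f \<alpha> = 0}\<rparr>"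


section \<open>The completed projective tensor product\<close>

definition bilinear_forms ::
  "('k::real_normed_field, 'a) nspace \<Rightarrow> ('k, 'b) nspace \<Rightarrow> ('a \<Rightarrow> 'b \<Rightarrow> 'k) set" where
  "bilinear_forms X Y = {B.
     (\<forall>x\<in>carrier X. \<forall>x'\<in>carrier X. \<forall>y\<in>carrier Y. B (x \<oplus>\<^bsub>X\<^esub> x') y = B x y + B x' y) \<and>
     (\<forall>x\<in>carrier X. \<forall>y\<in>carrier Y. \<forall>y'\<in>carrier Y. B x (y \<oplus>\<^bsub>Y\<^esub> y') = B x y + B x y') \<and>
     (\<forall>c. \<forall>x\<in>carrier X. \<forall>y\<in>carrier Y. B (c \<odot>\<^bsub>X\<^esub> x) y = c * B x y \<and> B x (c \<odot>\<^bsub>Y\<^esub> y) = c * B x y)}"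

text \<open>
  The algebraic tensor product, realised as usual inside the algebraic dual of the space of all
  bilinear forms, with \<open>x \<otimes> y\<close> acting as \<open>B \<mapsto> B x y\<close>. A list of pairs represents the sum of the
  corresponding elementary tensors; scalar coefficients are absorbed in the first factor.
\<close>

definition tensor_sum ::
  "('k::real_normed_field, 'a) nspace \<Rightarrow> ('k, 'b) nspace \<Rightarrow> ('a \<times> 'b) list \<Rightarrow> ('a \<Rightarrow> 'b \<Rightarrow> 'k) \<Rightarrow> 'k" where
  "tensor_sum X Y ps = (\<lambda>B. if B \<in> bilinear_forms X Y then \<Sum>(x, y)\<leftarrow>ps. B x y else 0)"

definition proj_tensor_alg ::
  "('k::real_normed_field, 'a) nspace \<Rightarrow> ('k, 'b) nspace \<Rightarrow> ('k, ('a \<Rightarrow> 'b \<Rightarrow> 'k) \<Rightarrow> 'k) nspace" where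
  "proj_tensor_alg X Y = \<lparr>
     carrier = {tensor_sum X Y ps | ps. set ps \<subseteq> carrier X \<times> carrier Y},
     mult = undefined, one = undefined,
     zero = (\<lambda>B. 0),
     add = (\<lambda>u v B. u B + v B),
     smult = (\<lambda>c u B. c * u B),
     nrm = (\<lambda>u. Inf {\<Sum>(x, y)\<leftarrow>ps. nrm X x * nrm Y y | ps.
              set ps \<subseteq> carrier X \<times> carrier Y \<and> tensor_sum X Y ps = u}) \<rparr>"

text \<open>The completion of a normed space: Cauchy sequences modulo null sequences.\<close>

definition cauchy_seqs :: "('k::real_normed_field, 'a) nspace \<Rightarrow> (nat \<Rightarrow> 'a) set" where
  "cauchy_seqs N = {s. (\<forall>n. s n \<in> carrier N) \<and>
     (\<forall>e>0. \<exists>K. \<forall>m\<ge>K. \<forall>n\<ge>K. nrm N (s m \<ominus>\<^bsub>N\<^esub> s n) < e)}"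

definition null_diff_rel :: "('k::real_normed_field, 'a) nspace \<Rightarrow> (nat \<Rightarrow> 'a) rel" where
  "null_diff_rel N = {(s, t). s \<in> cauchy_seqs N \<and> t \<in> cauchy_seqs N \<and>
     (\<lambda>n. nrm N (s n \<ominus>\<^bsub>N\<^esub> t n)) \<longlonglongrightarrow> 0}"

definition completion :: "('k::real_normed_field, 'a) nspace \<Rightarrow> ('k, (nat \<Rightarrow> 'a) set) nspace" where
  "completion N = \<lparr>
     carrier = cauchy_seqs N // null_diff_rel N,
     mult = undefined, one = undefined,
     zero = null_diff_rel N `` {\<lambda>n. \<zero>\<^bsub>N\<^esub>},
     add = (\<lambda>S T. \<Union>s\<in>S. \<Union>t\<in>T. null_diff_rel N `` {\<lambda>n. s n \<oplus>\<^bsub>N\<^esub> t n}),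
     smult = (\<lambda>c S. \<Union>s\<in>S. null_diff_rel N `` {\<lambda>n. c \<odot>\<^bsub>N\<^esub> s n}),
     nrm = (\<lambda>S. THE r. \<exists>s\<in>S. (\<lambda>n. nrm N (s n)) \<longlonglongrightarrow> r) \<rparr>"

definition proj_tensor ::
  "('k::real_normed_field, 'a) nspace \<Rightarrow> ('k, 'b) nspace \<Rightarrow>
   ('k, (nat \<Rightarrow> ('a \<Rightarrow> 'b \<Rightarrow> 'k) \<Rightarrow> 'k) set) nspace" (infixl \<open>\<otimes>\<^sub>\<pi>\<close> 70) where
  "X \<otimes>\<^sub>\<pi> Y = completion (proj_tensor_alg X Y)"

end

theory Submission
  imports Defs
begin

text \<open>
  Let \<open>u E = f E \<otimes> g E\<close> for \<open>E\<close> in \<open>S\<^sub>1\<^sub>+\<^sub>\<zeta>[S\<^sub>\<xi>]\<close>. Here \<open>f E\<close> is the indicator of a clopen interval attached to the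
  last \<open>S\<^sub>\<xi>\<close>-block of \<open>E\<close>; these intervals form a tree isomorphic to \<open>S\<^sub>\<xi>\<close>, which has rank \<open>\<omega>\<^sup>\<xi>\<close> and
  so fits into \<open>C\<^sub>0(\<omega>^\<omega>^\<xi>)\<close>. The function \<open>g E\<close> is a Rademacher function depending only on the blocks: whenever a
  new \<open>S\<^sub>1[S\<^sub>\<xi>]\<close>-block with minimum \<open>n\<close> begins, all sign patterns for its at most \<open>n\<close> many \<open>S\<^sub>\<xi>\<close>-blocks are reserved at
  once, so that only the tree of these beginnings matters, and its rank is at most \<open>\<omega>\<^sup>\<zeta>\<close>.

  On a maximal \<open>G\<close>, let \<open>B x y\<close> be the sum over the \<open>S\<^sub>\<xi>\<close>-blocks of \<open>G\<close> of \<open>q \<cdot> x(\<beta>) \<cdot> \<integral> r y\<close>, where \<open>\<beta>\<close> is a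
  point in the interval of the block and \<open>r\<close> its Rademacher function. As the squares of the \<open>q\<close> sum to one,
  Bessel's inequality gives \<open>\<parallel>B\<parallel> \<le> 1\<close>, and \<open>B\<close> takes the value \<open>\<Sum> q\<^sup>2 p = 1\<close> on the first average, for every \<open>M\<close>.
  The collection is weakly null because, for \<open>E\<close> fixed and \<open>k\<close> varying, the first factors of \<open>u (E \<union> {k})\<close> are
  disjointly supported, while the second ones are either equal or disjointly supported.
\<close>

section \<open>Arithmetic of countable ordinals\<close>

text \<open>The families carry the index 1 + \<zeta>, the second space only \<zeta>. If each
  S_\<xi>-block chose its sign when it begins, the ranking of the sign tree would start at
  \<omega>^(1+\<zeta>), which is too large when \<zeta> is finite. Reserving signs is possible
  because the minimum of an S_1[S_\<xi>]-block, known at its first element, bounds the number of its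
  S_\<xi>-blocks; re-indexing the families from index 1 then removes the extra factor \<omega>.
  Since q divides by a square root, its square satisfies the same recursion as p: dividing by the
  minimum cancels against the number of blocks of a maximal set. One factor q comes from the
  average, the other from the form. Functionals on the projective tensor product are treated as
  bilinear forms. For factors of norm at most one with disjoint supports, scalars of modulus one
  give a uniform bound on the sums of |B(f_k, g_k)|, so weak nullity follows from absolute
  summability. Three recursions (S_\<xi>, S_\<zeta>[S_\<xi>], and the latter shifted by 1) are
  instances of one abstract \<open>ladder\<close>, over which ranks, weights and alignment of blocks
  are studied once.\<close>

lemma omega1_induct [case_names zero succ limit]:
  fixes \<alpha> :: omega1
  assumes "P 0" "\<And>\<beta>. P \<beta> \<Longrightarrow> P (osucc \<beta>)"
    "\<And>\<delta>. limit_ord \<delta> \<Longrightarrow> (\<And>\<eta>. \<eta> < \<delta> \<Longrightarrow> P \<eta>) \<Longrightarrow> P \<delta>"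
  shows "P \<alpha>"
proof (induction \<alpha> rule: less_induct)
  case (less \<alpha>)
  then show ?case
    using assms less_osucc unfolding limit_ord_def by metis
qed

lemma less_osucc_iff: "\<alpha> < osucc \<beta> \<longleftrightarrow> \<alpha> \<le> \<beta>"
  using osucc_le_iff[of \<beta> \<alpha>] by auto

lemma osucc_mono: "\<alpha> < \<beta> \<Longrightarrow> osucc \<alpha> < osucc \<beta>"
  by (simp add: less_osucc_iff osucc_le_iff)

lemma limit_pos: "limit_ord \<delta> \<Longrightarrow> 0 < \<delta>"
  using omega1_zero_le[of \<delta>] by (auto simp: limit_ord_def order_less_le)

lemma not_less_zero: "\<not> \<alpha> < (0::omega1)"
  using omega1_zero_le[of \<alpha>] by auto

lemma less_one_iff: "\<alpha> < (1::omega1) \<longleftrightarrow> \<alpha> = 0"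
  using omega1_zero_le[of \<alpha>] by (auto simp: one_omega1_def less_osucc_iff)

lemma bdd_above_image_omega1:
  fixes f :: "omega1 \<Rightarrow> omega1"
  shows "bdd_above (f ` {..<\<delta>})"
proof -
  have "countable {..<\<delta>}"
    using countable_atMost_omega1[of \<delta>] by (rule countable_subset[rotated]) auto
  then obtain \<beta> where "\<forall>\<alpha>\<in>f ` {..<\<delta>}. \<alpha> < \<beta>"
    using bdd_above_countable_omega1[OF countable_image] by blast
  then show ?thesis by (auto intro!: bdd_aboveI[of _ \<beta>] less_imp_le)
qed

lemma ord_rec_SUP:
  assumes "limit_ord \<delta>"
  shows "ord_rec z s (\<lambda>\<delta> f. SUP \<eta>\<in>{..<\<delta>}. f \<eta>) \<delta>
    = (SUP \<eta>\<in>{..<\<delta>}. ord_rec z s (\<lambda>\<delta> f. SUP \<eta>\<in>{..<\<delta>}. f \<eta>) \<eta>)"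
proof (rule ord_rec_limit[OF assms])
  fix f g :: "omega1 \<Rightarrow> 'a"
  assume "\<And>\<beta>. \<beta> < \<delta> \<Longrightarrow> f \<beta> = g \<beta>"
  then have "f ` {..<\<delta>} = g ` {..<\<delta>}" by (intro image_cong) auto
  then show "(SUP \<eta>\<in>{..<\<delta>}. f \<eta>) = (SUP \<eta>\<in>{..<\<delta>}. g \<eta>)" by simp
qed

text \<open>The classical normal functions. Growth is required across successors only; continuity at
  limits upgrades it to strict monotonicity. Addition, multiplication and powers of
  \<open>omega\<close>, as functions of the right argument, are all instances, so their limit cases
  are handled together.\<close>

definition normal_function :: "(omega1 \<Rightarrow> omega1) \<Rightarrow> bool" where
  "normal_function \<phi> \<longleftrightarrow> (\<forall>\<beta>. \<phi> \<beta> < \<phi> (osucc \<beta>)) \<and> (\<forall>\<delta>. limit_ord \<delta> \<longrightarrow> \<phi> \<delta> = (SUP \<eta>\<in>{..<\<delta>}. \<phi> \<eta>))"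

lemma normal_mono:
  assumes "normal_function \<phi>" "\<beta> < \<gamma>"
  shows "\<phi> \<beta> < \<phi> \<gamma>"
  using assms(2)
proof (induction \<gamma> rule: omega1_induct)
  case zero
  then show ?case using not_less_zero by blast
next
  case (succ \<gamma>)
  then show ?case
    using assms(1) unfolding normal_function_def less_osucc_iff by (metis order_le_less order_less_trans)
next
  case (limit \<delta>)
  have "\<phi> (osucc \<beta>) \<le> (SUP \<eta>\<in>{..<\<delta>}. \<phi> \<eta>)"
    using limit osucc_less_limit by (intro cSUP_upper bdd_above_image_omega1) auto
  then show ?case
    using assms(1) limit(1) unfolding normal_function_def by (metis order_less_le_trans)
qed

lemma normal_less_limit:
  assumes "normal_function \<phi>" "limit_ord \<delta>" "x < \<phi> \<delta>"
  shows "\<exists>\<eta><\<delta>. x < \<phi> \<eta>"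
proof -
  have "x < (SUP \<eta>\<in>{..<\<delta>}. \<phi> \<eta>)" using assms unfolding normal_function_def by auto
  moreover have "{..<\<delta>} \<noteq> {}" using limit_pos[OF assms(2)] by auto
  ultimately show ?thesis by (auto simp: less_cSUP_iff bdd_above_image_omega1)
qed

lemma normal_limit:
  assumes "normal_function \<phi>" "limit_ord \<delta>"
  shows "limit_ord (\<phi> \<delta>)"
  unfolding limit_ord_def
proof (intro conjI allI)
  have "\<phi> 0 < \<phi> \<delta>" using assms limit_pos normal_mono by blast
  then show "\<phi> \<delta> \<noteq> 0" using not_less_zero by metis
  show "\<phi> \<delta> \<noteq> osucc \<beta>" for \<beta>
  proof
    assume *: "\<phi> \<delta> = osucc \<beta>"
    then obtain \<eta> where "\<eta> < \<delta>" "\<beta> < \<phi> \<eta>"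
      using normal_less_limit[OF assms, of \<beta>] less_osucc by auto
    then show False
      using normal_mono[OF assms(1) \<open>\<eta> < \<delta>\<close>] * by (metis less_osucc_iff not_le)
  qed
qed

section \<open>Ordinal addition\<close>

lemma plus_zero: "\<alpha> + 0 = (\<alpha>::omega1)"
  by (simp add: plus_omega1_def ord_rec_zero)

lemma plus_osucc: "\<alpha> + osucc \<beta> = osucc (\<alpha> + \<beta>)"
  by (simp add: plus_omega1_def ord_rec_osucc)

lemma plus_limit: "limit_ord \<delta> \<Longrightarrow> \<alpha> + \<delta> = (SUP \<eta>\<in>{..<\<delta>}. \<alpha> + \<eta>)"
  unfolding plus_omega1_def by (rule ord_rec_SUP)

lemma normal_plus: "normal_function ((+) \<alpha>)"
  by (simp add: normal_function_def plus_osucc plus_limit less_osucc)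

lemma plus_less_mono: "\<beta> < \<gamma> \<Longrightarrow> \<alpha> + \<beta> < \<alpha> + (\<gamma>::omega1)"
  using normal_mono[OF normal_plus] .

lemma plus_le_mono: "\<beta> \<le> \<gamma> \<Longrightarrow> \<alpha> + \<beta> \<le> \<alpha> + (\<gamma>::omega1)"
  by (metis order_le_less plus_less_mono)

lemma plus_ge_left: "\<alpha> \<le> \<alpha> + (\<beta>::omega1)"
  using plus_le_mono[OF omega1_zero_le, of \<alpha> \<beta>] by (simp add: plus_zero)

lemma plus_le_mono_left: "\<alpha> \<le> \<beta> \<Longrightarrow> \<alpha> + \<gamma> \<le> \<beta> + (\<gamma>::omega1)"
proof (induction \<gamma> rule: omega1_induct)
  case (succ \<gamma>)
  then show ?case by (metis leD leI less_osucc_iff osucc_le_iff plus_osucc)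
next
  case (limit \<delta>)
  have "(SUP \<eta>\<in>{..<\<delta>}. \<alpha> + \<eta>) \<le> (SUP \<eta>\<in>{..<\<delta>}. \<beta> + \<eta>)"
    using limit limit_pos[OF limit(1)] by (intro cSUP_mono bdd_above_image_omega1) auto
  then show ?case using limit by (simp add: plus_limit)
qed (simp add: plus_zero)

lemma zero_plus: "0 + \<alpha> = (\<alpha>::omega1)"
proof (induction \<alpha> rule: omega1_induct)
  case (limit \<delta>)
  \<comment> \<open>A strictly increasing map of ordinals never drops below the identity. At a limit
    the induction hypothesis alone only gives the opposite inequality.\<close>
  have "x \<le> 0 + x" for x :: omega1
  proof (induction x rule: omega1_induct)
    case (succ \<beta>)
    then show ?case by (metis less_osucc_iff not_le osucc_le_iff plus_osucc)
  next
    case (limit x)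
    show ?case
    proof (rule ccontr)
      assume "\<not> ?thesis"
      then have "0 + x < x" by simp
      then have "osucc (0 + x) < x" using limit osucc_less_limit by blast
      then have "osucc (0 + x) \<le> 0 + osucc (0 + x)" "0 + osucc (0 + x) < 0 + x"
        using limit plus_less_mono by auto
      then have "osucc (0 + x) < 0 + x" by simp
      then show False using less_osucc[of "0 + x"] by simp
    qed
  qed (simp add: plus_zero)
  moreover have "0 + \<delta> \<le> \<delta>"
    unfolding plus_limit[OF limit(1)]
    using limit limit_pos[OF limit(1)] by (intro cSUP_least) auto
  ultimately show ?case by (simp add: order_antisym)
qed (simp_all add: plus_zero plus_osucc)

lemma plus_assoc_omega1: "(\<alpha> + \<beta>) + \<gamma> = \<alpha> + (\<beta> + (\<gamma>::omega1))"
proof (induction \<gamma> rule: omega1_induct)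
  case (limit \<delta>)
  have L: "limit_ord (\<beta> + \<delta>)" using normal_limit[OF normal_plus limit(1)] .
  have "\<alpha> + (\<beta> + \<delta>) \<le> (\<alpha> + \<beta>) + \<delta>"
  proof (rule ccontr)
    assume "\<not> ?thesis"
    then obtain x where x: "x < \<beta> + \<delta>" "(\<alpha> + \<beta>) + \<delta> < \<alpha> + x"
      using normal_less_limit[OF normal_plus L] by (auto simp: not_le)
    then obtain \<eta> where "\<eta> < \<delta>" "x < \<beta> + \<eta>"
      using normal_less_limit[OF normal_plus limit(1)] by blast
    then have "\<alpha> + x < (\<alpha> + \<beta>) + \<eta>" "(\<alpha> + \<beta>) + \<eta> < (\<alpha> + \<beta>) + \<delta>"
      using plus_less_mono limit(2)[OF \<open>\<eta> < \<delta>\<close>] \<open>\<eta> < \<delta>\<close> by metis+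
    then show False using x by simp
  qed
  moreover have "(\<alpha> + \<beta>) + \<delta> \<le> \<alpha> + (\<beta> + \<delta>)"
    unfolding plus_limit[OF limit(1), of "\<alpha> + \<beta>"]
    using limit limit_pos[OF limit(1)] plus_less_mono
    by (intro cSUP_least) (auto intro!: less_imp_le)
  ultimately show ?case by simp
qed (simp_all add: plus_zero plus_osucc)

lemma one_plus_limit:
  assumes "limit_ord \<delta>"
  shows "1 + \<delta> = (\<delta>::omega1)"
proof (rule order_antisym)
  \<comment> \<open>Adding 1 on the left costs at most one successor, which a limit absorbs.\<close>
  have *: "1 + \<eta> \<le> osucc \<eta>" for \<eta>
  proof (induction \<eta> rule: omega1_induct)
    case (limit \<delta>)
    show ?case unfolding plus_limit[OF limit(1)]
    proof (rule cSUP_least)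
      show "1 + x \<le> osucc \<delta>" if "x \<in> {..<\<delta>}" for x
        using limit(2)[of x] that osucc_mono[of x \<delta>] by (simp add: order_trans less_imp_le)
    qed (use limit_pos[OF limit(1)] in auto)
  qed (simp_all add: plus_zero one_omega1_def plus_osucc osucc_le_iff less_osucc_iff)
  show "1 + \<delta> \<le> \<delta>" unfolding plus_limit[OF assms]
  proof (rule cSUP_least)
    show "1 + x \<le> \<delta>" if "x \<in> {..<\<delta>}" for x
      using that osucc_less_limit[OF assms, of x] *[of x] by simp
  qed (use limit_pos[OF assms] in auto)
  show "\<delta> \<le> 1 + \<delta>"
    using plus_le_mono_left[OF omega1_zero_le, of \<delta> 1] by (simp add: zero_plus)
qed

text \<open>Serves to rewrite nonzero indices as 1 + \<eta>; the bound \<eta> \<le> \<alpha> keeps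
  re-indexed sequences below their limits.\<close>

lemma one_plus_surj:
  fixes \<alpha> :: omega1
  assumes "\<alpha> \<noteq> 0"
  shows "\<exists>\<eta>\<le>\<alpha>. 1 + \<eta> = \<alpha>"
  using assms
proof (induction \<alpha> rule: omega1_induct)
  case (succ \<beta>)
  show ?case
  proof (cases "\<beta> = 0")
    case True
    then show ?thesis by (intro exI[of _ 0]) (simp add: plus_zero one_omega1_def omega1_zero_le)
  next
    case False
    then obtain \<eta> where "\<eta> \<le> \<beta>" "1 + \<eta> = \<beta>" using succ by blast
    then show ?thesis
      by (intro exI[of _ "osucc \<eta>"]) (simp add: plus_osucc osucc_le_iff less_osucc_iff)
  qed
qed (auto simp: one_plus_limit)

section \<open>Ordinal multiplication and finite multiples\<close>

lemma times_zero: "\<alpha> * 0 = (0::omega1)"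
  by (simp add: times_omega1_def ord_rec_zero)

lemma times_osucc: "\<alpha> * osucc \<beta> = \<alpha> * \<beta> + \<alpha>"
  by (simp add: times_omega1_def ord_rec_osucc)

lemma times_limit: "limit_ord \<delta> \<Longrightarrow> \<alpha> * \<delta> = (SUP \<eta>\<in>{..<\<delta>}. \<alpha> * \<eta>)"
  unfolding times_omega1_def by (rule ord_rec_SUP)

lemma normal_times:
  assumes "0 < \<alpha>"
  shows "normal_function ((*) \<alpha>)"
  using plus_less_mono[OF assms] by (auto simp: normal_function_def times_osucc times_limit plus_zero)

text \<open>Without limits every element would be an iterated successor of 0, and
  \<open>omega1\<close> would be countable.\<close>

lemma limit_omega: "limit_ord omega"
proof -
  have "\<exists>\<delta>. limit_ord \<delta>"
  proof (rule ccontr)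
    assume *: "\<not> ?thesis"
    have "countable (range (\<lambda>n. (osucc ^^ n) (0::omega1)))" by simp
    moreover have "(UNIV :: omega1 set) \<subseteq> range (\<lambda>n. (osucc ^^ n) 0)"
    proof (intro subsetI)
      fix x :: omega1
      show "x \<in> range (\<lambda>n. (osucc ^^ n) 0)"
      proof (induction x rule: omega1_induct)
        case zero
        show ?case by (rule range_eqI[of _ _ 0]) simp
      next
        case (succ \<beta>)
        then obtain n where "\<beta> = (osucc ^^ n) 0" by auto
        then have "osucc \<beta> = (osucc ^^ Suc n) 0" by simp
        then show ?case by blast
      qed (use * in blast)
    qed
    ultimately show False using uncountable_omega1 countable_subset by blast
  qed
  then show ?thesis unfolding omega_def by (rule LeastI_ex)
qed

lemma less_omega_iff: "\<alpha> < omega \<longleftrightarrow> (\<exists>n. \<alpha> = (osucc ^^ n) 0)"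
proof
  show "\<alpha> < omega \<Longrightarrow> \<exists>n. \<alpha> = (osucc ^^ n) 0"
  proof (induction \<alpha> rule: omega1_induct)
    case zero
    show ?case by (auto intro: exI[of _ 0])
  next
    case (succ \<beta>)
    then obtain n where "\<beta> = (osucc ^^ n) 0" using less_osucc order_less_trans by blast
    then have "osucc \<beta> = (osucc ^^ Suc n) 0" by simp
    then show ?case by blast
  next
    case (limit \<delta>)
    then show ?case unfolding omega_def using not_less_Least by blast
  qed
  have "(osucc ^^ n) 0 < omega" for n
    by (induction n) (auto intro: osucc_less_limit[OF limit_omega] limit_pos limit_omega)
  then show "\<exists>n. \<alpha> = (osucc ^^ n) 0 \<Longrightarrow> \<alpha> < omega" by blast
qed

primrec nmul :: "nat \<Rightarrow> omega1 \<Rightarrow> omega1" where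
  "nmul 0 \<alpha> = 0"
| "nmul (Suc n) \<alpha> = nmul n \<alpha> + \<alpha>"

lemma times_nat: "\<alpha> * (osucc ^^ n) 0 = nmul n \<alpha>"
  by (induction n) (simp_all add: times_zero times_osucc)

lemma nmul_add: "nmul m \<alpha> + nmul n \<alpha> = nmul (m + n) \<alpha>"
  by (induction n) (simp_all add: plus_zero plus_assoc_omega1[symmetric])

lemma nmul_less_times_omega: "0 < \<alpha> \<Longrightarrow> nmul n \<alpha> < \<alpha> * omega"
  using normal_mono[OF normal_times, of \<alpha> "(osucc ^^ n) 0" omega] less_omega_iff times_nat by metis

lemma less_times_omega: "0 < \<alpha> \<Longrightarrow> x < \<alpha> * omega \<Longrightarrow> \<exists>n. x < nmul n \<alpha>"
  using normal_less_limit[OF normal_times limit_omega, of \<alpha> x] less_omega_iff times_nat by metis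

section \<open>Powers of omega\<close>

lemma opow_zero: "opow \<alpha> 0 = 1"
  by (simp add: opow_def ord_rec_zero)

lemma opow_osucc: "opow \<alpha> (osucc \<beta>) = opow \<alpha> \<beta> * \<alpha>"
  by (simp add: opow_def ord_rec_osucc)

lemma opow_limit: "limit_ord \<delta> \<Longrightarrow> opow \<alpha> \<delta> = (SUP \<eta>\<in>{..<\<delta>}. opow \<alpha> \<eta>)"
  unfolding opow_def by (rule ord_rec_SUP)

lemma opow_pos: "0 < opow omega \<beta>"
proof (induction \<beta> rule: omega1_induct)
  case zero
  then show ?case by (simp add: opow_zero less_one_iff)
next
  case (succ \<beta>)
  then show ?case using nmul_less_times_omega[OF succ, of 0] by (simp add: opow_osucc)
next
  case (limit \<delta>)
  have "opow omega 0 \<le> opow omega \<delta>" unfolding opow_limit[OF limit(1)]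
    using limit_pos[OF limit(1)] by (intro cSUP_upper bdd_above_image_omega1) auto
  then show ?case using limit(2)[OF limit_pos[OF limit(1)]] by simp
qed

lemma normal_opow: "normal_function (opow omega)"
  unfolding normal_function_def opow_osucc
  using nmul_less_times_omega[OF opow_pos, of "Suc 0"] by (auto simp: opow_limit zero_plus)

lemma opow_less_mono: "\<beta> < \<gamma> \<Longrightarrow> opow omega \<beta> < opow omega \<gamma>"
  using normal_mono[OF normal_opow] .

lemma opow_le_mono: "\<beta> \<le> \<gamma> \<Longrightarrow> opow omega \<beta> \<le> opow omega \<gamma>"
  by (metis order_le_less opow_less_mono)

text \<open>Powers of \<omega> are additively indecomposable. This is why any finite number of
  shorter intervals can be laid end to end inside one of length
  \<open>opow omega \<beta>\<close>.\<close>

lemma opow_add_closed: "x < opow omega \<beta> \<Longrightarrow> y < opow omega \<beta> \<Longrightarrow> x + y < opow omega \<beta>"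
proof (induction \<beta> arbitrary: x y rule: omega1_induct)
  case zero
  then show ?case by (simp add: opow_zero less_one_iff plus_zero)
next
  case (succ \<beta>)
  then obtain m n where mn: "x < nmul m (opow omega \<beta>)" "y < nmul n (opow omega \<beta>)"
    using less_times_omega[OF opow_pos] by (metis opow_osucc)
  then have "x + y \<le> nmul m (opow omega \<beta>) + nmul n (opow omega \<beta>)"
    by (meson less_imp_le order_trans plus_le_mono plus_le_mono_left)
  then show ?case
    using nmul_less_times_omega[OF opow_pos] by (simp add: nmul_add opow_osucc order_le_less_trans)
next
  case (limit \<delta>)
  then obtain \<eta> \<theta> where "\<eta> < \<delta>" "x < opow omega \<eta>" "\<theta> < \<delta>" "y < opow omega \<theta>"
    using normal_less_limit[OF normal_opow limit(1)] by metis
  then have "max \<eta> \<theta> < \<delta>" "x < opow omega (max \<eta> \<theta>)" "y < opow omega (max \<eta> \<theta>)"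
    using opow_le_mono[of \<eta> "max \<eta> \<theta>"] opow_le_mono[of \<theta> "max \<eta> \<theta>"]
    by (simp_all add: order_less_le_trans)
  then show ?case using limit(2) opow_less_mono order_less_trans by blast
qed

section \<open>Regular families and block decompositions\<close>

text \<open>The empty segment is excluded, as it is from the range of summation of the
  averages.\<close>

definition init_segs :: "nat set \<Rightarrow> nat set set" where
  "init_segs G = {E. E \<noteq> {} \<and> init_seg E G}"

lemma init_seg_refl: "init_seg E E"
  by (simp add: init_seg_def)

lemma init_seg_trans: "init_seg A B \<Longrightarrow> init_seg B C \<Longrightarrow> init_seg A C"
  unfolding init_seg_def by blast

lemma init_seg_antisym: "init_seg A B \<Longrightarrow> init_seg B A \<Longrightarrow> A = B"
  unfolding init_seg_def by blast

lemma init_seg_insert: "\<forall>m\<in>E. m < k \<Longrightarrow> init_seg E (insert k E)"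
  unfolding init_seg_def by auto

lemma init_seg_Un: "set_less A B \<Longrightarrow> init_seg A (A \<union> B)"
  unfolding init_seg_def set_less_def by force

lemma init_seg_linear:
  assumes "init_seg A E" "init_seg B E"
  shows "init_seg A B \<or> init_seg B A"
proof (cases "A \<subseteq> B")
  case True
  then show ?thesis using assms unfolding init_seg_def by blast
next
  case False
  then obtain a where a: "a \<in> A" "a \<notin> B" by blast
  have "b < a" if "b \<in> B" for b
    using assms a that unfolding init_seg_def by (meson not_le subsetD)
  then show ?thesis using assms a unfolding init_seg_def by (meson less_imp_le subsetD subsetI)
qed

lemma finite_init_segs: "finite G \<Longrightarrow> finite (init_segs G)"
  by (rule finite_subset[of _ "Pow G"]) (auto simp: init_segs_def init_seg_def)

lemma init_seg_Min:
  assumes "init_seg E G" "E \<noteq> {}" "finite G"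
  shows "Min E = Min G"
proof (rule Min_eqI)
  have f: "finite E" using assms finite_subset unfolding init_seg_def by blast
  show "finite E" by (fact f)
  have "G \<noteq> {}" using assms by (auto simp: init_seg_def)
  then have g: "Min G \<in> G" "\<And>x. x \<in> G \<Longrightarrow> Min G \<le> x" using assms by (auto simp: init_seg_def)
  show "Min G \<le> y" if "y \<in> E" for y using that assms g unfolding init_seg_def by blast
  show "Min G \<in> E" using assms(1,2) g unfolding init_seg_def by (meson ex_in_conv subsetD)
qed

text \<open>A segment that meets B has already swallowed A. Sums over the segments of a set can
  therefore be split block by block.\<close>

lemma init_segs_Un:
  assumes "set_less A B"
  shows "init_segs (A \<union> B) = init_segs A \<union> (\<lambda>E. A \<union> E) ` init_segs B"
proof (intro equalityI subsetI)
  fix E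
  assume E: "E \<in> init_segs (A \<union> B)"
  show "E \<in> init_segs A \<union> (\<lambda>E. A \<union> E) ` init_segs B"
  proof (cases "E \<subseteq> A")
    case True
    then show ?thesis using E unfolding init_segs_def init_seg_def by blast
  next
    case False
    then obtain b where "b \<in> E" "b \<in> B" using E unfolding init_segs_def init_seg_def by blast
    have "A \<subseteq> E"
    proof
      fix a assume "a \<in> A"
      then have "a \<le> b" using assms \<open>b \<in> B\<close> unfolding set_less_def by (blast intro: less_imp_le)
      then show "a \<in> E" using E \<open>a \<in> A\<close> \<open>b \<in> E\<close> unfolding init_segs_def init_seg_def by blast
    qed
    then have "E = A \<union> (E \<inter> B)" using E unfolding init_segs_def init_seg_def by blast
    moreover have "E \<inter> B \<in> init_segs B"
      using E \<open>b \<in> E\<close> \<open>b \<in> B\<close> unfolding init_segs_def init_seg_def by blast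
    ultimately show ?thesis by blast
  qed
next
  fix E
  assume "E \<in> init_segs A \<union> (\<lambda>E. A \<union> E) ` init_segs B"
  then show "E \<in> init_segs (A \<union> B)"
  proof
    assume "E \<in> init_segs A"
    then show ?thesis
      using init_seg_trans[OF _ init_seg_Un[OF assms]] by (auto simp: init_segs_def)
  next
    assume "E \<in> (\<lambda>E. A \<union> E) ` init_segs B"
    then obtain E' where "E = A \<union> E'" "E' \<noteq> {}" "init_seg E' B" by (auto simp: init_segs_def)
    then show ?thesis
      using assms unfolding init_segs_def init_seg_def set_less_def by (auto, force)
  qed
qed

lemma fin_sets_insert:
  assumes "E \<in> fin_sets" "\<forall>m\<in>E. m < k" "E \<noteq> {} \<or> k \<ge> 1"
  shows "insert k E \<in> fin_sets"
  using assms by (auto simp: fin_sets_def)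

lemma fin_sets_induct [consumes 1, case_names empty insert]:
  assumes "E \<in> fin_sets" "P {}"
    "\<And>E k. E \<in> fin_sets \<Longrightarrow> \<forall>m\<in>E. m < k \<Longrightarrow> k \<ge> 1 \<Longrightarrow> P E \<Longrightarrow> P (insert k E)"
  shows "P E"
proof -
  have "finite E" "0 \<notin> E" using assms(1) by (auto simp: fin_sets_def)
  then show ?thesis
  proof (induction E rule: finite_linorder_max_induct)
    case (insert b A)
    then show ?case by (intro assms(3)) (auto simp: fin_sets_def intro: gr0I)
  qed (rule assms(2))
qed

lemma Min_insert_above:
  assumes "finite (E::nat set)" "E \<noteq> {}" "\<forall>m\<in>E. m < k"
  shows "Min (insert k E) = Min E"
  using assms by (simp add: Min_insert)

text \<open>Block budgets and limit stages look only at the minimum of a set; it is common to all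
  nonempty finite initial segments of M and can be fixed before such a segment is built.\<close>

lemma inf_subset_Least:
  assumes "M \<in> inf_subsets {1..}"
  obtains m where "m \<in> M" "m \<ge> 1" "\<And>x. x \<in> M \<Longrightarrow> m \<le> x"
    "\<And>G. init_seg G M \<Longrightarrow> finite G \<Longrightarrow> G \<noteq> {} \<Longrightarrow> Min G = m"
proof -
  define m where "m = (LEAST x. x \<in> M)"
  have "M \<noteq> {}" using assms by (auto simp: inf_subsets_def)
  then have m: "m \<in> M" "\<And>x. x \<in> M \<Longrightarrow> m \<le> x" unfolding m_def by (auto intro: LeastI Least_le)
  moreover have "m \<ge> 1" using assms m by (auto simp: inf_subsets_def)
  moreover have "Min G = m" if G: "init_seg G M" "finite G" "G \<noteq> {}" for G
  proof (rule Min_eqI)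
    show "m \<le> y" if "y \<in> G" for y using that G m by (auto simp: init_seg_def)
    show "m \<in> G" using G m unfolding init_seg_def by (meson ex_in_conv subsetD)
  qed (rule G)
  ultimately show ?thesis using that by blast
qed

section \<open>Decompositions into maximal blocks\<close>

definition is_decomp :: "nat set set \<Rightarrow> nat set \<Rightarrow> nat set list \<Rightarrow> bool" where
  "is_decomp F E Fs \<longleftrightarrow> Fs \<noteq> [] \<and> sorted_wrt set_less Fs \<and> \<Union>(set Fs) = E \<and>
     set (butlast Fs) \<subseteq> maximal_sets F \<and> last Fs \<in> F \<and> last Fs \<noteq> {}"

lemma decomp_is_decomp: "decomp F E = (THE Fs. is_decomp F E Fs)"
  by (simp add: decomp_def is_decomp_def)

abbreviation lastb :: "nat set set \<Rightarrow> nat set \<Rightarrow> nat set" where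
  "lastb F E \<equiv> last (decomp F E)"

abbreviation nb :: "nat set set \<Rightarrow> nat set \<Rightarrow> nat" where
  "nb F E \<equiv> length (decomp F E)"

text \<open>Closure properties that survive the Schreier step and the limit construction.
  \<open>extendable\<close> says that whether a nonempty set admits one more element beyond it does
  not depend on the element: the budgets are set by minima. \<open>ex_maximal\<close> plays the role
  of compactness.\<close>

locale regular =
  fixes F :: "nat set set"
  assumes empty_in: "{} \<in> F"
    and sub_fin: "F \<subseteq> fin_sets"
    and singleton_in: "n \<ge> 1 \<Longrightarrow> {n} \<in> F"
    and hereditary: "E \<in> F \<Longrightarrow> E' \<subseteq> E \<Longrightarrow> E' \<in> F"
    and extendable: "E \<noteq> {} \<Longrightarrow> insert j E \<in> F \<Longrightarrow> \<forall>m\<in>E. m < j \<Longrightarrow> \<forall>m\<in>E. m < k \<Longrightarrow> insert k E \<in> F"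
    and ex_maximal: "M \<in> inf_subsets {1..} \<Longrightarrow> \<exists>G\<in>maximal_sets F. init_seg G M"
begin

lemma finite_in: "E \<in> F \<Longrightarrow> finite E"
  using sub_fin by (auto simp: fin_sets_def)

lemma maximal_nonempty: "G \<in> maximal_sets F \<Longrightarrow> G \<noteq> {}"
  using singleton_in[of 1] by (force simp: maximal_sets_def init_seg_def)

lemma maximal_in: "G \<in> maximal_sets F \<Longrightarrow> G \<in> F"
  by (simp add: maximal_sets_def)

text \<open>Any proper end extension of E contains some \<open>insert j E\<close> with j beyond E,
  and \<open>extendable\<close> exchanges j for k. A single test element thus decides
  maximality.\<close>

lemma maximal_iff:
  assumes "E \<in> F" "E \<noteq> {}" "\<forall>m\<in>E. m < k"
  shows "E \<in> maximal_sets F \<longleftrightarrow> insert k E \<notin> F"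
proof
  assume E: "E \<in> maximal_sets F"
  show "insert k E \<notin> F"
  proof
    assume "insert k E \<in> F"
    then have "insert k E = E"
      using E init_seg_insert[OF assms(3)] by (auto simp: maximal_sets_def)
    then show False using assms(3) by blast
  qed
next
  assume k: "insert k E \<notin> F"
  show "E \<in> maximal_sets F"
  proof (rule ccontr)
    assume "E \<notin> maximal_sets F"
    then obtain G where G: "G \<in> F" "init_seg E G" "G \<noteq> E" using assms(1) by (auto simp: maximal_sets_def)
    then obtain j where j: "j \<in> G" "j \<notin> E" by (auto simp: init_seg_def)
    then have "\<forall>m\<in>E. m < j" using G unfolding init_seg_def by (meson not_le)
    moreover have "insert j E \<in> F" using G j by (intro hereditary[OF G(1)]) (auto simp: init_seg_def)
    ultimately show False using extendable[OF assms(2), of j k] k assms(3) by blast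
  qed
qed

lemma is_decomp_ConsD:
  assumes "is_decomp F E (A # Fs)"
  shows "A \<in> F" "A \<noteq> {}" "init_seg A E"
    "Fs = [] \<and> A = E \<or> Fs \<noteq> [] \<and> A \<in> maximal_sets F \<and> is_decomp F (E - A) Fs \<and> A \<noteq> E"
proof -
  have s: "set_less A (\<Union>(set Fs))" "sorted_wrt set_less Fs" "E = A \<union> \<Union>(set Fs)"
    using assms by (auto simp: is_decomp_def set_less_def)
  show "init_seg A E" using init_seg_Un s by blast
  have *: "A \<in> F \<and> A \<noteq> {} \<and> (Fs = [] \<or> A \<in> maximal_sets F)"
    using assms maximal_nonempty maximal_in by (auto simp: is_decomp_def split: if_splits)
  then show "A \<in> F" "A \<noteq> {}" by auto
  show "Fs = [] \<and> A = E \<or> Fs \<noteq> [] \<and> A \<in> maximal_sets F \<and> is_decomp F (E - A) Fs \<and> A \<noteq> E"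
  proof (cases "Fs = []")
    case False
    have "E - A = \<Union>(set Fs)" using s by (auto simp: set_less_def)
    moreover have "last Fs \<noteq> {}" "last Fs \<in> set Fs" using assms False by (auto simp: is_decomp_def)
    then have "E - A \<noteq> {}" using calculation by blast
    ultimately show ?thesis using False assms * by (auto simp: is_decomp_def)
  qed (use s in simp)
qed

text \<open>The first blocks of two decompositions are comparable as initial segments of E. A block
  that is not the last one is maximal, and a last block exhausts E, so comparability forces
  equality.\<close>

lemma is_decomp_unique: "is_decomp F E Fs \<Longrightarrow> is_decomp F E Gs \<Longrightarrow> Fs = Gs"
proof (induction Fs arbitrary: E Gs)
  case Nil
  then show ?case by (simp add: is_decomp_def)
next
  case (Cons A Fs)
  then obtain B Gs' where Gs: "Gs = B # Gs'" by (cases Gs) (auto simp: is_decomp_def)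
  note a = is_decomp_ConsD[OF Cons.prems(1)]
  note b = is_decomp_ConsD[OF Cons.prems(2)[unfolded Gs]]
  have "A = B"
    using init_seg_linear[OF a(3) b(3)]
  proof
    assume *: "init_seg A B"
    show ?thesis
      using a(4)
    proof
      assume "Fs = [] \<and> A = E"
      then show ?thesis using * b(3) init_seg_antisym by blast
    next
      assume "Fs \<noteq> [] \<and> A \<in> maximal_sets F \<and> is_decomp F (E - A) Fs \<and> A \<noteq> E"
      then show ?thesis using * b(1) by (auto simp: maximal_sets_def)
    qed
  next
    assume *: "init_seg B A"
    show ?thesis
      using b(4)
    proof
      assume "Gs' = [] \<and> B = E"
      then show ?thesis using * a(3) init_seg_antisym by blast
    next
      assume "Gs' \<noteq> [] \<and> B \<in> maximal_sets F \<and> is_decomp F (E - B) Gs' \<and> B \<noteq> E"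
      then show ?thesis using * a(1) by (auto simp: maximal_sets_def)
    qed
  qed
  then show ?case using a(4) b(4) Cons.IH Gs by blast
qed

lemma decomp_eqI: "is_decomp F E Fs \<Longrightarrow> decomp F E = Fs"
  unfolding decomp_is_decomp using is_decomp_unique by blast

lemma is_decomp_snoc:
  assumes "is_decomp F E Fs" "last Fs \<in> maximal_sets F" "G \<in> F" "G \<noteq> {}" "set_less E G"
  shows "is_decomp F (E \<union> G) (Fs @ [G])"
proof -
  obtain Gs L where Fs: "Fs = Gs @ [L]" using assms(1) by (metis is_decomp_def rev_exhaust)
  then show ?thesis using assms by (auto simp: is_decomp_def sorted_wrt_append set_less_def butlast_append)
qed

lemma is_decomp_grow:
  assumes "is_decomp F E Fs" "last Fs \<notin> maximal_sets F" "\<forall>m\<in>E. m < k"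
  shows "is_decomp F (insert k E) (butlast Fs @ [insert k (last Fs)])"
proof -
  obtain Gs L where Fs: "Fs = Gs @ [L]" using assms(1) by (metis is_decomp_def rev_exhaust)
  have L: "L \<in> F" "L \<noteq> {}" "L \<subseteq> E" using assms(1) Fs by (auto simp: is_decomp_def)
  then have "insert k L \<in> F" using maximal_iff[of L k] assms(2,3) Fs by auto
  then show ?thesis
    using assms Fs by (auto simp: is_decomp_def sorted_wrt_append set_less_def)
qed

lemma decomp_in: "E \<in> F \<Longrightarrow> E \<noteq> {} \<Longrightarrow> decomp F E = [E]"
  by (rule decomp_eqI) (simp add: is_decomp_def)

lemma is_decomp_decomp:
  assumes "E \<in> fin_sets" "E \<noteq> {}"
  shows "is_decomp F E (decomp F E)"
proof -
  have "E \<noteq> {} \<longrightarrow> (\<exists>Fs. is_decomp F E Fs)"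
    using assms(1)
  proof (induction rule: fin_sets_induct)
    case (insert E k)
    show ?case
    proof (cases "E = {}")
      case True
      then have "is_decomp F (insert k E) [{k}]" using singleton_in insert by (simp add: is_decomp_def)
      then show ?thesis by blast
    next
      case False
      then obtain Fs where Fs: "is_decomp F E Fs" using insert by blast
      have "set_less E {k}" "E \<union> {k} = insert k E" using insert by (auto simp: set_less_def)
      then show ?thesis
        using is_decomp_snoc[OF Fs, of "{k}"] is_decomp_grow[OF Fs] insert singleton_in by force
    qed
  qed simp
  then show ?thesis using assms(2) decomp_eqI by blast
qed

text \<open>Decomposition is greedy: a new largest element extends the last block if it can and
  opens a block otherwise. Inductions on finite sets below rest on this recursion.\<close>

lemma decomp_insert:
  assumes "E \<in> fin_sets" "E \<noteq> {}" "\<forall>m\<in>E. m < k"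
  shows "decomp F (insert k E) = (if lastb F E \<in> maximal_sets F then decomp F E @ [{k}]
      else butlast (decomp F E) @ [insert k (lastb F E)])"
proof -
  have "E \<union> {k} = insert k E" "set_less E {k}" using assms by (auto simp: set_less_def)
  moreover have "{k} \<in> F" using assms by (intro singleton_in) (auto simp: fin_sets_def)
  ultimately show ?thesis
    using is_decomp_snoc[OF is_decomp_decomp, of E "{k}"] is_decomp_grow[OF is_decomp_decomp, of E k] assms
    by (auto intro: decomp_eqI)
qed

lemma decomp_singleton: "k \<ge> 1 \<Longrightarrow> decomp F {k} = [{k}]"
  by (simp add: decomp_in singleton_in)

lemma lastb_insert:
  assumes "E \<in> fin_sets" "E \<noteq> {}" "\<forall>m\<in>E. m < k"
  shows "lastb F (insert k E) = (if lastb F E \<in> maximal_sets F then {k} else insert k (lastb F E))"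
  by (simp add: decomp_insert[OF assms])

lemma nb_pos:
  assumes "E \<in> fin_sets" "E \<noteq> {}"
  shows "nb F E > 0"
  using is_decomp_decomp[OF assms] by (simp add: is_decomp_def)

lemma nb_insert:
  assumes "E \<in> fin_sets" "E \<noteq> {}" "\<forall>m\<in>E. m < k"
  shows "nb F (insert k E) = (if lastb F E \<in> maximal_sets F then Suc (nb F E) else nb F E)"
  using nb_pos[OF assms(1,2)] by (simp add: decomp_insert[OF assms])

lemma lastb_props:
  assumes "E \<in> fin_sets" "E \<noteq> {}"
  shows "lastb F E \<in> F" "lastb F E \<noteq> {}" "lastb F E \<subseteq> E"
proof -
  have "last (decomp F E) \<in> set (decomp F E)"
    using is_decomp_decomp[OF assms] by (simp add: is_decomp_def)
  then show "lastb F E \<in> F" "lastb F E \<noteq> {}" "lastb F E \<subseteq> E"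
    using is_decomp_decomp[OF assms] unfolding is_decomp_def by blast+
qed

text \<open>Once a block has been opened inside B it can never be complete before B is exhausted,
  because it and the next element lie together in B, hence in F by heredity. So at most one block
  opens.\<close>

lemma nb_Un_le:
  assumes "E \<in> fin_sets" "B \<in> F" "set_less E B"
  shows "nb F (E \<union> B) \<le> Suc (nb F E)"
proof (cases "E = {}")
  case True
  then show ?thesis using decomp_in[OF assms(2)] by (cases "B = {}") auto
next
  case False
  have "C \<subseteq> B \<Longrightarrow> nb F (E \<union> C) = nb F E \<or> nb F (E \<union> C) = Suc (nb F E) \<and> lastb F (E \<union> C) \<subseteq> B"
    if "C \<in> fin_sets" for C
    using that
  proof (induction rule: fin_sets_induct)
    case (insert C k)
    have ab: "\<forall>m\<in>E \<union> C. m < k" using insert assms(3) by (auto simp: set_less_def)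
    have ne: "E \<union> C \<in> fin_sets" "E \<union> C \<noteq> {}" using False insert assms by (auto simp: fin_sets_def)
    have eq: "E \<union> insert k C = insert k (E \<union> C)" by simp
    have grow: "lastb F (E \<union> C) \<notin> maximal_sets F" if "lastb F (E \<union> C) \<subseteq> B"
      using maximal_iff[of "lastb F (E \<union> C)" k] lastb_props[OF ne] ab
        hereditary[OF assms(2), of "insert k (lastb F (E \<union> C))"] that insert by blast
    show ?case
      unfolding eq nb_insert[OF ne ab] lastb_insert[OF ne ab]
      using insert grow by auto
  qed simp
  then show ?thesis using assms(2) sub_fin by (metis le_Suc_eq order_refl subset_iff)
qed

text \<open>The greedy decomposition uses the fewest pieces; this turns existence statements about
  partitions into bounds on \<open>nb\<close>.\<close>

lemma nb_le_length:
  assumes "sorted_wrt set_less Es" "\<forall>E\<in>set Es. E \<in> F"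
  shows "nb F (\<Union>(set Es)) \<le> length Es \<or> \<Union>(set Es) = {}"
  using assms
proof (induction Es rule: rev_induct)
  case (snoc B Es)
  have fin: "\<Union>(set Es) \<in> fin_sets" using snoc.prems sub_fin finite_in by (fastforce simp: fin_sets_def)
  have less: "set_less (\<Union>(set Es)) B" using snoc.prems by (auto simp: sorted_wrt_append set_less_def)
  show ?case
  proof (cases "\<Union>(set Es) = {}")
    case True
    then have "\<Union>(set (Es @ [B])) = B" by auto
    then show ?thesis using decomp_in[of B] snoc.prems by (cases "B = {}") auto
  next
    case False
    then show ?thesis
      using snoc nb_Un_le[OF fin _ less] by (auto simp: sorted_wrt_append Un_commute)
  qed
qed simp

text \<open>By optimality of the greedy decomposition the existential quantifier in
  \<open>schreier_step\<close> becomes a count. All later reasoning about the step uses only this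
  form.\<close>

lemma step_iff: "E \<in> schreier_step F \<longleftrightarrow> E = {} \<or> E \<in> fin_sets \<and> E \<noteq> {} \<and> nb F E \<le> Min E"
proof (cases "E = {}")
  case True
  then show ?thesis by (simp add: schreier_step_def)
next
  case False
  have mins: "Min (hd Es) = Min (\<Union>(set Es))"
    if Es': "Es \<noteq> []" "sorted_wrt set_less Es" "\<forall>E\<in>set Es. E \<noteq> {} \<and> E \<in> F" for Es
  proof (rule init_seg_Min)
    obtain A Fs where Es: "Es = A # Fs" using Es' by (cases Es) auto
    have "\<Union>(set Es) = A \<union> \<Union>(set Fs)" "set_less A (\<Union>(set Fs))" using that Es by (auto simp: set_less_def)
    then show "init_seg (hd Es) (\<Union>(set Es))" using init_seg_Un[of A] Es by simp
    show "hd Es \<noteq> {}" using that by auto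
    show "finite (\<Union>(set Es))" using that finite_in by auto
  qed
  show ?thesis
  proof
    assume "E \<in> schreier_step F"
    then obtain Es where Es: "Es \<noteq> []" "sorted_wrt set_less Es" "\<forall>E\<in>set Es. E \<noteq> {} \<and> E \<in> F"
      "length Es \<le> Min (hd Es)" "E = \<Union>(set Es)"
      using False by (auto simp: schreier_step_def)
    then have "nb F E \<le> Min E" using nb_le_length[of Es] False mins[of Es] by auto
    moreover have "E \<in> fin_sets" using Es sub_fin finite_in by (fastforce simp: fin_sets_def)
    ultimately show "E = {} \<or> E \<in> fin_sets \<and> E \<noteq> {} \<and> nb F E \<le> Min E" using False by blast
  next
    assume "E = {} \<or> E \<in> fin_sets \<and> E \<noteq> {} \<and> nb F E \<le> Min E"
    then have E: "E \<in> fin_sets" "nb F E \<le> Min E" using False by auto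
    define Es where "Es = decomp F E"
    have d: "is_decomp F E Es" unfolding Es_def using is_decomp_decomp E False by blast
    obtain Gs L where L: "Es = Gs @ [L]" using d by (metis is_decomp_def rev_exhaust)
    have "\<forall>E\<in>set Es. E \<noteq> {} \<and> E \<in> F"
      using d maximal_nonempty maximal_in unfolding is_decomp_def L by auto
    moreover from this have "Min (hd Es) = Min E" using mins[of Es] d by (auto simp: is_decomp_def)
    ultimately show "E \<in> schreier_step F"
      using d E Es_def unfolding schreier_step_def is_decomp_def
      by (intro UnI2 CollectI exI[of _ Es]) simp
  qed
qed

lemma in_step: "E \<in> F \<Longrightarrow> E \<in> schreier_step F"
proof (cases "E = {}")
  case False
  assume "E \<in> F"
  moreover have "E \<in> fin_sets" using sub_fin \<open>E \<in> F\<close> by blast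
  moreover have "Min E \<in> E" using False \<open>E \<in> fin_sets\<close> by (simp add: fin_sets_def)
  then have "Min E \<ge> 1" using \<open>E \<in> fin_sets\<close> by (metis (no_types, lifting) One_nat_def Suc_leI fin_sets_def gr0I mem_Collect_eq)
  ultimately show ?thesis using False by (auto simp: step_iff decomp_in)
qed (simp add: step_iff)

text \<open>Intersecting the blocks of E with the subset gives an admissible partition of the subset
  with no more pieces.\<close>

lemma nb_mono:
  assumes "E \<in> fin_sets" "E' \<subseteq> E" "E' \<noteq> {}"
  shows "nb F E' \<le> nb F E"
proof -
  define Es where "Es = decomp F E"
  have d: "is_decomp F E Es" unfolding Es_def using is_decomp_decomp assms by blast
  obtain Gs L where L: "Es = Gs @ [L]" using d by (metis is_decomp_def rev_exhaust)
  have "\<forall>E\<in>set Es. E \<in> F" using d maximal_in unfolding is_decomp_def L by auto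
  then have "\<forall>E\<in>set (map (\<lambda>B. B \<inter> E') Es). E \<in> F" using hereditary by auto
  moreover have "sorted_wrt set_less (map (\<lambda>B. B \<inter> E') Es)"
    using d unfolding is_decomp_def sorted_wrt_map
    by (auto simp: set_less_def elim!: sorted_wrt_mono_rel[rotated])
  moreover have "\<Union>(set (map (\<lambda>B. B \<inter> E') Es)) = E'" using d assms by (auto simp: is_decomp_def)
  ultimately show ?thesis using nb_le_length[of "map (\<lambda>B. B \<inter> E') Es"] assms Es_def by simp
qed

text \<open>G is stuck exactly when its budget of \<open>Min G\<close> blocks is used up and the
  last block cannot grow: only then does a further element require one block too many.\<close>

lemma maximal_step_iff:
  assumes "G \<in> fin_sets" "G \<noteq> {}"
  shows "G \<in> maximal_sets (schreier_step F) \<longleftrightarrow> nb F G = Min G \<and> lastb F G \<in> maximal_sets F"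
proof -
  have fin: "finite G" using assms by (simp add: fin_sets_def)
  define k where "k = Suc (Max G)"
  have k: "\<forall>m\<in>G. m < k" using fin by (auto simp: k_def less_Suc_eq_le)
  have gen: "insert j G \<in> schreier_step F \<longleftrightarrow> nb F (insert j G) \<le> Min G" if "\<forall>m\<in>G. m < j" for j
    using step_iff[of "insert j G"] fin_sets_insert[OF assms(1) that] assms(2)
      Min_insert_above[OF fin assms(2) that] by auto
  show ?thesis
  proof
    assume max: "G \<in> maximal_sets (schreier_step F)"
    then have "nb F G \<le> Min G" using step_iff assms by (auto simp: maximal_sets_def)
    moreover have "\<not> nb F (insert k G) \<le> Min G"
    proof
      assume "nb F (insert k G) \<le> Min G"
      then have "insert k G = G"
        using gen[OF k] max init_seg_insert[OF k] by (auto simp: maximal_sets_def)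
      then show False using k by blast
    qed
    ultimately show "nb F G = Min G \<and> lastb F G \<in> maximal_sets F"
      using nb_insert[OF assms k] by (auto split: if_splits)
  next
    assume *: "nb F G = Min G \<and> lastb F G \<in> maximal_sets F"
    then have in_s: "G \<in> schreier_step F" using step_iff assms by auto
    show "G \<in> maximal_sets (schreier_step F)"
      unfolding maximal_sets_def
    proof (intro CollectI conjI in_s ballI impI, rule ccontr)
      fix H assume H: "H \<in> schreier_step F" "init_seg G H" "H \<noteq> G"
      then obtain j where j: "j \<in> H" "j \<notin> G" by (auto simp: init_seg_def)
      then have ab: "\<forall>m\<in>G. m < j" using H unfolding init_seg_def by (meson not_le)
      have Hne: "H \<noteq> {}" "H \<in> fin_sets" "nb F H \<le> Min H" using H j step_iff by auto
      have "nb F (insert j G) \<le> nb F H" using H j Hne by (intro nb_mono) (auto simp: init_seg_def)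
      moreover have "Min H = Min G" using init_seg_Min[OF H(2) assms(2)] Hne by (simp add: fin_sets_def)
      ultimately show False using nb_insert[OF assms ab] * Hne by simp
    qed
  qed
qed

lemma ex_nb_maximal:
  assumes "M \<in> inf_subsets {1..}"
  shows "\<exists>G. init_seg G M \<and> G \<in> fin_sets \<and> G \<noteq> {} \<and> nb F G = Suc n \<and> lastb F G \<in> maximal_sets F"
proof (induction n)
  case 0
  obtain G where G: "G \<in> maximal_sets F" "init_seg G M" using ex_maximal[OF assms] by blast
  then show ?case using maximal_nonempty maximal_in decomp_in sub_fin by (intro exI[of _ G]) auto
next
  case (Suc n)
  then obtain G where G: "init_seg G M" "G \<in> fin_sets" "G \<noteq> {}" "nb F G = Suc n" "lastb F G \<in> maximal_sets F"
    by blast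
  have "M - G \<in> inf_subsets {1..}" using assms G by (auto simp: inf_subsets_def fin_sets_def)
  then obtain H where H: "H \<in> maximal_sets F" "init_seg H (M - G)" using ex_maximal by blast
  have less: "set_less G H"
    using G H unfolding set_less_def init_seg_def by (meson DiffD1 DiffD2 not_le subsetD)
  have d: "decomp F (G \<union> H) = decomp F G @ [H]"
    using is_decomp_snoc[OF is_decomp_decomp[OF G(2,3)] G(5) _ _ less] H maximal_in maximal_nonempty
    by (auto intro: decomp_eqI)
  have "init_seg (G \<union> H) M" using G H unfolding init_seg_def by blast
  moreover have "G \<union> H \<in> fin_sets" using G H maximal_in sub_fin by (auto simp: fin_sets_def)
  ultimately show ?case using d G H by (intro exI[of _ "G \<union> H"]) auto
qed

lemma regular_step: "regular (schreier_step F)"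
proof
  show "{} \<in> schreier_step F" by (simp add: step_iff)
  show "schreier_step F \<subseteq> fin_sets" by (auto simp: step_iff fin_sets_def)
  show "{n} \<in> schreier_step F" if "n \<ge> 1" for n using that singleton_in in_step by blast
  show "E' \<in> schreier_step F" if "E \<in> schreier_step F" "E' \<subseteq> E" for E E'
  proof (cases "E' = {}")
    case False
    then have E: "E \<in> fin_sets" "E \<noteq> {}" "nb F E \<le> Min E" using that by (auto simp: step_iff)
    then have "E' \<in> fin_sets" "Min E \<le> Min E'"
      using that False by (auto simp: fin_sets_def intro: finite_subset Min_antimono)
    then show ?thesis using False nb_mono[OF E(1) that(2) False] E by (auto simp: step_iff)
  qed (simp add: step_iff)
  show "insert k E \<in> schreier_step F" if "E \<noteq> {}" "insert j E \<in> schreier_step F" "\<forall>m\<in>E. m < j" "\<forall>m\<in>E. m < k"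
    for E j k
  proof -
    have E: "E \<in> fin_sets" using that by (auto simp: step_iff fin_sets_def)
    then have "finite E" by (simp add: fin_sets_def)
    then show ?thesis
      using that E nb_insert[OF E that(1)] fin_sets_insert[OF E that(4)]
      by (auto simp: step_iff Min_insert_above simp del: Min_insert)
  qed
  show "\<exists>G\<in>maximal_sets (schreier_step F). init_seg G M" if M: "M \<in> inf_subsets {1..}" for M
  proof -
    obtain m where m: "m \<ge> 1" "\<And>G. init_seg G M \<Longrightarrow> finite G \<Longrightarrow> G \<noteq> {} \<Longrightarrow> Min G = m"
      using inf_subset_Least[OF M] by metis
    obtain G where G: "init_seg G M" "G \<in> fin_sets" "G \<noteq> {}" "nb F G = m" "lastb F G \<in> maximal_sets F"
      using ex_nb_maximal[OF M, of "m - 1"] m(1) by auto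
    then have "Min G = m" using m(2) by (simp add: fin_sets_def)
    then show ?thesis using maximal_step_iff[OF G(2,3)] G by blast
  qed
qed

end

section \<open>Iterating the Schreier step\<close>

context regular
begin

text \<open>The segments ending inside one given block contribute the total weight of that block,
  which is one; the sum therefore counts blocks.\<close>

lemma sum_blocks:
  assumes w: "\<And>H. H \<in> maximal_sets F \<Longrightarrow> sum w (init_segs H) = (1::real)"
    and G: "G \<in> fin_sets" "G \<noteq> {}" "lastb F G \<in> maximal_sets F"
  shows "(\<Sum>E\<in>init_segs G. w (lastb F E)) = real (nb F G)"
proof -
  have *: "(\<Sum>E\<in>init_segs (\<Union>(set Fs)). w (lastb F E)) = real (length Fs)"
    if "Fs \<noteq> []" "sorted_wrt set_less Fs" "set Fs \<subseteq> maximal_sets F" for Fs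
    using that
  proof (induction Fs rule: rev_induct)
    case (snoc H Fs)
    have H: "H \<in> maximal_sets F" "H \<in> F" using snoc.prems maximal_in by auto
    have segs: "E \<in> F \<and> E \<noteq> {} \<and> E \<subseteq> H" if "E \<in> init_segs H" for E
      using that hereditary[OF H(2)] by (auto simp: init_segs_def init_seg_def)
    have finH: "finite (init_segs H)" using H finite_in finite_init_segs by blast
    show ?case
    proof (cases "Fs = []")
      case True
      have "(\<Sum>E\<in>init_segs H. w (lastb F E)) = sum w (init_segs H)"
        using segs by (intro sum.cong) (auto simp: decomp_in)
      then show ?thesis using True w H by simp
    next
      case False
      define A where "A = \<Union>(set Fs)"
      have sub: "set Fs \<subseteq> maximal_sets F" and srt: "sorted_wrt set_less Fs"
        using snoc.prems by (auto simp: sorted_wrt_append)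
      have lst: "last Fs \<in> maximal_sets F" using sub False last_in_set by blast
      have less: "set_less A H" using snoc.prems by (auto simp: A_def sorted_wrt_append set_less_def)
      have d: "is_decomp F A Fs"
        using sub srt lst False maximal_in maximal_nonempty in_set_butlastD
        by (fastforce simp: is_decomp_def A_def)
      have finA: "finite A" using sub maximal_in finite_in by (auto simp: A_def)
      \<comment> \<open>The part A ends in a maximal block, so whatever follows it starts afresh and
        the weight sees only E.\<close>
      have lb: "lastb F (A \<union> E) = E" if "E \<in> init_segs H" for E
      proof -
        have "set_less A E" using less segs[OF that] by (auto simp: set_less_def)
        then show ?thesis using decomp_eqI[OF is_decomp_snoc[OF d lst]] segs[OF that] by simp
      qed
      have disj: "A \<inter> H = {}" using less by (auto simp: set_less_def)
      have inj: "inj_on (\<lambda>E. A \<union> E) (init_segs H)"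
        using segs disj by (intro inj_onI) blast
      have "init_segs A \<inter> (\<lambda>E. A \<union> E) ` init_segs H = {}"
        using segs disj by (force simp: init_segs_def init_seg_def)
      then have "(\<Sum>E\<in>init_segs (A \<union> H). w (lastb F E)) =
          (\<Sum>E\<in>init_segs A. w (lastb F E)) + (\<Sum>E\<in>(\<lambda>E. A \<union> E) ` init_segs H. w (lastb F E))"
        unfolding init_segs_Un[OF less]
        using finite_init_segs[OF finA] finH by (intro sum.union_disjoint) auto
      also have "(\<Sum>E\<in>(\<lambda>E. A \<union> E) ` init_segs H. w (lastb F E)) = sum w (init_segs H)"
        using lb by (simp add: sum.reindex[OF inj])
      also have "(\<Sum>E\<in>init_segs A. w (lastb F E)) = real (length Fs)"
        unfolding A_def using snoc.IH False srt sub by blast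
      finally show ?thesis using w[OF H(1)] by (simp add: A_def Un_commute)
    qed
  qed simp
  have d: "is_decomp F G (decomp F G)" using is_decomp_decomp G by blast
  have "set (decomp F G) \<subseteq> maximal_sets F"
    using d G(3) unfolding is_decomp_def
    by (metis append_butlast_last_id Un_subset_iff set_append empty_set empty_subsetI insert_subset list.simps(15))
  then show ?thesis using *[of "decomp F G"] d by (simp add: is_decomp_def)
qed

end

text \<open>The recursion common to all families used here, over an arbitrary regular base
  \<open>Fm 0\<close>. At a limit, \<open>\<nu> \<delta> n\<close> is the level that governs sets
  with minimum n; for Schreier families it is the successor of the n-th characteristic
  ordinal.\<close>

locale ladder =
  fixes Fm :: "omega1 \<Rightarrow> nat set set" and \<nu> :: "omega1 \<Rightarrow> nat \<Rightarrow> omega1"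
  assumes regular_zero: "regular (Fm 0)"
    and Fm_osucc: "Fm (osucc \<zeta>) = schreier_step (Fm \<zeta>)"
    and nu_less: "limit_ord \<delta> \<Longrightarrow> n \<ge> 1 \<Longrightarrow> \<nu> \<delta> n < \<delta>"
    and nu_mono: "limit_ord \<delta> \<Longrightarrow> n \<ge> 1 \<Longrightarrow> Fm (\<nu> \<delta> n) \<subseteq> Fm (\<nu> \<delta> (Suc n))"
    and Fm_limit: "limit_ord \<delta> \<Longrightarrow> Fm \<delta> = {{}} \<union> {E \<in> fin_sets. E \<noteq> {} \<and> E \<in> Fm (\<nu> \<delta> (Min E))}"
begin

lemma Min_ge_1: "E \<in> fin_sets \<Longrightarrow> E \<noteq> {} \<Longrightarrow> Min E \<ge> 1"
  using Min_in[of E] by (metis (no_types, lifting) One_nat_def Suc_leI fin_sets_def gr0I mem_Collect_eq)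

lemma in_limit_iff:
  "limit_ord \<delta> \<Longrightarrow> E \<in> fin_sets \<Longrightarrow> E \<noteq> {} \<Longrightarrow> E \<in> Fm \<delta> \<longleftrightarrow> E \<in> Fm (\<nu> \<delta> (Min E))"
  by (simp add: Fm_limit)

text \<open>At a limit, sets with a common minimum belong to one regular family of smaller index,
  and extending a set to the right does not move its minimum. Only passing to a subset can raise it,
  and there the monotonicity of the levels helps.\<close>

lemma regular_Fm: "regular (Fm \<zeta>)"
proof (induction \<zeta> rule: omega1_induct)
  case zero
  show ?case by (rule regular_zero)
next
  case (succ \<beta>)
  then show ?case unfolding Fm_osucc by (rule regular.regular_step)
next
  case (limit \<delta>)
  have reg: "regular (Fm (\<nu> \<delta> n))" if "n \<ge> 1" for n using limit that nu_less by blast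
  have mono: "Fm (\<nu> \<delta> n) \<subseteq> Fm (\<nu> \<delta> m)" if "1 \<le> n" "n \<le> m" for n m
    using that(2,1)
  proof (induction m rule: dec_induct)
    case (step m)
    then show ?case using nu_mono[OF limit(1), of m] by auto
  qed simp
  show ?case
  proof
    show "{} \<in> Fm \<delta>" "Fm \<delta> \<subseteq> fin_sets" using limit by (auto simp: Fm_limit fin_sets_def)
    show "{n} \<in> Fm \<delta>" if "n \<ge> 1" for n
      using that regular.singleton_in[OF reg[OF that] that] limit(1) by (auto simp: Fm_limit fin_sets_def)
    show "E' \<in> Fm \<delta>" if "E \<in> Fm \<delta>" "E' \<subseteq> E" for E E'
    proof (cases "E' = {}")
      case False
      then have E: "E \<in> fin_sets" "E \<noteq> {}" "E \<in> Fm (\<nu> \<delta> (Min E))" using that limit(1) by (auto simp: Fm_limit)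
      then have E': "E' \<in> fin_sets" "Min E \<le> Min E'"
        using that False by (auto simp: fin_sets_def intro: finite_subset Min_antimono)
      have "E' \<in> Fm (\<nu> \<delta> (Min E))" using regular.hereditary[OF reg] E Min_ge_1 that by blast
      then show ?thesis using mono Min_ge_1 E E' in_limit_iff[OF limit(1)] False by blast
    qed (use limit(1) in \<open>simp add: Fm_limit\<close>)
    show "insert k E \<in> Fm \<delta>" if "E \<noteq> {}" "insert j E \<in> Fm \<delta>" "\<forall>m\<in>E. m < j" "\<forall>m\<in>E. m < k"
      for E j k
    proof -
      have E: "E \<in> fin_sets" using that limit(1) by (auto simp: Fm_limit fin_sets_def)
      then have fE: "finite E" by (simp add: fin_sets_def)
      have "insert j E \<in> Fm (\<nu> \<delta> (Min E))"
        using that Min_insert_above[OF fE that(1,3)] limit(1) by (auto simp: Fm_limit simp del: Min_insert)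
      then have "insert k E \<in> Fm (\<nu> \<delta> (Min E))"
        using regular.extendable[OF reg[OF Min_ge_1[OF E that(1)]] that(1) _ that(3,4)] by blast
      then show ?thesis
        using in_limit_iff[OF limit(1) fin_sets_insert[OF E that(4)]] that(1) Min_insert_above[OF fE that(1,4)]
        by (simp del: Min_insert)
    qed
    show "\<exists>G\<in>maximal_sets (Fm \<delta>). init_seg G M" if M: "M \<in> inf_subsets {1..}" for M
    proof -
      obtain m where m1: "m \<ge> 1" and m: "\<And>G. init_seg G M \<Longrightarrow> finite G \<Longrightarrow> G \<noteq> {} \<Longrightarrow> Min G = m"
        using inf_subset_Least[OF M] by metis
      interpret R: regular "Fm (\<nu> \<delta> m)" by (rule reg[OF m1])
      obtain G where G: "G \<in> maximal_sets (Fm (\<nu> \<delta> m))" "init_seg G M" using R.ex_maximal[OF M] by blast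
      have Gf: "G \<in> fin_sets" "G \<noteq> {}" using G R.maximal_nonempty R.maximal_in R.sub_fin by auto
      have MG: "Min G = m" using m[OF G(2)] Gf by (simp add: fin_sets_def)
      have "G \<in> maximal_sets (Fm \<delta>)"
        unfolding maximal_sets_def
      proof (intro CollectI conjI ballI impI)
        show "G \<in> Fm \<delta>" using in_limit_iff[OF limit(1) Gf] MG R.maximal_in G by simp
        fix H assume H: "H \<in> Fm \<delta>" "init_seg G H"
        then have "H \<noteq> {}" "H \<in> fin_sets" using Gf limit(1) by (auto simp: Fm_limit init_seg_def)
        moreover have "Min H = m"
          using init_seg_Min[OF H(2) Gf(2)] \<open>H \<in> fin_sets\<close> MG by (simp add: fin_sets_def)
        ultimately have "H \<in> Fm (\<nu> \<delta> m)" using in_limit_iff[OF limit(1)] H by blast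
        then show "H = G" using G H by (auto simp: maximal_sets_def)
      qed
      then show ?thesis using G by blast
    qed
  qed
qed

sublocale regular "Fm \<zeta>" for \<zeta>
  by (rule regular_Fm)

lemma maximal_limit_iff:
  assumes "limit_ord \<delta>" "G \<in> fin_sets" "G \<noteq> {}"
  shows "G \<in> maximal_sets (Fm \<delta>) \<longleftrightarrow> G \<in> maximal_sets (Fm (\<nu> \<delta> (Min G)))"
proof -
  have fin: "finite G" using assms by (simp add: fin_sets_def)
  define k where "k = Suc (Max G)"
  have k: "\<forall>m\<in>G. m < k" using fin by (auto simp: k_def less_Suc_eq_le)
  have "insert k G \<in> Fm \<delta> \<longleftrightarrow> insert k G \<in> Fm (\<nu> \<delta> (Min G))"
    using in_limit_iff[OF assms(1) fin_sets_insert[OF assms(2) k]] assms(3) Min_insert_above[OF fin assms(3) k]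
    by (simp del: Min_insert)
  then show ?thesis
    using maximal_iff[of G] assms(3) k in_limit_iff[OF assms] maximal_in by metis
qed

text \<open>If maximal sets of level \<zeta> end in a complete base block, then cutting a set into
  level-\<zeta> blocks never cuts a base block, so the current base block is visible inside the
  current level-\<zeta> block.\<close>

lemma lastb_aligned_step:
  assumes "\<And>G. G \<in> maximal_sets (Fm \<zeta>) \<Longrightarrow> lastb (Fm 0) G \<in> maximal_sets (Fm 0)"
    and "E \<in> fin_sets" "E \<noteq> {}"
  shows "lastb (Fm 0) E = lastb (Fm 0) (lastb (Fm \<zeta>) E)"
  using assms(2,3)
proof (induction rule: fin_sets_induct)
  case (insert E k)
  show ?case
  proof (cases "E = {}")
    case True
    then show ?thesis using insert by (simp add: decomp_singleton)
  next
    case False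
    let ?L = "lastb (Fm \<zeta>) E"
    have L: "?L \<in> Fm \<zeta>" "?L \<noteq> {}" "?L \<subseteq> E" using lastb_props[OF insert(1) False] by auto
    have Lf: "?L \<in> fin_sets" "\<forall>m\<in>?L. m < k" using L sub_fin insert by auto
    have IH: "lastb (Fm 0) E = lastb (Fm 0) ?L" using insert False by blast
    show ?thesis
      using lastb_insert[OF insert(1) False insert(2)] lastb_insert[OF Lf(1) L(2) Lf(2), of 0] IH assms(1)[of ?L]
        decomp_singleton[OF insert(3)] by auto
  qed
qed simp

text \<open>Descend through the levels: maximality after a step passes to the last block one level
  below, maximality at a limit to the level chosen by the minimum, until the base is
  reached.\<close>

lemma lastb_maximal: "G \<in> maximal_sets (Fm \<zeta>) \<Longrightarrow> lastb (Fm 0) G \<in> maximal_sets (Fm 0)"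
proof (induction \<zeta> arbitrary: G rule: omega1_induct)
  case zero
  then show ?case using decomp_in[of G 0] maximal_in maximal_nonempty by auto
next
  case (succ \<beta>)
  have G: "G \<in> fin_sets" "G \<noteq> {}" using succ.prems maximal_in maximal_nonempty sub_fin by blast+
  then show ?case
    using succ maximal_step_iff[of G \<beta>] lastb_aligned_step[of \<beta> G] by (auto simp: Fm_osucc)
next
  case (limit \<delta>)
  have G: "G \<in> fin_sets" "G \<noteq> {}" using limit.prems maximal_in maximal_nonempty sub_fin by blast+
  then show ?case
    using limit maximal_limit_iff[OF limit(1) G] nu_less Min_ge_1 by blast
qed

lemma lastb_aligned:
  "E \<in> fin_sets \<Longrightarrow> E \<noteq> {} \<Longrightarrow> lastb (Fm 0) (lastb (Fm \<zeta>) E) = lastb (Fm 0) E"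
  using lastb_aligned_step[of \<zeta> E] lastb_maximal by simp

text \<open>At a successor the division by \<open>Min G\<close> cancels exactly the number of blocks
  of a maximal G. Keeping W abstract covers both the p-weights and the squared q-weights.\<close>

lemma sum_weights:
  fixes W :: "omega1 \<Rightarrow> nat set \<Rightarrow> real"
  assumes W_zero: "\<And>G. G \<in> maximal_sets (Fm 0) \<Longrightarrow> sum (W 0) (init_segs G) = 1"
    and W_osucc: "\<And>\<zeta> E. E \<in> Fm (osucc \<zeta>) \<Longrightarrow> E \<noteq> {} \<Longrightarrow>
      W (osucc \<zeta>) E = W \<zeta> (lastb (Fm \<zeta>) E) / real (Min E)"
    and W_limit: "\<And>\<delta> E. limit_ord \<delta> \<Longrightarrow> E \<in> Fm \<delta> \<Longrightarrow> E \<noteq> {} \<Longrightarrow> W \<delta> E = W (\<nu> \<delta> (Min E)) E"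
  shows "G \<in> maximal_sets (Fm \<zeta>) \<Longrightarrow> sum (W \<zeta>) (init_segs G) = 1"
proof (induction \<zeta> arbitrary: G rule: omega1_induct)
  case zero
  then show ?case by (rule W_zero)
next
  case (succ \<beta>)
  have G: "G \<in> fin_sets" "G \<noteq> {}" using succ.prems maximal_in maximal_nonempty sub_fin by blast+
  have fin: "finite G" using G by (simp add: fin_sets_def)
  have m: "nb (Fm \<beta>) G = Min G" "lastb (Fm \<beta>) G \<in> maximal_sets (Fm \<beta>)"
    using succ.prems maximal_step_iff[OF G] by (auto simp: Fm_osucc)
  have "sum (W (osucc \<beta>)) (init_segs G) = (\<Sum>E\<in>init_segs G. W \<beta> (lastb (Fm \<beta>) E) / real (Min G))"
  proof (rule sum.cong)
    fix E assume "E \<in> init_segs G"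
    then have E: "E \<noteq> {}" "init_seg E G" by (auto simp: init_segs_def)
    then have "E \<in> Fm (osucc \<beta>)"
      using hereditary[of G "osucc \<beta>" E] maximal_in[OF succ.prems] by (auto simp: init_seg_def)
    then show "W (osucc \<beta>) E = W \<beta> (lastb (Fm \<beta>) E) / real (Min G)"
      using W_osucc E init_seg_Min[OF E(2,1) fin] by simp
  qed simp
  also have "\<dots> = (\<Sum>E\<in>init_segs G. W \<beta> (lastb (Fm \<beta>) E)) / real (Min G)"
    by (simp add: sum_divide_distrib)
  also have "\<dots> = real (nb (Fm \<beta>) G) / real (Min G)"
    using sum_blocks[of \<beta> "W \<beta>" G] succ.IH G m by simp
  finally show ?case using m Min_ge_1[OF G] by simp
next
  case (limit \<delta>)
  have G: "G \<in> fin_sets" "G \<noteq> {}" using limit.prems maximal_in maximal_nonempty sub_fin by blast+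
  have fin: "finite G" using G by (simp add: fin_sets_def)
  have "sum (W \<delta>) (init_segs G) = sum (W (\<nu> \<delta> (Min G))) (init_segs G)"
  proof (rule sum.cong)
    fix E assume "E \<in> init_segs G"
    then have E: "E \<noteq> {}" "init_seg E G" by (auto simp: init_segs_def)
    then have "E \<in> Fm \<delta>"
      using hereditary[of G \<delta> E] maximal_in[OF limit.prems] by (auto simp: init_seg_def)
    then show "W \<delta> E = W (\<nu> \<delta> (Min G)) E"
      using W_limit[OF limit(1)] E init_seg_Min[OF E(2,1) fin] by simp
  qed simp
  also have "\<dots> = 1"
    using limit(2)[OF nu_less[OF limit(1) Min_ge_1[OF G]]] maximal_limit_iff[OF limit(1) G] limit.prems by blast
  finally show ?case .
qed

text \<open>Ranks the tree of sets by counting base blocks only: the value may stay constant inside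
  a base block and drops when one begins. A Schreier step multiplies by \<omega>, since the number
  of available blocks is finite but unknown until the minimum is chosen; hence the root value
  \<omega>^\<zeta>.\<close>

lemma ex_rank:
  "\<exists>\<rho>. \<rho> {} = opow omega \<zeta> \<and> (\<forall>E k. insert k E \<in> Fm \<zeta> \<longrightarrow> (\<forall>m\<in>E. m < k) \<longrightarrow>
     \<rho> (insert k E) \<le> \<rho> E \<and> (lastb (Fm 0) (insert k E) = {k} \<longrightarrow> \<rho> (insert k E) < \<rho> E))"
proof (induction \<zeta> rule: omega1_induct)
  case zero
  show ?case
  proof (intro exI[of _ "\<lambda>E. if E = {} then 1 else 0"] conjI allI impI)
    fix E k assume *: "insert k E \<in> Fm 0" "\<forall>m\<in>E. m < (k::nat)"
    show "(if insert k E = {} then 1 else 0) \<le> (if E = {} then 1 else 0 :: omega1)"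
      by (simp add: omega1_zero_le)
    assume "lastb (Fm 0) (insert k E) = {k}"
    then have "insert k E = {k}" using decomp_in[OF *(1)] by simp
    then have "E = {}" using * by blast
    then show "(if insert k E = {} then 1 else 0) < (if E = {} then 1 else 0 :: omega1)"
      by (simp add: less_one_iff)
  qed (simp add: opow_zero)
next
  case (succ \<beta>)
  let ?F = "Fm \<beta>" and ?\<alpha> = "opow omega \<beta>"
  obtain \<rho> where \<rho>: "\<rho> {} = ?\<alpha>" "\<And>E k. insert k E \<in> ?F \<Longrightarrow> \<forall>m\<in>E. m < k \<Longrightarrow> \<rho> (insert k E) \<le> \<rho> E"
    "\<And>E k. insert k E \<in> ?F \<Longrightarrow> \<forall>m\<in>E. m < k \<Longrightarrow> lastb (Fm 0) (insert k E) = {k} \<Longrightarrow> \<rho> (insert k E) < \<rho> E"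
    using succ by blast
  have sing: "\<rho> {k} < ?\<alpha>" if "k \<ge> 1" for k
    using \<rho>(3)[of k "{}"] that \<rho>(1) by (simp add: singleton_in decomp_singleton)
  \<comment> \<open>One copy of \<open>?\<alpha>\<close> for each block that may still begin,
    followed by the rank inside the current block. The order of the summands matters, as ordinal
    addition is strictly monotone on the right.\<close>
  define \<rho>' where "\<rho>' E = (if E = {} then ?\<alpha> * omega else nmul (Min E - nb ?F E) ?\<alpha> + \<rho> (lastb ?F E))" for E
  have "\<rho>' (insert k E) \<le> \<rho>' E \<and> (lastb (Fm 0) (insert k E) = {k} \<longrightarrow> \<rho>' (insert k E) < \<rho>' E)"
    if E: "insert k E \<in> Fm (osucc \<beta>)" "\<forall>m\<in>E. m < k" for E k
  proof (cases "E = {}")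
    case True
    have k: "k \<ge> 1" using E sub_fin[of "osucc \<beta>"] by (auto simp: fin_sets_def intro: Suc_leI gr0I)
    have "nmul (k - 1) ?\<alpha> + \<rho> {k} < nmul (k - 1) ?\<alpha> + ?\<alpha>" using sing[OF k] plus_less_mono by blast
    also have "\<dots> = nmul (Suc (k - 1)) ?\<alpha>" by simp
    also have "\<dots> < ?\<alpha> * omega" by (rule nmul_less_times_omega[OF opow_pos])
    finally have "\<rho>' {k} < \<rho>' {}" using k by (simp add: \<rho>'_def decomp_singleton)
    then show ?thesis using True by simp
  next
    case False
    have Ef: "E \<in> fin_sets" using E sub_fin[of "osucc \<beta>"] by (auto simp: fin_sets_def)
    have fE: "finite E" using Ef by (simp add: fin_sets_def)
    have k: "k \<ge> 1" using E sub_fin[of "osucc \<beta>"] by (auto simp: fin_sets_def intro: Suc_leI gr0I)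
    let ?L = "lastb ?F E"
    have L: "?L \<in> ?F" "?L \<noteq> {}" "?L \<subseteq> E" using lastb_props[OF Ef False] by auto
    have le: "nb ?F (insert k E) \<le> Min E"
      using E step_iff[of "insert k E" \<beta>] Min_insert_above[OF fE False E(2)] by (auto simp: Fm_osucc simp del: Min_insert)
    have new: "\<rho>' (insert k E) = nmul (Min E - nb ?F (insert k E)) ?\<alpha> + \<rho> (lastb ?F (insert k E))"
      using Min_insert_above[OF fE False E(2)] by (simp add: \<rho>'_def del: Min_insert)
    have old: "\<rho>' E = nmul (Min E - nb ?F E) ?\<alpha> + \<rho> ?L" using False by (simp add: \<rho>'_def)
    show ?thesis
    proof (cases "?L \<in> maximal_sets ?F")
      case True
      then have n: "nb ?F (insert k E) = Suc (nb ?F E)" "lastb ?F (insert k E) = {k}"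
        using nb_insert[OF Ef False E(2)] lastb_insert[OF Ef False E(2)] by auto
      then have "\<rho>' (insert k E) < nmul (Min E - Suc (nb ?F E)) ?\<alpha> + ?\<alpha>"
        using new sing[OF k] plus_less_mono by simp
      also have "\<dots> = nmul (Min E - nb ?F E) ?\<alpha>"
        using le n by (metis Suc_diff_Suc Suc_le_lessD nmul.simps(2))
      also have "\<dots> \<le> \<rho>' E" unfolding old by (rule plus_ge_left)
      finally show ?thesis by simp
    next
      case nmax: False
      then have n: "nb ?F (insert k E) = nb ?F E" "lastb ?F (insert k E) = insert k ?L"
        using nb_insert[OF Ef False E(2)] lastb_insert[OF Ef False E(2)] by auto
      have ab: "\<forall>m\<in>?L. m < k" using L E by blast
      have "insert k ?L \<in> ?F" using maximal_iff[OF L(1,2) ab] nmax by blast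
      note r = \<rho>(2,3)[OF this ab]
      \<comment> \<open>Alignment: whether k opens a base block of the whole set can be read off the
        current level-\<beta> block.\<close>
      moreover have "lastb (Fm 0) (insert k ?L) = lastb (Fm 0) (insert k E)"
        using lastb_aligned[OF fin_sets_insert[OF Ef E(2)], of \<beta>] n k by simp
      ultimately show ?thesis unfolding new old n using plus_le_mono plus_less_mono by simp
    qed
  qed
  then show ?case by (intro exI[of _ \<rho>']) (auto simp: \<rho>'_def opow_osucc)
next
  case (limit \<delta>)
  then obtain \<rho> where \<rho>: "\<And>\<eta>. \<eta> < \<delta> \<Longrightarrow> \<rho> \<eta> {} = opow omega \<eta>"
    "\<And>\<eta> E k. \<eta> < \<delta> \<Longrightarrow> insert k E \<in> Fm \<eta> \<Longrightarrow> \<forall>m\<in>E. m < k \<Longrightarrow> \<rho> \<eta> (insert k E) \<le> \<rho> \<eta> E"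
    "\<And>\<eta> E k. \<eta> < \<delta> \<Longrightarrow> insert k E \<in> Fm \<eta> \<Longrightarrow> \<forall>m\<in>E. m < k \<Longrightarrow> lastb (Fm 0) (insert k E) = {k} \<Longrightarrow>
       \<rho> \<eta> (insert k E) < \<rho> \<eta> E"
    by metis
  \<comment> \<open>The first element selects a level below \<delta>, so the value falls at once
    below the power at \<delta>; from then on the ranking of that level applies.\<close>
  define \<rho>' where "\<rho>' E = (if E = {} then opow omega \<delta> else \<rho> (\<nu> \<delta> (Min E)) E)" for E
  have "\<rho>' (insert k E) \<le> \<rho>' E \<and> (lastb (Fm 0) (insert k E) = {k} \<longrightarrow> \<rho>' (insert k E) < \<rho>' E)"
    if E: "insert k E \<in> Fm \<delta>" "\<forall>m\<in>E. m < k" for E k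
  proof -
    have kE: "insert k E \<in> fin_sets" using E sub_fin by blast
    then have lt: "\<nu> \<delta> (Min (insert k E)) < \<delta>" using nu_less[OF limit(1)] Min_ge_1 by blast
    have inF: "insert k E \<in> Fm (\<nu> \<delta> (Min (insert k E)))" using in_limit_iff[OF limit(1) kE] E by blast
    note r = \<rho>(2,3)[OF lt inF E(2)]
    show ?thesis
    proof (cases "E = {}")
      case True
      then have "\<rho>' {k} \<le> \<rho> (\<nu> \<delta> k) {}" using r(1) by (simp add: \<rho>'_def)
      also have "\<dots> < opow omega \<delta>" using \<rho>(1) lt opow_less_mono True by simp
      finally show ?thesis using True by (simp add: \<rho>'_def)
    next
      case False
      have "finite E" using kE by (simp add: fin_sets_def)
      then show ?thesis
        using r Min_insert_above[OF _ False E(2)] False by (simp add: \<rho>'_def del: Min_insert)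
    qed
  qed
  then show ?case by (intro exI[of _ \<rho>']) (auto simp: \<rho>'_def)
qed

text \<open>Starting at index 1 makes \<open>Fm 1\<close> the base. Limits absorb the added 1, and
  the governing levels, being nonzero, are again of the form 1 + \<eta>. With \<open>ex_rank\<close>
  this ranks \<open>Fm (1 + \<zeta>)\<close> by \<omega>^\<zeta>, counting
  \<open>Fm 1\<close>-blocks.\<close>

lemma ladder_shift:
  assumes "\<And>\<delta> n. limit_ord \<delta> \<Longrightarrow> n \<ge> 1 \<Longrightarrow> \<nu> \<delta> n \<noteq> 0"
  shows "\<exists>\<nu>'. ladder (\<lambda>\<zeta>. Fm (1 + \<zeta>)) \<nu>'"
proof -
  have "\<exists>\<eta><\<delta>. 1 + \<eta> = \<nu> \<delta> n" if "limit_ord \<delta>" "n \<ge> 1" for \<delta> n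
    using one_plus_surj[OF assms[OF that]] nu_less[OF that] by (meson order_le_less_trans)
  then obtain \<nu>' where \<nu>': "\<And>\<delta> n. limit_ord \<delta> \<Longrightarrow> n \<ge> 1 \<Longrightarrow> \<nu>' \<delta> n < \<delta> \<and> 1 + \<nu>' \<delta> n = \<nu> \<delta> n"
    by metis
  have "ladder (\<lambda>\<zeta>. Fm (1 + \<zeta>)) \<nu>'"
    unfolding ladder_def
  proof (intro conjI allI impI)
    fix \<delta> assume \<delta>: "limit_ord \<delta>"
    have "E \<in> Fm (\<nu> \<delta> (Min E)) \<longleftrightarrow> E \<in> Fm (1 + \<nu>' \<delta> (Min E))" if "E \<in> fin_sets" "E \<noteq> {}" for E
      using \<nu>' \<delta> Min_ge_1 that by simp
    then show "Fm (1 + \<delta>) = {{}} \<union> {E \<in> fin_sets. E \<noteq> {} \<and> E \<in> Fm (1 + \<nu>' \<delta> (Min E))}"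
      unfolding one_plus_limit[OF \<delta>] using Fm_limit[OF \<delta>] by auto
    show "\<nu>' \<delta> n < \<delta>" if "n \<ge> 1" for n using \<nu>' \<delta> that by blast
    show "Fm (1 + \<nu>' \<delta> n) \<subseteq> Fm (1 + \<nu>' \<delta> (Suc n))" if "n \<ge> 1" for n
      using \<nu>'[OF \<delta> that] \<nu>'[OF \<delta>, of "Suc n"] nu_mono[OF \<delta> that] by simp
  qed (use regular_Fm in \<open>auto simp: plus_osucc Fm_osucc\<close>)
  then show ?thesis by blast
qed

end

section \<open>Schreier families and their weights\<close>

text \<open>Existence: keep removing a maximal initial segment from the rest of M. Uniqueness
  justifies the definite description behind \<open>inf_decomp\<close>.\<close>

lemma (in regular) ex1_inf_decomp:
  assumes M: "M \<in> inf_subsets {1..}"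
  shows "\<exists>!G :: nat \<Rightarrow> nat set. (\<forall>k. G k \<in> maximal_sets F) \<and> (\<forall>j k. j < k \<longrightarrow> set_less (G j) (G k)) \<and> (\<Union>k. G k) = M"
    (is "\<exists>!G. ?P G")
proof (rule ex_ex1I)
  obtain g where g: "\<And>M. M \<in> inf_subsets {1..} \<Longrightarrow> g M \<in> maximal_sets F \<and> init_seg (g M) M"
    using ex_maximal by metis
  define R where "R = rec_nat M (\<lambda>_ N. N - g N)"
  have R0: "R 0 = M" and RS: "R (Suc n) = R n - g (R n)" for n by (simp_all add: R_def)
  have Rin: "R n \<in> inf_subsets {1..}" for n
  proof (induction n)
    case (Suc n)
    then show ?case
      unfolding RS using g[OF Suc] maximal_in finite_in by (auto simp: inf_subsets_def)
  qed (use M in \<open>simp only: R0\<close>)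
  define G where "G n = g (R n)" for n
  have G: "G n \<in> maximal_sets F" "init_seg (G n) (R n)" for n using g[OF Rin] by (auto simp: G_def)
  have anti: "R n \<subseteq> R m" if "m \<le> n" for m n
    using that by (induction n rule: dec_induct) (auto simp: RS)
  have less: "set_less (G j) (G k)" if "j < k" for j k
  proof -
    have "G k \<subseteq> R j - G j" using G(2)[of k] anti[of "Suc j" k] that RS[of j] by (auto simp: init_seg_def G_def)
    then show ?thesis using G(2)[of j] unfolding set_less_def init_seg_def by (meson DiffD1 DiffD2 not_le subsetD)
  qed
  have sub: "G k \<subseteq> M" for k using G(2)[of k] anti[of 0 k] R0 by (auto simp: init_seg_def)
  have "M \<subseteq> (\<Union>k. G k)"
  proof
    fix x assume x: "x \<in> M"
    show "x \<in> (\<Union>k. G k)"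
    proof (rule ccontr)
      assume nin: "x \<notin> (\<Union>k. G k)"
      \<comment> \<open>An uncovered x survives in every remainder and so bounds all blocks, whose
        strictly increasing minima cannot stay below x.\<close>
      have xR: "x \<in> R k" for k by (induction k) (use x nin in \<open>auto simp: R0 RS G_def\<close>)
      have lt: "m < x" if "m \<in> G k" for m k
        using G(2)[of k] xR[of k] that nin unfolding init_seg_def by (meson UN_I UNIV_I not_le)
      have ne: "G k \<noteq> {}" "finite (G k)" for k using G(1)[of k] maximal_nonempty maximal_in finite_in by auto
      have mono: "Min (G j) < Min (G k)" if "j < k" for j k
        using less[OF that] Min_in[OF ne(2,1), of j] Min_in[OF ne(2,1), of k] by (simp add: set_less_def)
      have "inj (\<lambda>k. Min (G k))"
      proof (rule linorder_injI)
        show "Min (G j) \<noteq> Min (G k)" if "j < k" for j k using mono[OF that] by simp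
      qed
      moreover have "range (\<lambda>k. Min (G k)) \<subseteq> {..<x}"
        using lt[OF Min_in[OF ne(2,1)]] by auto
      ultimately show False using finite_subset range_inj_infinite by blast
    qed
  qed
  then have "?P G" using G less sub by blast
  then show "\<exists>G. ?P G" by blast
next
  fix G G' assume GG: "?P G" "?P G'"
  \<comment> \<open>Each block is an initial segment of what its predecessors leave; two candidates
    for the k-th block are then comparable, and maximality identifies them.\<close>
  have seg: "init_seg (H k) (M - (\<Union>j<k. H j))" if H: "?P H" for H k
    unfolding init_seg_def
  proof (intro conjI ballI impI)
    show "H k \<subseteq> M - (\<Union>j<k. H j)" using H by (force simp: set_less_def)
    fix m n assume mn: "m \<in> H k" "n \<in> M - (\<Union>j<k. H j)" "n \<le> m"
    then obtain i where i: "n \<in> H i" "\<not> i < k" using H by blast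
    then have "i = k"
      using H mn unfolding set_less_def by (metis leD nat_neq_iff)
    then show "n \<in> H k" using i by simp
  qed
  have "G k = G' k" for k
  proof (induction k rule: less_induct)
    case (less k)
    then have "(\<Union>j<k. G j) = (\<Union>j<k. G' j)" by auto
    then have "init_seg (G k) (G' k) \<or> init_seg (G' k) (G k)"
      using init_seg_linear[OF seg[OF GG(1), of k]] seg[OF GG(2), of k] by simp
    moreover have m: "G k \<in> maximal_sets F" "G' k \<in> maximal_sets F" using GG by auto
    ultimately show ?case
    proof (elim disjE)
      assume "init_seg (G k) (G' k)"
      then show ?thesis using m(1) maximal_in[OF m(2)] unfolding maximal_sets_def by blast
    next
      assume "init_seg (G' k) (G k)"
      then show ?thesis using m(2) maximal_in[OF m(1)] unfolding maximal_sets_def by blast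
    qed
  qed
  then show "G = G'" by blast
qed

lemma (in regular) inf_decomp_maximal:
  "M \<in> inf_subsets {1..} \<Longrightarrow> inf_decomp F M k \<in> maximal_sets F"
  unfolding inf_decomp_def using theI'[OF ex1_inf_decomp] by blast

lemma fin_sets_Min:
  assumes "E \<in> fin_sets" "E \<noteq> {}"
  shows "finite E" "Min E \<in> E" "Min E \<ge> 1" "\<And>x. x \<in> E \<Longrightarrow> Min E \<le> x"
proof -
  show fin: "finite E" using assms by (simp add: fin_sets_def)
  show m: "Min E \<in> E" "\<And>x. x \<in> E \<Longrightarrow> Min E \<le> x" using fin assms by auto
  show "Min E \<ge> 1" using m(1) assms(1) by (metis (no_types, lifting) One_nat_def Suc_leI fin_sets_def gr0I mem_Collect_eq)
qed

lemma schreier_step_fin_sets: "F \<subseteq> fin_sets \<Longrightarrow> schreier_step F \<subseteq> fin_sets"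
  by (fastforce simp: schreier_step_def fin_sets_def)

lemma subset_schreier_step:
  assumes "F \<subseteq> fin_sets"
  shows "F \<subseteq> schreier_step F"
proof
  fix E assume E: "E \<in> F"
  show "E \<in> schreier_step F"
  proof (cases "E = {}")
    case False
    have "E \<in> fin_sets" using E assms by blast
    then have "length [E] \<le> Min (hd [E])" using fin_sets_Min(3)[OF _ False] by simp
    then show ?thesis using E False unfolding schreier_step_def by (intro UnI2 CollectI exI[of _ "[E]"]) simp
  qed (simp add: schreier_step_def)
qed

lemma regular_schreier_zero: "regular (schreier \<kappa> 0)"
proof
  show "\<exists>G\<in>maximal_sets (schreier \<kappa> 0). init_seg G M" if M: "M \<in> inf_subsets {1..}" for M
  proof -
    obtain m where "m \<in> M" "\<And>x. x \<in> M \<Longrightarrow> m \<le> x" using inf_subset_Least[OF M] by metis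
    then have "{m} \<in> maximal_sets (schreier \<kappa> 0)" "init_seg {m} M"
      using M by (auto simp: schreier_zero maximal_sets_def init_seg_def inf_subsets_def intro: order_antisym)
    then show ?thesis by blast
  qed
qed (auto simp: schreier_zero fin_sets_def)

lemma characteristic_less:
  "characteristic_sequences \<kappa> \<Longrightarrow> limit_ord \<delta> \<Longrightarrow> n \<ge> 1 \<Longrightarrow> osucc (\<kappa> \<delta> n) < \<delta>"
  by (simp add: characteristic_sequences_def osucc_less_limit)

lemma schreier_fin_sets:
  assumes "characteristic_sequences \<kappa>"
  shows "schreier \<kappa> \<xi> \<subseteq> fin_sets"
proof (induction \<xi> rule: omega1_induct)
  case zero
  then show ?case by (auto simp: schreier_zero fin_sets_def)
next
  case (succ \<beta>)
  then show ?case by (simp add: schreier_osucc schreier_step_fin_sets)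
next
  case (limit \<delta>)
  then show ?case
    using assms by (subst schreier_limit) (auto simp: characteristic_sequences_def fin_sets_def)
qed

lemma ladder_schreier:
  assumes "characteristic_sequences \<kappa>"
  shows "ladder (schreier \<kappa>) (\<lambda>\<delta> n. osucc (\<kappa> \<delta> n))"
proof
  fix \<delta> n assume \<delta>: "limit_ord \<delta>"
  show "osucc (\<kappa> \<delta> n) < \<delta>" if "n \<ge> 1" using characteristic_less[OF assms \<delta> that] .
  \<comment> \<open>The assumed inclusion ends at level \<open>\<kappa> \<delta> (Suc n)\<close>;
    one further Schreier step only enlarges the family.\<close>
  show "schreier \<kappa> (osucc (\<kappa> \<delta> n)) \<subseteq> schreier \<kappa> (osucc (\<kappa> \<delta> (Suc n)))" if "n \<ge> 1"
    using assms \<delta> that subset_schreier_step[OF schreier_fin_sets[OF assms]]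
    unfolding characteristic_sequences_def schreier_osucc[of \<kappa> "\<kappa> \<delta> (Suc n)"] by blast
  show "schreier \<kappa> \<delta> = {{}} \<union> {E \<in> fin_sets. E \<noteq> {} \<and> E \<in> schreier \<kappa> (osucc (\<kappa> \<delta> (Min E)))}"
    using assms \<delta> by (intro schreier_limit) (auto simp: characteristic_sequences_def)
qed (simp_all add: schreier_osucc regular.empty_in regular.sub_fin regular.singleton_in regular.hereditary
    regular.extendable regular.ex_maximal regular_schreier_zero)

lemma fam_comp_mono: "G \<subseteq> G' \<Longrightarrow> fam_comp G F \<subseteq> fam_comp G' F"
  unfolding fam_comp_def by blast

lemma Min_image_Min:
  assumes "Es \<noteq> []" "\<forall>E\<in>set Es. E \<noteq> {} \<and> finite E"
  shows "Min (Min ` set Es) = Min (\<Union>(set Es))"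
proof (rule Min_eqI)
  have "Min (\<Union>(set Es)) \<in> \<Union>(set Es)" using assms by (intro Min_in) auto
  then obtain E where E: "E \<in> set Es" "Min (\<Union>(set Es)) \<in> E" by blast
  have le: "Min (\<Union>(set Es)) \<le> y" if "y \<in> \<Union>(set Es)" for y using that assms by (intro Min_le) auto
  have "Min E = Min (\<Union>(set Es))"
  proof (rule Min_eqI)
    show "Min (\<Union>(set Es)) \<le> y" if "y \<in> E" for y using le[of y] E that by blast
  qed (use E assms in auto)
  then show "Min (\<Union>(set Es)) \<in> Min ` set Es" using E by (metis image_eqI)
  show "Min (\<Union>(set Es)) \<le> y" if "y \<in> Min ` set Es" for y
    using that assms le Min_in by blast
qed simp

lemma fam_comp_singletons:
  assumes "F \<subseteq> fin_sets" "{} \<in> F"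
  shows "fam_comp (schreier \<kappa> 0) F = F"
proof (intro equalityI subsetI)
  fix E assume "E \<in> fam_comp (schreier \<kappa> 0) F"
  then consider "E = {}" | Es where "E = \<Union>(set Es)" "Es \<noteq> []" "sorted_wrt set_less Es"
      "\<forall>E\<in>set Es. E \<noteq> {} \<and> E \<in> F" "Min ` set Es \<in> schreier \<kappa> 0"
    by (auto simp: fam_comp_def)
  then show "E \<in> F"
  proof cases
    case 2
    obtain A Fs where Es: "Es = A # Fs" using 2 by (cases Es) auto
    have "Fs = []"
    proof (rule ccontr)
      assume "Fs \<noteq> []"
      then obtain B Gs where B: "Fs = B # Gs" by (cases Fs) auto
      then have "Min A < Min B"
      proof -
        have "A \<in> fin_sets" "A \<noteq> {}" "B \<in> fin_sets" "B \<noteq> {}" "set_less A B"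
          using 2(3,4) Es B assms(1) by auto
        then show ?thesis using fin_sets_Min(2) unfolding set_less_def by blast
      qed
      then show False using 2(5) Es B by (auto simp: schreier_zero)
    qed
    then show ?thesis using 2 Es by simp
  qed (use assms in simp)
next
  fix E assume E: "E \<in> F"
  show "E \<in> fam_comp (schreier \<kappa> 0) F"
  proof (cases "E = {}")
    case False
    then have "Min E \<ge> 1" using fin_sets_Min E assms by blast
    then show ?thesis
      unfolding fam_comp_def schreier_zero using E False by (intro UnI2 CollectI exI[of _ "[E]"]) auto
  qed (simp add: fam_comp_def)
qed

lemma sorted_wrt_concat:
  assumes "sorted_wrt set_less Gs" "\<forall>G\<in>set Gs. sorted_wrt set_less (f G) \<and> \<Union>(set (f G)) = G"
  shows "sorted_wrt set_less (concat (map f Gs))"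
  using assms
proof (induction Gs)
  case (Cons A Gs)
  have "set_less B C" if BC: "B \<in> set (f A)" "C \<in> set (concat (map f Gs))" for B C
  proof -
    obtain D where D: "D \<in> set Gs" "C \<in> set (f D)" using BC by auto
    then have "\<Union>(set (f D)) = D" "\<Union>(set (f A)) = A" "set_less A D" using Cons.prems by auto
    then have "C \<subseteq> D" "B \<subseteq> A" "set_less A D" using D BC by blast+
    then show ?thesis by (auto simp: set_less_def)
  qed
  then show ?case using Cons by (auto simp: sorted_wrt_append)
qed simp

lemma sorted_wrt_trichotomy:
  assumes "sorted_wrt P xs" "x \<in> set xs" "y \<in> set xs"
  shows "x = y \<or> P x y \<or> P y x"
  using assms by (induction xs) auto

text \<open>The identity S_(\<zeta>+1)[S_\<xi>] = S_1[S_\<zeta>[S_\<xi>]]. In one direction a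
  partition of the set of minima is lifted to the blocks, in the other the minima are collected
  piece by piece; the first minimum is preserved, so the bound on the number of pieces carries
  over.\<close>

lemma fam_comp_step:
  assumes F: "F \<subseteq> fin_sets"
  shows "fam_comp (schreier_step G) F = schreier_step (fam_comp G F)"
proof (intro equalityI subsetI)
  fix E assume "E \<in> fam_comp (schreier_step G) F"
  then consider "E = {}" | Es where "E = \<Union>(set Es)" "Es \<noteq> []" "sorted_wrt set_less Es"
      "\<forall>E\<in>set Es. E \<noteq> {} \<and> E \<in> F" "Min ` set Es \<in> schreier_step G"
    by (auto simp: fam_comp_def)
  then show "E \<in> schreier_step (fam_comp G F)"
  proof cases
    case Es: 2
    then obtain Ns where Ns: "Min ` set Es = \<Union>(set Ns)" "Ns \<noteq> []" "sorted_wrt set_less Ns"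
      "\<forall>N\<in>set Ns. N \<noteq> {} \<and> N \<in> G" "length Ns \<le> Min (hd Ns)"
      by (auto simp: schreier_step_def)
    have fin: "finite B" "Min B \<in> B" "\<And>x. x \<in> B \<Longrightarrow> Min B \<le> x" if "B \<in> set Es" for B
      using fin_sets_Min[of B] that Es(4) F by auto
    \<comment> \<open>Groups the blocks by the piece of the partition that contains their
      minimum.\<close>
    define h where "h N = filter (\<lambda>B. Min B \<in> N) Es" for N
    have mins: "Min ` set (h N) = N" if "N \<in> set Ns" for N
    proof -
      have "N \<subseteq> Min ` set Es" using Ns(1) that by blast
      then show ?thesis by (auto simp: h_def)
    qed
    have h_in: "\<Union>(set (h N)) \<in> fam_comp G F \<and> \<Union>(set (h N)) \<noteq> {}" if "N \<in> set Ns" for N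
    proof -
      have "h N \<noteq> []" using mins[OF that] Ns(4) that by force
      moreover have "sorted_wrt set_less (h N)" "\<forall>E\<in>set (h N). E \<noteq> {} \<and> E \<in> F"
        using Es(3,4) by (auto simp: h_def sorted_wrt_filter)
      ultimately show ?thesis
        using mins[OF that] Ns(4) that unfolding fam_comp_def
        by (auto intro!: exI[of _ "h N"])
    qed
    let ?Gs = "map (\<lambda>N. \<Union>(set (h N))) Ns"
    have srt: "sorted_wrt set_less ?Gs"
      unfolding sorted_wrt_map
    proof (rule sorted_wrt_mono_rel[OF _ Ns(3)])
      fix N N' assume NN: "set_less N N'"
      show "set_less (\<Union>(set (h N))) (\<Union>(set (h N')))"
        unfolding set_less_def
      proof (intro ballI)
        fix m n assume "m \<in> \<Union>(set (h N))" "n \<in> \<Union>(set (h N'))"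
        then obtain B B' where B: "B \<in> set Es" "Min B \<in> N" "m \<in> B" "B' \<in> set Es" "Min B' \<in> N'" "n \<in> B'"
          by (auto simp: h_def)
        then have lt: "Min B < Min B'" using NN by (auto simp: set_less_def)
        have "set_less B B'"
          using sorted_wrt_trichotomy[OF Es(3) B(1,4)] lt fin[OF B(1)] fin[OF B(4)]
          unfolding set_less_def by (metis less_irrefl order_less_trans)
        then show "m < n" using B by (auto simp: set_less_def)
      qed
    qed
    have un: "\<Union>(set ?Gs) = E"
    proof -
      have "\<exists>N\<in>set Ns. Min B \<in> N" if "B \<in> set Es" for B using Ns(1) that by blast
      then show ?thesis unfolding Es(1) by (auto simp: h_def)
    qed
    have hd: "hd Ns \<in> set Ns" using Ns(2) by simp
    have "Min (hd Ns) \<le> Min (\<Union>(set (h (hd Ns))))"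
    proof (rule Min.boundedI)
      show "finite (\<Union>(set (h (hd Ns))))" using fin by (auto simp: h_def)
      show "\<Union>(set (h (hd Ns))) \<noteq> {}" using h_in[OF hd] by blast
      fix a assume "a \<in> \<Union>(set (h (hd Ns)))"
      then obtain B where B: "B \<in> set Es" "Min B \<in> hd Ns" "a \<in> B" by (auto simp: h_def)
      have "finite (hd Ns)" using mins[OF hd] by (metis List.finite_set finite_imageI)
      then show "Min (hd Ns) \<le> a" using B fin[OF B(1)] by (meson Min_le order_trans)
    qed
    then have "length ?Gs \<le> Min (hd ?Gs)" using Ns(2,5) by (simp add: list.map_sel(1))
    then show ?thesis
      unfolding schreier_step_def using srt un h_in Ns(2)
      by (intro UnI2 CollectI exI[of _ ?Gs]) auto
  qed (simp add: schreier_step_def)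
next
  fix E assume "E \<in> schreier_step (fam_comp G F)"
  then consider "E = {}" | Gs where "E = \<Union>(set Gs)" "Gs \<noteq> []" "sorted_wrt set_less Gs"
      "\<forall>E\<in>set Gs. E \<noteq> {} \<and> E \<in> fam_comp G F" "length Gs \<le> Min (hd Gs)"
    by (auto simp: schreier_step_def)
  then show "E \<in> fam_comp (schreier_step G) F"
  proof cases
    case Gs: 2
    have "\<forall>H\<in>set Gs. \<exists>Es. H = \<Union>(set Es) \<and> Es \<noteq> [] \<and> sorted_wrt set_less Es \<and>
       (\<forall>E\<in>set Es. E \<noteq> {} \<and> E \<in> F) \<and> Min ` set Es \<in> G"
      using Gs(4) unfolding fam_comp_def by blast
    then obtain f where f: "\<And>H. H \<in> set Gs \<Longrightarrow> H = \<Union>(set (f H)) \<and> f H \<noteq> [] \<and> sorted_wrt set_less (f H) \<and>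
       (\<forall>E\<in>set (f H). E \<noteq> {} \<and> E \<in> F) \<and> Min ` set (f H) \<in> G"
      by metis
    let ?Es = "concat (map f Gs)"
    let ?N = "\<lambda>H. Min ` set (f H)"
    have sub: "?N H \<subseteq> H \<and> finite (?N H) \<and> ?N H \<noteq> {}" if "H \<in> set Gs" for H
      using f[OF that] F fin_sets_Min(2) by fastforce
    have hd: "hd Gs \<in> set Gs" using Gs(2) by simp
    have "\<forall>E\<in>set (f (hd Gs)). finite E" using f[OF hd] F unfolding fin_sets_def by blast
    then have "finite (\<Union>(set (f (hd Gs))))" by blast
    then have finH: "finite (hd Gs)" using f[OF hd] by metis
    have "Min (hd Gs) \<le> Min (?N (hd Gs))"
      using sub[OF hd] finH by (intro Min_antimono) auto
    then have "length (map ?N Gs) \<le> Min (hd (map ?N Gs))" using Gs(2,5) by (simp add: list.map_sel(1))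
    moreover have "sorted_wrt set_less (map ?N Gs)"
      unfolding sorted_wrt_map
    proof (rule sorted_wrt_mono_rel[OF _ Gs(3)])
      fix H H' assume "H \<in> set Gs" "H' \<in> set Gs" "set_less H H'"
      then show "set_less (?N H) (?N H')" using sub[of H] sub[of H'] unfolding set_less_def by blast
    qed
    ultimately have "\<Union>(set (map ?N Gs)) \<in> schreier_step G"
      unfolding schreier_step_def using Gs(2) sub f
      by (intro UnI2 CollectI exI[of _ "map ?N Gs"]) auto
    moreover have "\<Union>(set (map ?N Gs)) = Min ` set ?Es" by auto
    ultimately have "Min ` set ?Es \<in> schreier_step G" by simp
    moreover have "sorted_wrt set_less ?Es" using sorted_wrt_concat[OF Gs(3)] f by metis
    moreover have "?Es \<noteq> []" using Gs(2) f[OF hd] hd by auto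
    moreover have "\<Union>(set ?Es) = E"
    proof -
      have "\<Union>(set ?Es) = (\<Union>H\<in>set Gs. \<Union>(set (f H)))" by auto
      also have "\<dots> = (\<Union>H\<in>set Gs. H)" using f by (intro SUP_cong) auto
      finally show ?thesis unfolding Gs(1) by simp
    qed
    moreover have "\<forall>E\<in>set ?Es. E \<noteq> {} \<and> E \<in> F" using f by auto
    ultimately show ?thesis unfolding fam_comp_def by blast
  qed (simp add: fam_comp_def)
qed

lemma schreier2_zero:
  assumes "characteristic_sequences \<kappa>"
  shows "schreier2 \<kappa> \<xi> 0 = schreier \<kappa> \<xi>"
  unfolding schreier2_def
  using fam_comp_singletons schreier_fin_sets[OF assms] regular.empty_in[OF ladder.regular_Fm[OF ladder_schreier[OF assms]]]
  by blast

text \<open>At limits the point is that the minimum of the block minima is the minimum of the union,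
  so both descriptions select the same characteristic index.\<close>

lemma ladder_schreier2:
  assumes "characteristic_sequences \<kappa>"
  shows "ladder (schreier2 \<kappa> \<xi>) (\<lambda>\<delta> n. osucc (\<kappa> \<delta> n))"
proof -
  interpret S: ladder "schreier \<kappa>" "\<lambda>\<delta> n. osucc (\<kappa> \<delta> n)" by (rule ladder_schreier[OF assms])
  show ?thesis
    unfolding ladder_def schreier2_zero[OF assms]
  proof (intro conjI allI impI)
    show "regular (schreier \<kappa> \<xi>)" by (rule S.regular_Fm)
    show "schreier2 \<kappa> \<xi> (osucc \<zeta>) = schreier_step (schreier2 \<kappa> \<xi> \<zeta>)" for \<zeta>
      by (simp add: schreier2_def schreier_osucc fam_comp_step[OF schreier_fin_sets[OF assms]])
    fix \<delta> assume \<delta>: "limit_ord \<delta>"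
    show "osucc (\<kappa> \<delta> n) < \<delta>" if "n \<ge> 1" for n using S.nu_less[OF \<delta> that] .
    show "schreier2 \<kappa> \<xi> (osucc (\<kappa> \<delta> n)) \<subseteq> schreier2 \<kappa> \<xi> (osucc (\<kappa> \<delta> (Suc n)))" if "n \<ge> 1" for n
      unfolding schreier2_def using fam_comp_mono[OF S.nu_mono[OF \<delta> that]] .
    have *: "Min ` set Es \<in> schreier \<kappa> \<delta> \<longleftrightarrow> Min ` set Es \<in> schreier \<kappa> (osucc (\<kappa> \<delta> (Min (\<Union>(set Es)))))"
      "\<Union>(set Es) \<in> fin_sets"
      if Es: "Es \<noteq> []" "\<forall>E\<in>set Es. E \<noteq> {} \<and> E \<in> schreier \<kappa> \<xi>" for Es
    proof -
      have fin: "E \<in> fin_sets \<and> E \<noteq> {}" if "E \<in> set Es" for E using Es that schreier_fin_sets[OF assms] by blast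
      then have "\<forall>E\<in>set Es. Min E \<noteq> 0" using fin_sets_Min(3) by fastforce
      then have "Min ` set Es \<in> fin_sets" "Min ` set Es \<noteq> {}"
        using Es by (auto simp: fin_sets_def)
      then show "Min ` set Es \<in> schreier \<kappa> \<delta> \<longleftrightarrow> Min ` set Es \<in> schreier \<kappa> (osucc (\<kappa> \<delta> (Min (\<Union>(set Es)))))"
        using S.in_limit_iff[OF \<delta>, of "Min ` set Es"] Min_image_Min[of Es] Es fin fin_sets_Min(1) by metis
      show "\<Union>(set Es) \<in> fin_sets" using fin by (auto simp: fin_sets_def)
    qed
    show "schreier2 \<kappa> \<xi> \<delta> = {{}} \<union> {E \<in> fin_sets. E \<noteq> {} \<and> E \<in> schreier2 \<kappa> \<xi> (osucc (\<kappa> \<delta> (Min E)))}"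
    proof (intro equalityI subsetI)
      fix E assume "E \<in> schreier2 \<kappa> \<xi> \<delta>"
      then show "E \<in> {{}} \<union> {E \<in> fin_sets. E \<noteq> {} \<and> E \<in> schreier2 \<kappa> \<xi> (osucc (\<kappa> \<delta> (Min E)))}"
        unfolding schreier2_def fam_comp_def using * by (auto 0 4)
    next
      fix E assume "E \<in> {{}} \<union> {E \<in> fin_sets. E \<noteq> {} \<and> E \<in> schreier2 \<kappa> \<xi> (osucc (\<kappa> \<delta> (Min E)))}"
      then show "E \<in> schreier2 \<kappa> \<xi> \<delta>"
        unfolding schreier2_def fam_comp_def using *(1) by (auto 0 4)
    qed
  qed
qed

text \<open>The limit clauses of the weights are functions of all sets E, including those with
  \<open>Min E = 0\<close>, where the characteristic index is unconstrained; the congruence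
  condition of \<open>ord_rec_limit\<close> may fail for them. The cut form postpones the check to
  each single E.\<close>

lemma ord_rec_limit_cut:
  assumes "limit_ord \<alpha>"
  shows "ord_rec z s l \<alpha> = l \<alpha> (cut (ord_rec z s l) {(\<alpha>, \<beta>). \<alpha> < \<beta>} \<alpha>)"
  using assms unfolding ord_rec_def by (subst wfrec[OF wf]) (simp add: limit_ord_def)

section \<open>Recursion and normalisation of the weights\<close>

lemma pw0_zero: "pw0 \<kappa> 0 E = 1"
  by (simp add: pw0_def ord_rec_zero)

lemma pw0_osucc: "pw0 \<kappa> (osucc \<xi>) E = pw0 \<kappa> \<xi> (lastb (schreier \<kappa> \<xi>) E) / real (Min E)"
  by (simp add: pw0_def ord_rec_osucc)

lemma pw0_limit:
  "limit_ord \<xi> \<Longrightarrow> osucc (\<kappa> \<xi> (Min E)) < \<xi> \<Longrightarrow> pw0 \<kappa> \<xi> E = pw0 \<kappa> (osucc (\<kappa> \<xi> (Min E))) E"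
  unfolding pw0_def by (subst ord_rec_limit_cut) (simp_all add: cut_def)

lemma qw0_zero: "qw0 \<kappa> \<xi> 0 E = 1"
  by (simp add: qw0_def ord_rec_zero)

lemma qw0_osucc:
  "qw0 \<kappa> \<xi> (osucc \<zeta>) E = qw0 \<kappa> \<xi> \<zeta> (lastb (schreier2 \<kappa> \<xi> \<zeta>) E) / sqrt (real (Min E))"
  by (simp add: qw0_def ord_rec_osucc)

lemma qw0_limit:
  "limit_ord \<zeta> \<Longrightarrow> osucc (\<kappa> \<zeta> (Min E)) < \<zeta> \<Longrightarrow> qw0 \<kappa> \<xi> \<zeta> E = qw0 \<kappa> \<xi> (osucc (\<kappa> \<zeta> (Min E))) E"
  unfolding qw0_def by (subst ord_rec_limit_cut) (simp_all add: cut_def)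

lemma sum_pw0:
  assumes "characteristic_sequences \<kappa>" "G \<in> maximal_sets (schreier \<kappa> \<xi>)"
  shows "sum (pw0 \<kappa> \<xi>) (init_segs G) = 1"
proof -
  interpret S: ladder "schreier \<kappa>" "\<lambda>\<delta> n. osucc (\<kappa> \<delta> n)" by (rule ladder_schreier[OF assms(1)])
  show ?thesis
  proof (rule S.sum_weights[OF _ _ _ assms(2)])
    fix G assume "G \<in> maximal_sets (schreier \<kappa> 0)"
    then have "G \<in> schreier \<kappa> 0" "G \<noteq> {}" using S.maximal_in S.maximal_nonempty by blast+
    then obtain n where "G = {n}" by (auto simp: schreier_zero)
    moreover have "init_segs {n} = {{n}}" by (auto simp: init_segs_def init_seg_def)
    ultimately show "sum (pw0 \<kappa> 0) (init_segs G) = 1" by (simp add: pw0_zero)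
  next
    fix \<delta> E assume "limit_ord \<delta>" "E \<in> schreier \<kappa> \<delta>" "E \<noteq> {}"
    then show "pw0 \<kappa> \<delta> E = pw0 \<kappa> (osucc (\<kappa> \<delta> (Min E))) E"
      using S.sub_fin S.Min_ge_1 S.nu_less by (intro pw0_limit) blast+
  qed (simp add: pw0_osucc)
qed

text \<open>Squaring turns the divisor \<open>sqrt (Min E)\<close> into \<open>Min E\<close>, so
  \<open>sum_weights\<close> applies. It is used twice: with w the p-weight, for the value on the
  first average, and with w the indicator of maximal sets, for the sum of squares over complete
  blocks.\<close>

lemma sum_qw0:
  assumes "characteristic_sequences \<kappa>" "G \<in> maximal_sets (schreier2 \<kappa> \<xi> \<zeta>)"
    and w: "\<And>H. H \<in> maximal_sets (schreier \<kappa> \<xi>) \<Longrightarrow> sum w (init_segs H) = 1"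
  shows "(\<Sum>E\<in>init_segs G. (qw0 \<kappa> \<xi> \<zeta> E)\<^sup>2 * w (lastb (schreier \<kappa> \<xi>) E)) = 1"
proof -
  interpret S: ladder "schreier2 \<kappa> \<xi>" "\<lambda>\<delta> n. osucc (\<kappa> \<delta> n)" by (rule ladder_schreier2[OF assms(1)])
  note z = schreier2_zero[OF assms(1), of \<xi>]
  show ?thesis
  proof (rule S.sum_weights[where W = "\<lambda>\<zeta> E. (qw0 \<kappa> \<xi> \<zeta> E)\<^sup>2 * w (lastb (schreier \<kappa> \<xi>) E)", OF _ _ _ assms(2)])
    fix H assume H: "H \<in> maximal_sets (schreier2 \<kappa> \<xi> 0)"
    have "(\<Sum>E\<in>init_segs H. (qw0 \<kappa> \<xi> 0 E)\<^sup>2 * w (lastb (schreier \<kappa> \<xi>) E)) = sum w (init_segs H)"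
    proof (rule sum.cong)
      fix E assume "E \<in> init_segs H"
      then have "E \<in> schreier2 \<kappa> \<xi> 0" "E \<noteq> {}"
        using S.hereditary[OF S.maximal_in[OF H]] by (auto simp: init_segs_def init_seg_def)
      then show "(qw0 \<kappa> \<xi> 0 E)\<^sup>2 * w (lastb (schreier \<kappa> \<xi>) E) = w E"
        using S.decomp_in[of E 0] by (simp add: qw0_zero z)
    qed simp
    then show "(\<Sum>E\<in>init_segs H. (qw0 \<kappa> \<xi> 0 E)\<^sup>2 * w (lastb (schreier \<kappa> \<xi>) E)) = 1"
      using w H z by simp
  next
    fix \<zeta> E assume "E \<in> schreier2 \<kappa> \<xi> (osucc \<zeta>)" "E \<noteq> {}"
    then have "E \<in> fin_sets" "E \<noteq> {}" using S.sub_fin by blast+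
    then show "(qw0 \<kappa> \<xi> (osucc \<zeta>) E)\<^sup>2 * w (lastb (schreier \<kappa> \<xi>) E) = (qw0 \<kappa> \<xi> \<zeta> (lastb (schreier2 \<kappa> \<xi> \<zeta>) E))\<^sup>2 *
       w (lastb (schreier \<kappa> \<xi>) (lastb (schreier2 \<kappa> \<xi> \<zeta>) E)) / real (Min E)"
      using S.lastb_aligned[of E \<zeta>] z by (simp add: qw0_osucc power_divide)
  next
    fix \<delta> E assume "limit_ord \<delta>" "E \<in> schreier2 \<kappa> \<xi> \<delta>" "E \<noteq> {}"
    then have "qw0 \<kappa> \<xi> \<delta> E = qw0 \<kappa> \<xi> (osucc (\<kappa> \<delta> (Min E))) E"
      using S.sub_fin S.Min_ge_1 S.nu_less by (intro qw0_limit) blast+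
    then show "(qw0 \<kappa> \<xi> \<delta> E)\<^sup>2 * w (lastb (schreier \<kappa> \<xi>) E) =
       (qw0 \<kappa> \<xi> (osucc (\<kappa> \<delta> (Min E))) E)\<^sup>2 * w (lastb (schreier \<kappa> \<xi>) E)" by simp
  qed
qed

text \<open>The q-weight is constant along an S_\<xi>-block: while that block is incomplete,
  alignment makes the block of every intermediate level incomplete too, and all of them keep the
  minima on which q depends.\<close>

lemma qw0_insert:
  assumes \<kappa>: "characteristic_sequences \<kappa>"
  shows "insert k E \<in> schreier2 \<kappa> \<xi> \<zeta> \<Longrightarrow> E \<noteq> {} \<Longrightarrow> \<forall>m\<in>E. m < k \<Longrightarrow>
    lastb (schreier \<kappa> \<xi>) E \<notin> maximal_sets (schreier \<kappa> \<xi>) \<Longrightarrow> qw0 \<kappa> \<xi> \<zeta> (insert k E) = qw0 \<kappa> \<xi> \<zeta> E"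
proof (induction \<zeta> arbitrary: E rule: omega1_induct)
  case zero
  then show ?case by (simp add: qw0_zero)
next
  case (succ \<beta>)
  interpret S: ladder "schreier2 \<kappa> \<xi>" "\<lambda>\<delta> n. osucc (\<kappa> \<delta> n)" by (rule ladder_schreier2[OF \<kappa>])
  note z = schreier2_zero[OF \<kappa>, of \<xi>]
  have E: "E \<in> fin_sets" "finite E" using succ.prems S.sub_fin[of "osucc \<beta>"] by (auto simp: fin_sets_def)
  let ?L = "lastb (schreier2 \<kappa> \<xi> \<beta>) E"
  have L: "?L \<in> schreier2 \<kappa> \<xi> \<beta>" "?L \<noteq> {}" "?L \<subseteq> E" using S.lastb_props[OF E(1) succ.prems(2)] by auto
  have al: "lastb (schreier \<kappa> \<xi>) ?L = lastb (schreier \<kappa> \<xi>) E"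
    using S.lastb_aligned[OF E(1) succ.prems(2)] z by simp
  then have nm: "?L \<notin> maximal_sets (schreier2 \<kappa> \<xi> \<beta>)" using S.lastb_maximal succ.prems(4) z by metis
  have ab: "\<forall>m\<in>?L. m < k" using L succ.prems(3) by blast
  have "insert k ?L \<in> schreier2 \<kappa> \<xi> \<beta>" using S.maximal_iff[OF L(1,2) ab] nm by blast
  then have "qw0 \<kappa> \<xi> \<beta> (insert k ?L) = qw0 \<kappa> \<xi> \<beta> ?L" using succ.IH L ab al succ.prems(4) by simp
  then show ?case
    using S.lastb_insert[OF E(1) succ.prems(2,3)] nm Min_insert_above[OF E(2) succ.prems(2,3)]
    by (simp add: qw0_osucc del: Min_insert)
next
  case (limit \<delta>)
  interpret S: ladder "schreier2 \<kappa> \<xi>" "\<lambda>\<delta> n. osucc (\<kappa> \<delta> n)" by (rule ladder_schreier2[OF \<kappa>])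
  have E: "E \<in> fin_sets" "finite E" "insert k E \<in> fin_sets"
    using limit.prems S.sub_fin[of \<delta>] by (auto simp: fin_sets_def)
  have M: "Min (insert k E) = Min E" using Min_insert_above[OF E(2) limit.prems(2,3)] .
  have lt: "osucc (\<kappa> \<delta> (Min E)) < \<delta>" using S.nu_less[OF limit(1) S.Min_ge_1[OF E(1) limit.prems(2)]] .
  have "insert k E \<in> schreier2 \<kappa> \<xi> (osucc (\<kappa> \<delta> (Min E)))"
    using S.in_limit_iff[OF limit(1) E(3)] limit.prems(1) M by (simp del: Min_insert)
  then show ?case
    using limit(2)[OF lt] limit.prems qw0_limit[OF limit(1), of \<kappa> E \<xi>] qw0_limit[OF limit(1), of \<kappa> "insert k E" \<xi>] lt M
    by (simp del: Min_insert)
qed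

section \<open>Function spaces and bilinear forms\<close>

text \<open>Compactness of [0, \<alpha>] in the form needed for the supremum norm. Continuity bounds
  f on some (\<eta>, \<beta>], and induction handles the rest below \<beta>.\<close>

lemma continuous_on_omega1_bounded:
  fixes f :: "omega1 \<Rightarrow> 'b::real_normed_vector"
  assumes "continuous_on {..\<alpha>} f"
  shows "bdd_above ((\<lambda>\<beta>. norm (f \<beta>)) ` {..\<alpha>})"
proof -
  have "\<beta> \<le> \<alpha> \<longrightarrow> (\<exists>C. \<forall>\<gamma>\<le>\<beta>. norm (f \<gamma>) \<le> C)" for \<beta>
  proof (induction \<beta> rule: less_induct)
    case (less \<beta>)
    show ?case
    proof
      assume \<beta>: "\<beta> \<le> \<alpha>"
      have "(f \<longlongrightarrow> f \<beta>) (at \<beta> within {..\<alpha>})"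
        using assms \<beta> by (simp add: continuous_on_def)
      then have "\<forall>\<^sub>F \<gamma> in at \<beta> within {..\<alpha>}. dist (f \<gamma>) (f \<beta>) < 1"
        by (rule tendstoD) simp
      then obtain S where S: "open S" "\<beta> \<in> S" "\<And>\<gamma>. \<gamma> \<in> S \<Longrightarrow> \<gamma> \<noteq> \<beta> \<Longrightarrow> \<gamma> \<le> \<alpha> \<Longrightarrow> dist (f \<gamma>) (f \<beta>) < 1"
        by (auto simp: eventually_at_topological)
      have near: "norm (f \<gamma>) \<le> norm (f \<beta>) + 1" if "\<gamma> \<in> S" "\<gamma> \<le> \<beta>" for \<gamma>
      proof (cases "\<gamma> = \<beta>")
        case False
        then have "norm (f \<gamma> - f \<beta>) < 1" using S(3)[of \<gamma>] that \<beta> by (simp add: dist_norm)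
        then show ?thesis using norm_triangle_ineq2[of "f \<gamma>" "f \<beta>"] by simp
      qed simp
      show "\<exists>C. \<forall>\<gamma>\<le>\<beta>. norm (f \<gamma>) \<le> C"
      proof (cases "\<exists>\<eta>. \<eta> < \<beta>")
        case True
        then obtain \<eta> where \<eta>: "\<eta> < \<beta>" "{\<eta><..\<beta>} \<subseteq> S" using open_left[OF S(1,2)] by blast
        then obtain C where C: "\<forall>\<gamma>\<le>\<eta>. norm (f \<gamma>) \<le> C" using less \<beta> by fastforce
        have "norm (f \<gamma>) \<le> max C (norm (f \<beta>) + 1)" if "\<gamma> \<le> \<beta>" for \<gamma>
        proof (cases "\<gamma> \<le> \<eta>")
          case False
          then have "\<gamma> \<in> S" using \<eta>(2) that by auto
          then show ?thesis using near[of \<gamma>] that by simp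
        qed (use C in \<open>simp add: le_max_iff_disj\<close>)
        then show ?thesis by blast
      next
        case False
        then have "\<gamma> = \<beta>" if "\<gamma> \<le> \<beta>" for \<gamma> using that by (meson order_le_less)
        then show ?thesis by blast
      qed
    qed
  qed
  then obtain C where "\<forall>\<gamma>\<le>\<alpha>. norm (f \<gamma>) \<le> C" by blast
  then show ?thesis by (intro bdd_aboveI[of _ C]) auto
qed

text \<open>Half-open intervals are clopen, because \<open>b\<close> has an immediate successor;
  their indicators are continuous.\<close>

lemma open_interval_omega1:
  fixes a b :: omega1
  shows "open {a<..b}" "open (- {a<..b})"
proof -
  have "{a<..b} = {a<..<osucc b}" by (auto simp: less_osucc_iff)
  moreover have "- {a<..b} = {..<osucc a} \<union> {b<..}" by (auto simp: less_osucc_iff)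
  ultimately show "open {a<..b}" "open (- {a<..b})" by auto
qed

lemma continuous_on_If_clopen:
  fixes c d :: "'b::topological_space"
  assumes "open U" "open (- U)"
  shows "continuous_on S (\<lambda>x. if x \<in> U then c else d)"
proof -
  have "(\<lambda>x. if x \<in> U then c else d) -` V =
      (if c \<in> V then if d \<in> V then UNIV else U else if d \<in> V then - U else {})" for V
    by (auto split: if_splits)
  then have "continuous_on UNIV (\<lambda>x. if x \<in> U then c else d)"
    using assms by (simp add: continuous_on_open_vimage)
  then show ?thesis by (rule continuous_on_subset) simp
qed

section \<open>The spaces C_0 over ordinal intervals\<close>

lemma C0_carrier:
  "f \<in> carrier (C0_space \<alpha>) \<longleftrightarrow> continuous_on {..\<alpha>} f \<and> (\<forall>\<beta>\<ge>\<alpha>. f \<beta> = 0)"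
  by (auto simp: C0_space_def C_space_def order_le_less)

lemma C0_ops:
  "f \<oplus>\<^bsub>C0_space \<alpha>\<^esub> g = (\<lambda>\<beta>. f \<beta> + g \<beta>)" "c \<odot>\<^bsub>C0_space \<alpha>\<^esub> f = (\<lambda>\<beta>. c * f \<beta>)"
  "nrm (C0_space \<alpha>) f = (SUP \<beta>\<in>{..\<alpha>}. norm (f \<beta>))"
  by (simp_all add: C0_space_def C_space_def)

lemma C0_norm_le:
  assumes "f \<in> carrier (C0_space \<alpha>)"
  shows "norm (f \<beta>) \<le> nrm (C0_space \<alpha>) f"
proof -
  have b: "norm (f \<gamma>) \<le> nrm (C0_space \<alpha>) f" if "\<gamma> \<le> \<alpha>" for \<gamma>
    unfolding C0_ops using assms that
    by (intro cSUP_upper continuous_on_omega1_bounded) (auto simp: C0_carrier)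
  show ?thesis
  proof (cases "\<beta> \<le> \<alpha>")
    case False
    then have "f \<beta> = 0" using assms by (simp add: C0_carrier)
    then show ?thesis using b[of \<alpha>] assms by (simp add: C0_carrier)
  qed (rule b)
qed

lemma C0_nrm_nonneg: "f \<in> carrier (C0_space \<alpha>) \<Longrightarrow> 0 \<le> nrm (C0_space \<alpha>) f"
  using C0_norm_le norm_ge_zero order_trans by blast

lemma C0_nrm_leI: "(\<And>\<beta>. norm (f \<beta>) \<le> C) \<Longrightarrow> nrm (C0_space \<alpha>) f \<le> C"
  unfolding C0_ops by (intro cSUP_least) auto

lemma C0_nrm_smult:
  fixes f :: "omega1 \<Rightarrow> 'k::real_normed_field"
  assumes "f \<in> carrier (C0_space \<alpha>)"
  shows "nrm (C0_space \<alpha>) (c \<odot>\<^bsub>C0_space \<alpha>\<^esub> f) = norm c * nrm (C0_space \<alpha>) f"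
proof -
  have le: "nrm (C0_space \<alpha>) (\<lambda>\<beta>. d * g \<beta>) \<le> norm d * nrm (C0_space \<alpha>) g"
    if "g \<in> carrier (C0_space \<alpha>)" for d :: 'k and g
    using C0_norm_le[OF that] by (intro C0_nrm_leI) (simp add: norm_mult mult_left_mono)
  show ?thesis
  proof (cases "c = 0")
    case True
    then show ?thesis by (simp add: C0_ops)
  next
    case False
    have "(\<lambda>\<beta>. c * f \<beta>) \<in> carrier (C0_space \<alpha>)"
      using assms by (auto simp: C0_carrier intro!: continuous_intros)
    from le[OF this, of "inverse c"] have "nrm (C0_space \<alpha>) f \<le> norm (inverse c) * nrm (C0_space \<alpha>) (\<lambda>\<beta>. c * f \<beta>)"
      using False by (simp add: mult.assoc[symmetric])
    then have "norm c * nrm (C0_space \<alpha>) f \<le> nrm (C0_space \<alpha>) (\<lambda>\<beta>. c * f \<beta>)"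
      using False by (simp add: norm_divide field_simps)
    then show ?thesis using le[OF assms, of c] by (simp add: C0_ops(2))
  qed
qed

lemma C0_smult_closed: "f \<in> carrier (C0_space \<alpha>) \<Longrightarrow> c \<odot>\<^bsub>C0_space \<alpha>\<^esub> f \<in> carrier (C0_space \<alpha>)"
  by (auto simp: C0_carrier C0_ops intro!: continuous_intros)

lemma C0_lincomb:
  assumes "\<And>k. k \<in> K \<Longrightarrow> f k \<in> carrier (C0_space \<alpha>)"
  shows "(\<lambda>\<beta>. \<Sum>k\<in>K. a k * f k \<beta>) \<in> carrier (C0_space \<alpha>)"
  using assms by (auto simp: C0_carrier intro!: continuous_intros)

lemma C0_lincomb_disjoint:
  fixes f :: "'i \<Rightarrow> omega1 \<Rightarrow> 'k::real_normed_field"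
  assumes "\<And>k \<beta>. k \<in> K \<Longrightarrow> norm (f k \<beta>) \<le> 1" "\<And>k. k \<in> K \<Longrightarrow> norm (a k) = 1"
    and "\<And>k l \<beta>. k \<in> K \<Longrightarrow> l \<in> K \<Longrightarrow> k \<noteq> l \<Longrightarrow> f k \<beta> = 0 \<or> f l \<beta> = 0"
  shows "nrm (C0_space \<alpha>) (\<lambda>\<beta>. \<Sum>k\<in>K. a k * f k \<beta>) \<le> 1"
proof (rule C0_nrm_leI)
  fix \<beta>
  show "norm (\<Sum>k\<in>K. a k * f k \<beta>) \<le> 1"
  proof (cases "finite K \<and> (\<exists>k\<in>K. f k \<beta> \<noteq> 0)")
    case True
    then obtain k where k: "k \<in> K" "f k \<beta> \<noteq> 0" "finite K" by blast
    have "(\<Sum>l\<in>K. a l * f l \<beta>) = (\<Sum>l\<in>K. if l = k then a k * f k \<beta> else 0)"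
      using assms(3)[of k _ \<beta>] k by (intro sum.cong) auto
    then show ?thesis using k assms by (simp add: norm_mult)
  next
    case False
    then have "(\<Sum>k\<in>K. a k * f k \<beta>) = 0" by (cases "finite K") auto
    then show ?thesis by simp
  qed
qed

text \<open>The norm of the field is multiplicative, so z/|z| times |w|/w has norm one and turns w
  into a nonnegative multiple of z. This treats real and complex scalars alike.\<close>

lemma align_norm:
  fixes z w :: "'k::real_normed_field"
  shows "\<exists>c. norm c = 1 \<and> norm (z + c * w) = norm z + norm w"
proof (cases "z = 0 \<or> w = 0")
  case True
  then show ?thesis by (intro exI[of _ 1]) auto
next
  case False
  define c where "c = (z / of_real (norm z)) * (of_real (norm w) / w)"
  have "norm c = 1" using False by (simp add: c_def norm_mult norm_divide)
  moreover have "z + c * w = z * of_real (1 + norm w / norm z)"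
    using False by (simp add: c_def field_simps)
  then have "norm (z + c * w) = norm z * (1 + norm w / norm z)"
    by (simp only: norm_mult norm_of_real) (simp add: add_nonneg_nonneg)
  then have "norm (z + c * w) = norm z + norm w" using False by (simp add: field_simps)
  ultimately show ?thesis by blast
qed

lemma bilinear_formsD:
  assumes "B \<in> bilinear_forms (C0_space \<alpha>) (C0_space \<beta>)"
    "x \<in> carrier (C0_space \<alpha>)" "x' \<in> carrier (C0_space \<alpha>)" "y \<in> carrier (C0_space \<beta>)" "y' \<in> carrier (C0_space \<beta>)"
  shows "B (\<lambda>\<gamma>. x \<gamma> + x' \<gamma>) y = B x y + B x' y" "B x (\<lambda>\<gamma>. y \<gamma> + y' \<gamma>) = B x y + B x y'"
    "B (\<lambda>\<gamma>. c * x \<gamma>) y = c * B x y" "B x (\<lambda>\<gamma>. c * y \<gamma>) = c * B x y"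
  using assms by (auto simp: bilinear_forms_def C0_ops)

text \<open>Averaging \<open>B(x + c f, y + g)\<close> and \<open>B(x - c f, y - g)\<close> removes the mixed terms.\<close>

lemma bilinear_signs:
  fixes B :: "(omega1 \<Rightarrow> 'k::real_normed_field) \<Rightarrow> (omega1 \<Rightarrow> 'k) \<Rightarrow> 'k"
  assumes B: "B \<in> bilinear_forms (C0_space \<alpha>) (C0_space \<beta>)" and "finite K"
    and f: "\<And>k. k \<in> K \<Longrightarrow> f k \<in> carrier (C0_space \<alpha>)" and g: "\<And>k. k \<in> K \<Longrightarrow> g k \<in> carrier (C0_space \<beta>)"
  shows "\<exists>a b. (\<forall>k\<in>K. norm (a k) = 1 \<and> norm (b k) = 1) \<and>
    (\<Sum>k\<in>K. norm (B (f k) (g k))) \<le> norm (B (\<lambda>\<gamma>. \<Sum>k\<in>K. a k * f k \<gamma>) (\<lambda>\<gamma>. \<Sum>k\<in>K. b k * g k \<gamma>))"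
  using assms(2) f g
proof (induction K rule: finite_induct)
  case (insert k K)
  have "\<exists>a b. (\<forall>k\<in>K. norm (a k) = 1 \<and> norm (b k) = 1) \<and>
    (\<Sum>k\<in>K. norm (B (f k) (g k))) \<le> norm (B (\<lambda>\<gamma>. \<Sum>k\<in>K. a k * f k \<gamma>) (\<lambda>\<gamma>. \<Sum>k\<in>K. b k * g k \<gamma>))"
    by (rule insert.IH) (use insert.prems in auto)
  then obtain a b where ab: "\<forall>k\<in>K. norm (a k) = 1 \<and> norm (b k) = 1"
    "(\<Sum>k\<in>K. norm (B (f k) (g k))) \<le> norm (B (\<lambda>\<gamma>. \<Sum>k\<in>K. a k * f k \<gamma>) (\<lambda>\<gamma>. \<Sum>k\<in>K. b k * g k \<gamma>))"
    by blast
  define x where "x = (\<lambda>\<gamma>. \<Sum>k\<in>K. a k * f k \<gamma>)"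
  define y where "y = (\<lambda>\<gamma>. \<Sum>k\<in>K. b k * g k \<gamma>)"
  have x: "x \<in> carrier (C0_space \<alpha>)" and y: "y \<in> carrier (C0_space \<beta>)"
    unfolding x_def y_def using insert by (auto intro: C0_lincomb)
  have fk: "f k \<in> carrier (C0_space \<alpha>)" and gk: "g k \<in> carrier (C0_space \<beta>)" using insert by auto
  obtain c where c: "norm c = 1" "norm (B x y + c * B (f k) (g k)) = norm (B x y) + norm (B (f k) (g k))"
    using align_norm by blast
  define P where "P s = B (\<lambda>\<gamma>. x \<gamma> + (s * c) * f k \<gamma>) (\<lambda>\<gamma>. y \<gamma> + s * g k \<gamma>)" for s
  have smul: "(\<lambda>\<gamma>. d * f k \<gamma>) \<in> carrier (C0_space \<alpha>)" "(\<lambda>\<gamma>. d * g k \<gamma>) \<in> carrier (C0_space \<beta>)" for d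
    using C0_smult_closed[OF fk] C0_smult_closed[OF gk] by (simp_all add: C0_ops)
  have add: "(\<lambda>\<gamma>. y \<gamma> + s * g k \<gamma>) \<in> carrier (C0_space \<beta>)" for s
    using y gk by (auto simp: C0_carrier intro!: continuous_intros)
  have Ps: "P s = B x y + s * B x (g k) + (s * c) * B (f k) y + (s * c) * (s * B (f k) (g k))" for s
  proof -
    have "P s = B x (\<lambda>\<gamma>. y \<gamma> + s * g k \<gamma>) + (s * c) * B (f k) (\<lambda>\<gamma>. y \<gamma> + s * g k \<gamma>)"
      unfolding P_def bilinear_formsD(1)[OF B x smul(1) add add] bilinear_formsD(3)[OF B fk fk add add] ..
    also have "\<dots> = B x y + s * B x (g k) + (s * c) * (B (f k) y + s * B (f k) (g k))"
      unfolding bilinear_formsD(2)[OF B x x y smul(2)] bilinear_formsD(2)[OF B fk fk y smul(2)]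
        bilinear_formsD(4)[OF B x x gk gk] bilinear_formsD(4)[OF B fk fk gk gk] ..
    finally show ?thesis by (simp only: distrib_left add.assoc)
  qed
  have "P 1 + P (- 1) = 2 * (B x y + c * B (f k) (g k))"
    unfolding Ps by (simp add: algebra_simps)
  then have "norm (P 1 + P (- 1)) = 2 * (norm (B x y) + norm (B (f k) (g k)))"
    by (simp only: norm_mult c(2)) simp
  then have "norm (P 1) + norm (P (- 1)) \<ge> 2 * (norm (B x y) + norm (B (f k) (g k)))"
    using norm_triangle_ineq[of "P 1" "P (- 1)"] by linarith
  \<comment> \<open>The larger of two numbers is at least their mean, so one of the two signs can be
    kept.\<close>
  then have "norm (P 1) \<ge> norm (B x y) + norm (B (f k) (g k)) \<or> norm (P (- 1)) \<ge> norm (B x y) + norm (B (f k) (g k))"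
    by argo
  then obtain s where s: "s = 1 \<or> s = - 1" "norm (P s) \<ge> norm (B x y) + norm (B (f k) (g k))"
    by blast
  define a' where "a' = a(k := s * c)"
  define b' where "b' = b(k := s)"
  have "(\<lambda>\<gamma>. \<Sum>l\<in>insert k K. a' l * f l \<gamma>) = (\<lambda>\<gamma>. x \<gamma> + (s * c) * f k \<gamma>)"
    "(\<lambda>\<gamma>. \<Sum>l\<in>insert k K. b' l * g l \<gamma>) = (\<lambda>\<gamma>. y \<gamma> + s * g k \<gamma>)"
    unfolding x_def y_def a'_def b'_def using insert(1,2)
    by (auto simp: fun_eq_iff add.commute intro!: sum.cong)
  then have "(\<Sum>k\<in>insert k K. norm (B (f k) (g k))) \<le>
      norm (B (\<lambda>\<gamma>. \<Sum>k\<in>insert k K. a' k * f k \<gamma>) (\<lambda>\<gamma>. \<Sum>k\<in>insert k K. b' k * g k \<gamma>))"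
    using s(2) ab(2) insert(1,2) unfolding P_def x_def[symmetric] y_def[symmetric] by simp
  moreover have "\<forall>l\<in>insert k K. norm (a' l) = 1 \<and> norm (b' l) = 1"
    using ab(1) c(1) s(1) by (auto simp: a'_def b'_def norm_mult)
  ultimately show ?case by blast
qed simp

text \<open>The variant for a constant second factor: no mixed terms arise, and aligning the
  summands one after another is enough.\<close>

lemma bilinear_signs_left:
  fixes B :: "(omega1 \<Rightarrow> 'k::real_normed_field) \<Rightarrow> (omega1 \<Rightarrow> 'k) \<Rightarrow> 'k"
  assumes B: "B \<in> bilinear_forms (C0_space \<alpha>) (C0_space \<beta>)" and "finite K"
    and f: "\<And>k. k \<in> K \<Longrightarrow> f k \<in> carrier (C0_space \<alpha>)" and g: "g \<in> carrier (C0_space \<beta>)"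
  shows "\<exists>a. (\<forall>k\<in>K. norm (a k) = 1) \<and>
    (\<Sum>k\<in>K. norm (B (f k) g)) \<le> norm (B (\<lambda>\<gamma>. \<Sum>k\<in>K. a k * f k \<gamma>) g)"
  using assms(2) f
proof (induction K rule: finite_induct)
  case (insert k K)
  have "\<exists>a. (\<forall>k\<in>K. norm (a k) = 1) \<and>
    (\<Sum>k\<in>K. norm (B (f k) g)) \<le> norm (B (\<lambda>\<gamma>. \<Sum>k\<in>K. a k * f k \<gamma>) g)"
    by (rule insert.IH) (use insert.prems in auto)
  then obtain a where a: "\<forall>k\<in>K. norm (a k) = 1"
    "(\<Sum>k\<in>K. norm (B (f k) g)) \<le> norm (B (\<lambda>\<gamma>. \<Sum>k\<in>K. a k * f k \<gamma>) g)"
    by blast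
  define x where "x = (\<lambda>\<gamma>. \<Sum>k\<in>K. a k * f k \<gamma>)"
  have x: "x \<in> carrier (C0_space \<alpha>)" unfolding x_def using insert by (auto intro: C0_lincomb)
  have fk: "f k \<in> carrier (C0_space \<alpha>)" using insert by auto
  obtain c where c: "norm c = 1" "norm (B x g + c * B (f k) g) = norm (B x g) + norm (B (f k) g)"
    using align_norm by blast
  have smul: "(\<lambda>\<gamma>. c * f k \<gamma>) \<in> carrier (C0_space \<alpha>)"
    using C0_smult_closed[OF fk] by (simp add: C0_ops)
  have "B (\<lambda>\<gamma>. x \<gamma> + c * f k \<gamma>) g = B x g + c * B (f k) g"
    using bilinear_formsD(1)[OF B x smul g g] bilinear_formsD(3)[OF B fk fk g g] by simp
  moreover have "(\<lambda>\<gamma>. \<Sum>l\<in>insert k K. (a(k := c)) l * f l \<gamma>) = (\<lambda>\<gamma>. x \<gamma> + c * f k \<gamma>)"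
    unfolding x_def using insert(1,2) by (auto simp: fun_eq_iff add.commute intro!: sum.cong)
  ultimately show ?case
    using a c insert(1,2) unfolding x_def[symmetric]
    by (intro exI[of _ "a(k := c)"]) auto
qed simp

text \<open>Weak nullity is obtained through this stronger property, a uniform bound on sums of
  absolute values. The threshold N allows finitely many initial terms to be arbitrary.\<close>

lemma bounded_sums_tendsto_zero:
  fixes h :: "nat \<Rightarrow> 'b::real_normed_vector"
  assumes "\<And>n. (\<Sum>k\<in>{k. N < k \<and> k < n}. norm (h k)) \<le> C"
  shows "h \<longlonglongrightarrow> 0"
proof -
  define h' where "h' k = (if N < k then norm (h k) else 0)" for k
  have "sum h' {..<n} = (\<Sum>k\<in>{k. N < k \<and> k < n}. norm (h k))" for n
    by (rule sum.mono_neutral_cong_right) (auto simp: h'_def)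
  then have "summable h'" using assms by (intro summableI_nonneg_bounded[where x = C]) (auto simp: h'_def)
  then have "h' \<longlonglongrightarrow> 0" by (rule summable_LIMSEQ_zero)
  then have "(\<lambda>k. norm (h k)) \<longlonglongrightarrow> 0"
    by (rule Lim_transform_eventually) (auto simp: h'_def eventually_sequentially intro!: exI[of _ "Suc N"])
  then show ?thesis by (rule tendsto_norm_zero_cancel)
qed

section \<open>Completions and projective tensor products\<close>

lemma tendsto_zero_le:
  fixes f :: "nat \<Rightarrow> 'b::real_normed_vector"
  assumes "\<And>n. norm (f n) \<le> g n" "g \<longlonglongrightarrow> 0"
  shows "f \<longlonglongrightarrow> 0"
  using assms(1) by (intro Lim_null_comparison[OF _ assms(2)] always_eventually) simp

text \<open>A seminorm is the right notion here: the completion divides by null differences, which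
  identifies vectors at distance zero.\<close>

locale seminormed = abelian_group N for N :: "('k::{real_normed_field,banach}, 'a) nspace" (structure) +
  assumes smult_closed: "x \<in> carrier N \<Longrightarrow> c \<odot> x \<in> carrier N"
    and smult_add: "x \<in> carrier N \<Longrightarrow> y \<in> carrier N \<Longrightarrow> c \<odot> (x \<oplus> y) = c \<odot> x \<oplus> c \<odot> y"
    and nrm_zero: "nrm N \<zero> = 0"
    and nrm_triangle: "x \<in> carrier N \<Longrightarrow> y \<in> carrier N \<Longrightarrow> nrm N (x \<oplus> y) \<le> nrm N x + nrm N y"
    and nrm_minus: "x \<in> carrier N \<Longrightarrow> nrm N (\<ominus> x) = nrm N x"
    and nrm_smult: "x \<in> carrier N \<Longrightarrow> nrm N (c \<odot> x) \<le> norm c * nrm N x"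
begin

lemma diff_self: "x \<in> carrier N \<Longrightarrow> nrm N (x \<ominus> x) = 0"
  by (simp add: a_minus_def r_neg nrm_zero)

lemma diff_sym: "x \<in> carrier N \<Longrightarrow> y \<in> carrier N \<Longrightarrow> nrm N (x \<ominus> y) = nrm N (y \<ominus> x)"
  using nrm_minus[of "x \<ominus> y"] by (simp add: a_minus_def minus_add a_comm)

lemma diff_triangle:
  assumes "x \<in> carrier N" "y \<in> carrier N" "z \<in> carrier N"
  shows "nrm N (x \<ominus> z) \<le> nrm N (x \<ominus> y) + nrm N (y \<ominus> z)"
proof -
  have "(x \<ominus> y) \<oplus> (y \<ominus> z) = x \<ominus> z"
    using assms by (simp add: a_minus_def a_assoc r_neg1)
  then show ?thesis using nrm_triangle[of "x \<ominus> y" "y \<ominus> z"] assms by simp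
qed

lemma nrm_nonneg: "x \<in> carrier N \<Longrightarrow> 0 \<le> nrm N x"
  using nrm_triangle[of x "\<ominus> x"] by (simp add: r_neg nrm_zero nrm_minus)

lemma nrm_diff_abs:
  assumes "x \<in> carrier N" "y \<in> carrier N"
  shows "\<bar>nrm N x - nrm N y\<bar> \<le> nrm N (x \<ominus> y)"
proof -
  have *: "nrm N x \<le> nrm N (x \<ominus> y) + nrm N y" if "x \<in> carrier N" "y \<in> carrier N" for x y
  proof -
    have "(x \<ominus> y) \<oplus> y = x" using that by (simp add: a_minus_def a_assoc l_neg)
    then show ?thesis using nrm_triangle[of "x \<ominus> y" y] that by simp
  qed
  show ?thesis using *[OF assms] *[OF assms(2,1)] diff_sym[OF assms] by linarith
qed

lemma diff_add:
  assumes "x \<in> carrier N" "y \<in> carrier N" "x' \<in> carrier N" "y' \<in> carrier N"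
  shows "nrm N ((x \<oplus> y) \<ominus> (x' \<oplus> y')) \<le> nrm N (x \<ominus> x') + nrm N (y \<ominus> y')"
proof -
  have "(x \<oplus> y) \<ominus> (x' \<oplus> y') = (x \<ominus> x') \<oplus> (y \<ominus> y')"
    using assms by (simp add: a_minus_def minus_add a_ac)
  then show ?thesis using nrm_triangle[of "x \<ominus> x'" "y \<ominus> y'"] assms by simp
qed

lemma diff_smult:
  assumes "x \<in> carrier N" "y \<in> carrier N"
  shows "nrm N (c \<odot> x \<ominus> c \<odot> y) \<le> norm c * nrm N (x \<ominus> y)"
proof -
  have "c \<odot> y \<oplus> c \<odot> (x \<ominus> y) = c \<odot> (y \<oplus> (x \<ominus> y))" using assms by (simp add: smult_add)
  also have "y \<oplus> (x \<ominus> y) = x" using assms by (simp add: a_minus_def a_lcomm[of y x] r_neg)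
  finally have eq: "c \<odot> y \<oplus> c \<odot> (x \<ominus> y) = c \<odot> x" .
  have "(a \<oplus> b) \<ominus> a = b" if "a \<in> carrier N" "b \<in> carrier N" for a b
    unfolding a_minus_def a_comm[OF that] a_assoc[OF that(2,1) a_inv_closed[OF that(1)]] r_neg[OF that(1)]
    using that(2) by (rule r_zero)
  from this[of "c \<odot> y" "c \<odot> (x \<ominus> y)"] have "c \<odot> x \<ominus> c \<odot> y = c \<odot> (x \<ominus> y)"
    using assms smult_closed unfolding eq by blast
  then show ?thesis using nrm_smult assms by simp
qed

section \<open>Cauchy sequences and the completion\<close>

lemma cauchy_carrier: "s \<in> cauchy_seqs N \<Longrightarrow> s n \<in> carrier N"
  by (simp add: cauchy_seqs_def)

lemma cauchyE:
  assumes "s \<in> cauchy_seqs N" "e > 0"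
  obtains K where "\<And>m n. m \<ge> K \<Longrightarrow> n \<ge> K \<Longrightarrow> nrm N (s m \<ominus> s n) < e"
proof -
  have "\<exists>K. \<forall>m\<ge>K. \<forall>n\<ge>K. nrm N (s m \<ominus> s n) < e" using assms by (simp add: cauchy_seqs_def)
  then show ?thesis using that by metis
qed

lemma null_diff_iff:
  "(s, t) \<in> null_diff_rel N \<longleftrightarrow> s \<in> cauchy_seqs N \<and> t \<in> cauchy_seqs N \<and> (\<lambda>n. nrm N (s n \<ominus> t n)) \<longlonglongrightarrow> 0"
  by (simp add: null_diff_rel_def)

lemma equiv_null_diff: "equiv (cauchy_seqs N) (null_diff_rel N)"
proof (rule equivI)
  show "null_diff_rel N \<subseteq> cauchy_seqs N \<times> cauchy_seqs N" by (auto simp: null_diff_rel_def)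
  show "refl_on (cauchy_seqs N) (null_diff_rel N)"
    by (auto simp: refl_on_def null_diff_iff diff_self cauchy_carrier)
  show "sym (null_diff_rel N)"
    by (intro symI) (auto simp: null_diff_iff diff_sym[OF cauchy_carrier cauchy_carrier])
  show "trans (null_diff_rel N)"
  proof (rule transI)
    fix s t u assume st: "(s, t) \<in> null_diff_rel N" and tu: "(t, u) \<in> null_diff_rel N"
    then have c: "s \<in> cauchy_seqs N" "t \<in> cauchy_seqs N" "u \<in> cauchy_seqs N" by (auto simp: null_diff_iff)
    have "(\<lambda>n. nrm N (s n \<ominus> t n) + nrm N (t n \<ominus> u n)) \<longlonglongrightarrow> 0 + 0"
      using st tu by (intro tendsto_add) (auto simp: null_diff_iff)
    then have "(\<lambda>n. nrm N (s n \<ominus> u n)) \<longlonglongrightarrow> 0"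
      using diff_triangle[OF cauchy_carrier[OF c(1)] cauchy_carrier[OF c(2)] cauchy_carrier[OF c(3)]]
        nrm_nonneg cauchy_carrier c
      by - (rule tendsto_zero_le[of _ "\<lambda>n. nrm N (s n \<ominus> t n) + nrm N (t n \<ominus> u n)"], simp_all)
    then show "(s, u) \<in> null_diff_rel N" using c by (simp add: null_diff_iff)
  qed
qed

definition cls :: "(nat \<Rightarrow> 'a) \<Rightarrow> (nat \<Rightarrow> 'a) set" where
  "cls s = null_diff_rel N `` {s}"

definition emb :: "'a \<Rightarrow> (nat \<Rightarrow> 'a) set" where
  "emb x = cls (\<lambda>n. x)"

lemma cls_eq_iff: "s \<in> cauchy_seqs N \<Longrightarrow> t \<in> cauchy_seqs N \<Longrightarrow> cls s = cls t \<longleftrightarrow> (s, t) \<in> null_diff_rel N"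
  unfolding cls_def using eq_equiv_class_iff[OF equiv_null_diff] .

lemma cls_self: "s \<in> cauchy_seqs N \<Longrightarrow> s \<in> cls s"
  unfolding cls_def using equiv_class_self[OF equiv_null_diff] .

lemma in_cls: "t \<in> cls s \<longleftrightarrow> (s, t) \<in> null_diff_rel N"
  by (simp add: cls_def)

lemma completion_carrier: "S \<in> carrier (completion N) \<longleftrightarrow> (\<exists>s\<in>cauchy_seqs N. S = cls s)"
  by (auto simp: completion_def quotient_def cls_def)

lemma const_cauchy: "x \<in> carrier N \<Longrightarrow> (\<lambda>n. x) \<in> cauchy_seqs N"
  by (auto simp: cauchy_seqs_def diff_self)

lemma add_cauchy:
  assumes s: "s \<in> cauchy_seqs N" and t: "t \<in> cauchy_seqs N"
  shows "(\<lambda>n. s n \<oplus> t n) \<in> cauchy_seqs N"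
  unfolding cauchy_seqs_def
proof (intro CollectI conjI allI impI)
  show "s n \<oplus> t n \<in> carrier N" for n using s t cauchy_carrier by simp
  fix e :: real assume "e > 0"
  then have e: "e / 2 > 0" by simp
  obtain K where K: "\<And>m n. m \<ge> K \<Longrightarrow> n \<ge> K \<Longrightarrow> nrm N (s m \<ominus> s n) < e / 2"
    using cauchyE[OF s e] by blast
  obtain L where L: "\<And>m n. m \<ge> L \<Longrightarrow> n \<ge> L \<Longrightarrow> nrm N (t m \<ominus> t n) < e / 2"
    using cauchyE[OF t e] by blast
  have "nrm N ((s m \<oplus> t m) \<ominus> (s n \<oplus> t n)) < e" if "m \<ge> max K L" "n \<ge> max K L" for m n
    using diff_add[OF cauchy_carrier[OF s] cauchy_carrier[OF t] cauchy_carrier[OF s] cauchy_carrier[OF t], of m m n n]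
      K[of m n] L[of m n] that by simp
  then show "\<exists>K. \<forall>m\<ge>K. \<forall>n\<ge>K. nrm N ((s m \<oplus> t m) \<ominus> (s n \<oplus> t n)) < e" by blast
qed

lemma smult_cauchy:
  assumes s: "s \<in> cauchy_seqs N"
  shows "(\<lambda>n. c \<odot> s n) \<in> cauchy_seqs N"
  unfolding cauchy_seqs_def
proof (intro CollectI conjI allI impI)
  show "c \<odot> s n \<in> carrier N" for n using s cauchy_carrier smult_closed by simp
  fix e :: real assume "e > 0"
  then have e: "e / (norm c + 1) > 0" by (simp add: add_nonneg_pos)
  obtain K where K: "\<And>m n. m \<ge> K \<Longrightarrow> n \<ge> K \<Longrightarrow> nrm N (s m \<ominus> s n) < e / (norm c + 1)"
    using cauchyE[OF s e] by blast
  have "nrm N (c \<odot> s m \<ominus> c \<odot> s n) < e" if "m \<ge> K" "n \<ge> K" for m n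
  proof -
    have "nrm N (c \<odot> s m \<ominus> c \<odot> s n) \<le> norm c * nrm N (s m \<ominus> s n)"
      using diff_smult s cauchy_carrier by blast
    also have "\<dots> \<le> (norm c + 1) * nrm N (s m \<ominus> s n)"
      using nrm_nonneg s cauchy_carrier by (intro mult_right_mono) auto
    also have "\<dots> < (norm c + 1) * (e / (norm c + 1))"
      using K[OF that] by (intro mult_strict_left_mono) (auto simp: add_nonneg_pos)
    also have "\<dots> = e" using norm_ge_zero[of c] by (simp add: add_nonneg_eq_0_iff)
    finally show ?thesis .
  qed
  then show "\<exists>K. \<forall>m\<ge>K. \<forall>n\<ge>K. nrm N (c \<odot> s m \<ominus> c \<odot> s n) < e" by blast
qed

text \<open>The union over all representatives in the definition collapses to one class because
  equivalent summands give equivalent sums.\<close>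

lemma completion_add:
  assumes s: "s \<in> cauchy_seqs N" and t: "t \<in> cauchy_seqs N"
  shows "cls s \<oplus>\<^bsub>completion N\<^esub> cls t = cls (\<lambda>n. s n \<oplus> t n)"
proof -
  have "cls (\<lambda>n. s' n \<oplus> t' n) = cls (\<lambda>n. s n \<oplus> t n)" if "s' \<in> cls s" "t' \<in> cls t" for s' t'
  proof -
    have st: "(s, s') \<in> null_diff_rel N" "(t, t') \<in> null_diff_rel N" using that by (auto simp: in_cls)
    then have c: "s' \<in> cauchy_seqs N" "t' \<in> cauchy_seqs N" by (auto simp: null_diff_iff)
    have "(\<lambda>n. nrm N (s n \<ominus> s' n) + nrm N (t n \<ominus> t' n)) \<longlonglongrightarrow> 0 + 0"
      using st by (intro tendsto_add) (auto simp: null_diff_iff)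
    then have "(\<lambda>n. nrm N ((s n \<oplus> t n) \<ominus> (s' n \<oplus> t' n))) \<longlonglongrightarrow> 0"
      using diff_add[OF cauchy_carrier[OF s] cauchy_carrier[OF t] cauchy_carrier[OF c(1)] cauchy_carrier[OF c(2)]]
        nrm_nonneg cauchy_carrier s t c
      by - (rule tendsto_zero_le[of _ "\<lambda>n. nrm N (s n \<ominus> s' n) + nrm N (t n \<ominus> t' n)"], simp_all)
    then show ?thesis
      using cls_eq_iff[OF add_cauchy[OF s t] add_cauchy[OF c]] add_cauchy s t c by (simp add: null_diff_iff)
  qed
  moreover have "s \<in> cls s" "t \<in> cls t" using s t cls_self by auto
  ultimately have "(\<Union>s'\<in>cls s. \<Union>t'\<in>cls t. cls (\<lambda>n. s' n \<oplus> t' n)) = cls (\<lambda>n. s n \<oplus> t n)" by blast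
  then show ?thesis by (simp add: completion_def cls_def)
qed

lemma completion_smult:
  assumes s: "s \<in> cauchy_seqs N"
  shows "c \<odot>\<^bsub>completion N\<^esub> cls s = cls (\<lambda>n. c \<odot> s n)"
proof -
  have "cls (\<lambda>n. c \<odot> s' n) = cls (\<lambda>n. c \<odot> s n)" if "s' \<in> cls s" for s'
  proof -
    have st: "(s, s') \<in> null_diff_rel N" using that by (auto simp: in_cls)
    then have c: "s' \<in> cauchy_seqs N" by (auto simp: null_diff_iff)
    have "(\<lambda>n. norm c * nrm N (s n \<ominus> s' n)) \<longlonglongrightarrow> norm c * 0"
      using st by (intro tendsto_mult tendsto_const) (auto simp: null_diff_iff)
    then have "(\<lambda>n. nrm N (c \<odot> s n \<ominus> c \<odot> s' n)) \<longlonglongrightarrow> 0"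
      using diff_smult[OF cauchy_carrier[OF s] cauchy_carrier[OF c]] nrm_nonneg smult_closed cauchy_carrier s c
      by - (rule tendsto_zero_le[of _ "\<lambda>n. norm c * nrm N (s n \<ominus> s' n)"], simp_all)
    then show ?thesis
      using cls_eq_iff[OF smult_cauchy[OF s, of c] smult_cauchy[OF c, of c]]
        smult_cauchy[OF s, of c] smult_cauchy[OF c, of c] by (simp add: null_diff_iff)
  qed
  moreover have "s \<in> cls s" using s cls_self by auto
  ultimately have "(\<Union>s'\<in>cls s. cls (\<lambda>n. c \<odot> s' n)) = cls (\<lambda>n. c \<odot> s n)" by blast
  then show ?thesis by (simp add: completion_def cls_def)
qed

lemma completion_zero: "\<zero>\<^bsub>completion N\<^esub> = cls (\<lambda>n. \<zero>)"
  by (simp add: completion_def cls_def)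

lemma abelian_monoid_completion: "abelian_monoid (completion N)"
proof (rule abelian_monoidI)
  let ?U = "completion N"
  note c = completion_carrier
  show "\<zero>\<^bsub>?U\<^esub> \<in> carrier ?U" unfolding c completion_zero using const_cauchy by blast
  fix S T assume S: "S \<in> carrier ?U" and T: "T \<in> carrier ?U"
  then obtain s t where st: "s \<in> cauchy_seqs N" "S = cls s" "t \<in> cauchy_seqs N" "T = cls t" unfolding c by blast
  show "S \<oplus>\<^bsub>?U\<^esub> T \<in> carrier ?U" using st add_cauchy unfolding c by (auto simp: completion_add)
  have "(\<lambda>n. s n \<oplus> t n) = (\<lambda>n. t n \<oplus> s n)" using st cauchy_carrier a_comm by auto
  then show "S \<oplus>\<^bsub>?U\<^esub> T = T \<oplus>\<^bsub>?U\<^esub> S" using st by (simp add: completion_add)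
  have "(\<lambda>n. \<zero> \<oplus> s n) = s" using st cauchy_carrier by auto
  then show "\<zero>\<^bsub>?U\<^esub> \<oplus>\<^bsub>?U\<^esub> S = S" using st const_cauchy by (simp add: completion_add completion_zero)
  fix R assume "R \<in> carrier ?U"
  then obtain r where r: "r \<in> cauchy_seqs N" "R = cls r" unfolding c by blast
  have "(\<lambda>n. (s n \<oplus> t n) \<oplus> r n) = (\<lambda>n. s n \<oplus> (t n \<oplus> r n))" using st r cauchy_carrier a_assoc by auto
  then show "(S \<oplus>\<^bsub>?U\<^esub> T) \<oplus>\<^bsub>?U\<^esub> R = S \<oplus>\<^bsub>?U\<^esub> (T \<oplus>\<^bsub>?U\<^esub> R)"
    using st r add_cauchy by (simp add: completion_add)
qed

lemma completion_nrm:
  assumes s: "s \<in> cauchy_seqs N"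
  shows "(\<lambda>n. nrm N (s n)) \<longlonglongrightarrow> nrm (completion N) (cls s)"
proof -
  have "Cauchy (\<lambda>n. nrm N (s n))"
  proof (rule CauchyI)
    fix e :: real assume e: "e > 0"
    obtain K where K: "\<And>m n. m \<ge> K \<Longrightarrow> n \<ge> K \<Longrightarrow> nrm N (s m \<ominus> s n) < e"
      using cauchyE[OF s e] by blast
    then have "norm (nrm N (s m) - nrm N (s n)) < e" if "m \<ge> K" "n \<ge> K" for m n
      using nrm_diff_abs[OF cauchy_carrier[OF s] cauchy_carrier[OF s], of m n] K[OF that] by simp
    then show "\<exists>M. \<forall>m\<ge>M. \<forall>n\<ge>M. norm (nrm N (s m) - nrm N (s n)) < e" by blast
  qed
  then obtain r where r: "(\<lambda>n. nrm N (s n)) \<longlonglongrightarrow> r" using Cauchy_convergent convergent_def by blast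
  have "nrm (completion N) (cls s) = r"
    unfolding completion_def nspace.simps
  proof (rule the_equality)
    show "\<exists>s\<in>cls s. (\<lambda>n. nrm N (s n)) \<longlonglongrightarrow> r" using r cls_self[OF s] by blast
    fix r' assume "\<exists>s\<in>cls s. (\<lambda>n. nrm N (s n)) \<longlonglongrightarrow> r'"
    then obtain t where t: "(s, t) \<in> null_diff_rel N" "(\<lambda>n. nrm N (t n)) \<longlonglongrightarrow> r'" by (auto simp: in_cls)
    then have tc: "t \<in> cauchy_seqs N" "(\<lambda>n. nrm N (s n \<ominus> t n)) \<longlonglongrightarrow> 0" by (auto simp: null_diff_iff)
    have "(\<lambda>n. nrm N (s n) - nrm N (t n)) \<longlonglongrightarrow> 0"
      using nrm_diff_abs[OF cauchy_carrier[OF s] cauchy_carrier[OF tc(1)]]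
      by - (rule tendsto_zero_le[OF _ tc(2)], simp_all)
    moreover have "(\<lambda>n. nrm N (s n) - nrm N (t n)) \<longlonglongrightarrow> r - r'" by (intro tendsto_diff r t(2))
    ultimately show "r' = r" using LIMSEQ_unique by fastforce
  qed
  then show ?thesis using r by simp
qed

lemma emb_carrier: "x \<in> carrier N \<Longrightarrow> emb x \<in> carrier (completion N)"
  unfolding emb_def completion_carrier using const_cauchy by blast

lemma emb_add: "x \<in> carrier N \<Longrightarrow> y \<in> carrier N \<Longrightarrow> emb x \<oplus>\<^bsub>completion N\<^esub> emb y = emb (x \<oplus> y)"
  unfolding emb_def by (simp add: completion_add const_cauchy)

lemma emb_smult: "x \<in> carrier N \<Longrightarrow> c \<odot>\<^bsub>completion N\<^esub> emb x = emb (c \<odot> x)"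
  unfolding emb_def by (simp add: completion_smult const_cauchy)

lemma emb_nrm: "x \<in> carrier N \<Longrightarrow> nrm (completion N) (emb x) = nrm N x"
  unfolding emb_def using completion_nrm[OF const_cauchy] LIMSEQ_unique tendsto_const by blast

lemma completion_smult_closed:
  "S \<in> carrier (completion N) \<Longrightarrow> c \<odot>\<^bsub>completion N\<^esub> S \<in> carrier (completion N)"
  unfolding completion_carrier using completion_smult smult_cauchy by blast

lemma ex_extension:
  fixes \<psi> :: "'a \<Rightarrow> 'k"
  assumes add: "\<And>x y. x \<in> carrier N \<Longrightarrow> y \<in> carrier N \<Longrightarrow> \<psi> (x \<oplus> y) = \<psi> x + \<psi> y"
    and smult: "\<And>c x. x \<in> carrier N \<Longrightarrow> \<psi> (c \<odot> x) = c * \<psi> x"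
    and bound: "\<And>x. x \<in> carrier N \<Longrightarrow> norm (\<psi> x) \<le> nrm N x"
  shows "\<exists>\<Psi>\<in>dual_ball (completion N). \<forall>x\<in>carrier N. \<Psi> (emb x) = \<psi> x"
proof -
  have diff: "norm (\<psi> x - \<psi> y) \<le> nrm N (x \<ominus> y)" if "x \<in> carrier N" "y \<in> carrier N" for x y
  proof -
    have "(x \<ominus> y) \<oplus> y = x" using that by (simp add: a_minus_def a_assoc l_neg)
    then have "\<psi> x = \<psi> (x \<ominus> y) + \<psi> y" using add[of "x \<ominus> y" y] that by simp
    then show ?thesis using bound[of "x \<ominus> y"] that by simp
  qed
  \<comment> \<open>The representative is chosen arbitrarily; the fact \<open>lim\<close> shows that
    each representative has the same limit, so linearity can be checked on convenient ones.\<close>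
  define \<Psi> where "\<Psi> S = lim (\<lambda>n. \<psi> ((SOME s. s \<in> S) n))" for S
  have lim: "(\<lambda>n. \<psi> (s n)) \<longlonglongrightarrow> \<Psi> (cls s)" if s: "s \<in> cauchy_seqs N" for s
  proof -
    define t where "t = (SOME t. t \<in> cls s)"
    have "t \<in> cls s" unfolding t_def using someI[of "\<lambda>t. t \<in> cls s", OF cls_self[OF s]] .
    then have t: "t \<in> cauchy_seqs N" "(\<lambda>n. nrm N (s n \<ominus> t n)) \<longlonglongrightarrow> 0" by (auto simp: in_cls null_diff_iff)
    have "Cauchy (\<lambda>n. \<psi> (t n))"
    proof (rule CauchyI)
      fix e :: real assume e: "e > 0"
      obtain K where K: "\<And>m n. m \<ge> K \<Longrightarrow> n \<ge> K \<Longrightarrow> nrm N (t m \<ominus> t n) < e"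
        using cauchyE[OF t(1) e] by blast
      then have "norm (\<psi> (t m) - \<psi> (t n)) < e" if "m \<ge> K" "n \<ge> K" for m n
        using diff[OF cauchy_carrier[OF t(1)] cauchy_carrier[OF t(1)], of m n] K[OF that] by simp
      then show "\<exists>M. \<forall>m\<ge>M. \<forall>n\<ge>M. norm (\<psi> (t m) - \<psi> (t n)) < e" by blast
    qed
    then have "(\<lambda>n. \<psi> (t n)) \<longlonglongrightarrow> \<Psi> (cls s)"
      unfolding \<Psi>_def t_def[symmetric] using Cauchy_convergent convergent_LIMSEQ_iff by blast
    moreover have "(\<lambda>n. \<psi> (s n) - \<psi> (t n)) \<longlonglongrightarrow> 0"
      using diff[OF cauchy_carrier[OF s] cauchy_carrier[OF t(1)]]
      by - (rule tendsto_zero_le[OF _ t(2)], simp_all)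
    ultimately show ?thesis using tendsto_add by fastforce
  qed
  have \<Psi>_add: "\<Psi> (S \<oplus>\<^bsub>completion N\<^esub> T) = \<Psi> S + \<Psi> T"
    if ST: "S \<in> carrier (completion N)" "T \<in> carrier (completion N)" for S T
  proof -
    obtain s t where st: "s \<in> cauchy_seqs N" "S = cls s" "t \<in> cauchy_seqs N" "T = cls t"
      using ST unfolding completion_carrier by blast
    have "(\<lambda>n. \<psi> (s n) + \<psi> (t n)) \<longlonglongrightarrow> \<Psi> (cls (\<lambda>n. s n \<oplus> t n))"
      using lim[OF add_cauchy[OF st(1,3)]] add cauchy_carrier st by simp
    moreover have "(\<lambda>n. \<psi> (s n) + \<psi> (t n)) \<longlonglongrightarrow> \<Psi> S + \<Psi> T" using lim st by (auto intro: tendsto_add)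
    ultimately show ?thesis using LIMSEQ_unique st by (auto simp: completion_add)
  qed
  have \<Psi>_smult: "\<Psi> (c \<odot>\<^bsub>completion N\<^esub> S) = c * \<Psi> S" if ST: "S \<in> carrier (completion N)" for c S
  proof -
    obtain s where s: "s \<in> cauchy_seqs N" "S = cls s"
      using ST unfolding completion_carrier by blast
    have "(\<lambda>n. c * \<psi> (s n)) \<longlonglongrightarrow> \<Psi> (cls (\<lambda>n. c \<odot> s n))"
      using lim[OF smult_cauchy[OF s(1)]] smult cauchy_carrier s by simp
    moreover have "(\<lambda>n. c * \<psi> (s n)) \<longlonglongrightarrow> c * \<Psi> S" using lim s by (auto intro: tendsto_mult)
    ultimately show ?thesis using LIMSEQ_unique s by (auto simp: completion_smult)
  qed
  have \<Psi>_bound: "norm (\<Psi> S) \<le> nrm (completion N) S" if ST: "S \<in> carrier (completion N)" for S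
  proof -
    obtain s where s: "s \<in> cauchy_seqs N" "S = cls s"
      using ST unfolding completion_carrier by blast
    show ?thesis
      unfolding s(2) using bound cauchy_carrier s(1)
      by (intro LIMSEQ_le[OF tendsto_norm[OF lim[OF s(1)]] completion_nrm[OF s(1)]]) auto
  qed
  have "\<exists>C. \<forall>S\<in>carrier (completion N). norm (\<Psi> S) \<le> C * nrm (completion N) S"
    using \<Psi>_bound by (intro exI[of _ 1]) simp
  then have "\<Psi> \<in> dual_ball (completion N)"
    using \<Psi>_add \<Psi>_smult \<Psi>_bound by (simp add: dual_ball_def bounded_functionals_def)
  moreover have "\<Psi> (emb x) = \<psi> x" if "x \<in> carrier N" for x
    using lim[OF const_cauchy[OF that]] unfolding emb_def by (simp add: LIMSEQ_const_iff)
  ultimately show ?thesis by blast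
qed

lemma functional_finsum:
  assumes "\<Psi> \<in> bounded_functionals (completion N)" "finite K"
    and x: "\<And>k. k \<in> K \<Longrightarrow> x k \<in> carrier (completion N)"
  shows "\<Psi> (\<Oplus>\<^bsub>completion N\<^esub>k\<in>K. c k \<odot>\<^bsub>completion N\<^esub> x k) = (\<Sum>k\<in>K. c k * \<Psi> (x k))"
proof -
  interpret U: abelian_monoid "completion N" by (rule abelian_monoid_completion)
  have add: "\<Psi> (S \<oplus>\<^bsub>completion N\<^esub> T) = \<Psi> S + \<Psi> T"
    if "S \<in> carrier (completion N)" "T \<in> carrier (completion N)" for S T
    using assms(1) that by (simp add: bounded_functionals_def)
  have smult: "\<Psi> (d \<odot>\<^bsub>completion N\<^esub> S) = d * \<Psi> S" if "S \<in> carrier (completion N)" for d S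
    using assms(1) that by (simp add: bounded_functionals_def)
  have zero: "\<Psi> \<zero>\<^bsub>completion N\<^esub> = 0" using add[of "\<zero>\<^bsub>completion N\<^esub>" "\<zero>\<^bsub>completion N\<^esub>"] by simp
  show ?thesis
    using assms(2) x
  proof (induction K rule: finite_induct)
    case (insert k K)
    have "(\<lambda>k. c k \<odot>\<^bsub>completion N\<^esub> x k) \<in> K \<rightarrow> carrier (completion N)"
      using insert completion_smult_closed by auto
    then show ?case
      using insert completion_smult_closed by (simp add: U.finsum_insert add smult U.finsum_closed)
  qed (simp add: zero)
qed

end

text \<open>Scalars are absorbed in the first factor of an elementary tensor, which is why the laws
  for scalar multiplication concern \<open>X\<close>.\<close>

locale tensor_pair =
  fixes X :: "('k::{real_normed_field,banach}, 'a) nspace" and Y :: "('k, 'b) nspace"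
  assumes smult_closed_X: "x \<in> carrier X \<Longrightarrow> c \<odot>\<^bsub>X\<^esub> x \<in> carrier X"
    and nrm_smult_X: "x \<in> carrier X \<Longrightarrow> nrm X (c \<odot>\<^bsub>X\<^esub> x) = norm c * nrm X x"
    and nrm_nonneg_X: "x \<in> carrier X \<Longrightarrow> 0 \<le> nrm X x"
    and nrm_nonneg_Y: "y \<in> carrier Y \<Longrightarrow> 0 \<le> nrm Y y"
begin

abbreviation "N \<equiv> proj_tensor_alg X Y"

definition weight :: "('a \<times> 'b) list \<Rightarrow> real" where
  "weight ps = (\<Sum>(x, y)\<leftarrow>ps. nrm X x * nrm Y y)"

definition reps :: "(('a \<Rightarrow> 'b \<Rightarrow> 'k) \<Rightarrow> 'k) \<Rightarrow> ('a \<times> 'b) list set" where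
  "reps u = {ps. set ps \<subseteq> carrier X \<times> carrier Y \<and> tensor_sum X Y ps = u}"

lemma N_simps:
  "u \<oplus>\<^bsub>N\<^esub> v = (\<lambda>B. u B + v B)" "c \<odot>\<^bsub>N\<^esub> u = (\<lambda>B. c * u B)" "\<zero>\<^bsub>N\<^esub> = (\<lambda>B. 0)"
  "u \<in> carrier N \<longleftrightarrow> reps u \<noteq> {}" "nrm N u = Inf (weight ` reps u)"
  by (auto simp: proj_tensor_alg_def reps_def weight_def image_def intro: arg_cong[where f = Inf])

lemma weight_nonneg: "ps \<in> reps u \<Longrightarrow> 0 \<le> weight ps"
  unfolding weight_def reps_def
  by (intro sum_list_nonneg) (auto simp: nrm_nonneg_X nrm_nonneg_Y)

lemma bdd_weight: "bdd_below (weight ` reps u)"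
  using weight_nonneg by (intro bdd_belowI[of _ 0]) auto

lemma tensor_sum_append: "tensor_sum X Y (ps @ qs) = (\<lambda>B. tensor_sum X Y ps B + tensor_sum X Y qs B)"
  by (auto simp: tensor_sum_def fun_eq_iff)

lemma reps_add: "ps \<in> reps u \<Longrightarrow> qs \<in> reps v \<Longrightarrow> ps @ qs \<in> reps (\<lambda>B. u B + v B)"
  by (auto simp: reps_def tensor_sum_append)

lemma reps_smult:
  assumes "ps \<in> reps u"
  shows "map (\<lambda>(x, y). (c \<odot>\<^bsub>X\<^esub> x, y)) ps \<in> reps (\<lambda>B. c * u B)"
    "weight (map (\<lambda>(x, y). (c \<odot>\<^bsub>X\<^esub> x, y)) ps) = norm c * weight ps"
proof -
  have ps: "set ps \<subseteq> carrier X \<times> carrier Y" "tensor_sum X Y ps = u" using assms by (auto simp: reps_def)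
  have "tensor_sum X Y (map (\<lambda>(x, y). (c \<odot>\<^bsub>X\<^esub> x, y)) ps) = (\<lambda>B. c * tensor_sum X Y ps B)"
  proof
    fix B
    show "tensor_sum X Y (map (\<lambda>(x, y). (c \<odot>\<^bsub>X\<^esub> x, y)) ps) B = c * tensor_sum X Y ps B"
    proof (cases "B \<in> bilinear_forms X Y")
      case True
      then have B: "\<And>x y. x \<in> carrier X \<Longrightarrow> y \<in> carrier Y \<Longrightarrow> B (c \<odot>\<^bsub>X\<^esub> x) y = c * B x y"
        by (simp add: bilinear_forms_def)
      show ?thesis
        using ps(1) True by (induction ps) (auto simp: tensor_sum_def B distrib_left)
    qed (simp add: tensor_sum_def)
  qed
  then show "map (\<lambda>(x, y). (c \<odot>\<^bsub>X\<^esub> x, y)) ps \<in> reps (\<lambda>B. c * u B)"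
    using ps smult_closed_X by (auto simp: reps_def)
  show "weight (map (\<lambda>(x, y). (c \<odot>\<^bsub>X\<^esub> x, y)) ps) = norm c * weight ps"
    using ps(1) by (induction ps) (auto simp: weight_def nrm_smult_X distrib_left mult.assoc)
qed

lemma nrm_le_weight: "ps \<in> reps u \<Longrightarrow> nrm N u \<le> weight ps"
  unfolding N_simps using bdd_weight by (intro cInf_lower) auto

lemma nrm_ge: "u \<in> carrier N \<Longrightarrow> (\<And>ps. ps \<in> reps u \<Longrightarrow> r \<le> weight ps) \<Longrightarrow> r \<le> nrm N u"
  unfolding N_simps by (intro cInf_greatest) auto

lemma nrm_smult_N: "u \<in> carrier N \<Longrightarrow> nrm N (\<lambda>B. c * u B) \<le> norm c * nrm N u"
proof (cases "c = 0")
  case True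
  assume "u \<in> carrier N"
  then obtain ps where "ps \<in> reps u" by (auto simp: N_simps)
  then show ?thesis using True nrm_le_weight[OF reps_smult(1), of ps u c] reps_smult(2)[of ps u c] by simp
next
  case False
  assume u: "u \<in> carrier N"
  have "nrm N (\<lambda>B. c * u B) / norm c \<le> nrm N u"
  proof (rule nrm_ge[OF u])
    fix ps assume "ps \<in> reps u"
    then have "nrm N (\<lambda>B. c * u B) \<le> norm c * weight ps"
      using nrm_le_weight[OF reps_smult(1)] reps_smult(2) by metis
    then show "nrm N (\<lambda>B. c * u B) / norm c \<le> weight ps" using False by (simp add: field_simps)
  qed
  then show ?thesis using False by (simp add: field_simps)
qed

lemma abelian_group_N: "abelian_group N"
proof (rule abelian_groupI)
  show "\<zero>\<^bsub>N\<^esub> \<in> carrier N"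
    unfolding N_simps by (auto simp: reps_def tensor_sum_def fun_eq_iff intro!: exI[of _ "[]"])
  show "u \<oplus>\<^bsub>N\<^esub> v \<in> carrier N" if "u \<in> carrier N" "v \<in> carrier N" for u v
    using that reps_add unfolding N_simps by blast
  show "\<exists>v\<in>carrier N. v \<oplus>\<^bsub>N\<^esub> u = \<zero>\<^bsub>N\<^esub>" if "u \<in> carrier N" for u
  proof (rule bexI[of _ "\<lambda>B. - 1 * u B"])
    show "(\<lambda>B. - 1 * u B) \<in> carrier N"
      using that reps_smult(1)[of _ u "- 1"] unfolding N_simps by blast
  qed (simp add: N_simps)
qed (auto simp: N_simps add_ac)

lemma a_inv_N: "u \<in> carrier N \<Longrightarrow> \<ominus>\<^bsub>N\<^esub> u = (\<lambda>B. - 1 * u B)"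
proof -
  interpret abelian_group N by (rule abelian_group_N)
  assume u: "u \<in> carrier N"
  have "(\<lambda>B. - 1 * u B) \<in> carrier N"
    using u reps_smult(1)[of _ u "- 1"] unfolding N_simps by blast
  moreover have "(\<lambda>B. - 1 * u B) \<oplus>\<^bsub>N\<^esub> u = \<zero>\<^bsub>N\<^esub>" by (simp add: N_simps)
  ultimately show ?thesis using u by (metis minus_equality)
qed

lemma nrm_triangle_N:
  assumes "u \<in> carrier N" "v \<in> carrier N"
  shows "nrm N (u \<oplus>\<^bsub>N\<^esub> v) \<le> nrm N u + nrm N v"
proof -
  have "nrm N (u \<oplus>\<^bsub>N\<^esub> v) - nrm N v \<le> nrm N u"
  proof (rule nrm_ge[OF assms(1)])
    fix ps assume ps: "ps \<in> reps u"
    have "nrm N (u \<oplus>\<^bsub>N\<^esub> v) - weight ps \<le> nrm N v"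
    proof (rule nrm_ge[OF assms(2)])
      fix qs assume "qs \<in> reps v"
      then have "nrm N (\<lambda>B. u B + v B) \<le> weight (ps @ qs)" using nrm_le_weight reps_add ps by blast
      then show "nrm N (u \<oplus>\<^bsub>N\<^esub> v) - weight ps \<le> weight qs" by (simp add: N_simps(1) weight_def)
    qed
    then show "nrm N (u \<oplus>\<^bsub>N\<^esub> v) - nrm N v \<le> weight ps" by simp
  qed
  then show ?thesis by simp
qed

lemma nrm_nonneg_N: "u \<in> carrier N \<Longrightarrow> 0 \<le> nrm N u"
  by (rule nrm_ge) (auto intro: weight_nonneg)

lemma seminormed_N: "seminormed N"
proof -
  interpret abelian_group N by (rule abelian_group_N)
  show ?thesis
  proof
    show "c \<odot>\<^bsub>N\<^esub> u \<in> carrier N" if "u \<in> carrier N" for u c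
      using that reps_smult(1)[of _ u c] unfolding N_simps by blast
    show "nrm N \<zero>\<^bsub>N\<^esub> = 0"
    proof (rule antisym)
      have "[] \<in> reps \<zero>\<^bsub>N\<^esub>" by (auto simp: reps_def tensor_sum_def fun_eq_iff N_simps)
      then show "nrm N \<zero>\<^bsub>N\<^esub> \<le> 0" using nrm_le_weight[of "[]"] by (simp add: weight_def)
    qed (simp add: nrm_nonneg_N)
    show "nrm N (\<ominus>\<^bsub>N\<^esub> u) = nrm N u" if u: "u \<in> carrier N" for u
    proof -
      have le: "nrm N (\<ominus>\<^bsub>N\<^esub> v) \<le> nrm N v" if "v \<in> carrier N" for v
        using nrm_smult_N[OF that, of "- 1"] by (simp only: a_inv_N[OF that] norm_minus_cancel norm_one mult_1_left)
      have "nrm N u \<le> nrm N (\<ominus>\<^bsub>N\<^esub> u)" using le[OF a_inv_closed[OF u]] u by simp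
      then show ?thesis using le[OF u] by (rule order_antisym[rotated])
    qed
    show "nrm N (u \<oplus>\<^bsub>N\<^esub> v) \<le> nrm N u + nrm N v" if "u \<in> carrier N" "v \<in> carrier N" for u v
      using nrm_triangle_N[OF that] .
  qed (auto simp: nrm_smult_N N_simps(1,2) distrib_left)
qed

sublocale N: seminormed N
  by (rule seminormed_N)

definition tens :: "'a \<Rightarrow> 'b \<Rightarrow> (nat \<Rightarrow> ('a \<Rightarrow> 'b \<Rightarrow> 'k) \<Rightarrow> 'k) set" where
  "tens x y = N.emb (tensor_sum X Y [(x, y)])"

lemma tensor_rep: "x \<in> carrier X \<Longrightarrow> y \<in> carrier Y \<Longrightarrow> [(x, y)] \<in> reps (tensor_sum X Y [(x, y)])"
  by (simp add: reps_def)

lemma tensor_carrier: "x \<in> carrier X \<Longrightarrow> y \<in> carrier Y \<Longrightarrow> tensor_sum X Y [(x, y)] \<in> carrier N"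
  using tensor_rep unfolding N_simps by blast

lemma tens_carrier: "x \<in> carrier X \<Longrightarrow> y \<in> carrier Y \<Longrightarrow> tens x y \<in> carrier (X \<otimes>\<^sub>\<pi> Y)"
  unfolding tens_def proj_tensor_def by (intro N.emb_carrier tensor_carrier)

lemma tens_nrm: "x \<in> carrier X \<Longrightarrow> y \<in> carrier Y \<Longrightarrow> nrm (X \<otimes>\<^sub>\<pi> Y) (tens x y) \<le> nrm X x * nrm Y y"
  unfolding tens_def proj_tensor_def
  using nrm_le_weight[OF tensor_rep] tensor_carrier by (simp add: N.emb_nrm weight_def)

text \<open>Moves questions about functionals on the tensor product, weak nullity above all, to
  bilinear forms on the two function spaces.\<close>

lemma tens_bilinear:
  assumes \<phi>: "\<phi> \<in> bounded_functionals (X \<otimes>\<^sub>\<pi> Y)"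
    and add_X: "\<And>x x'. x \<in> carrier X \<Longrightarrow> x' \<in> carrier X \<Longrightarrow> x \<oplus>\<^bsub>X\<^esub> x' \<in> carrier X"
    and add_Y: "\<And>y y'. y \<in> carrier Y \<Longrightarrow> y' \<in> carrier Y \<Longrightarrow> y \<oplus>\<^bsub>Y\<^esub> y' \<in> carrier Y"
    and smult_Y: "\<And>y c. y \<in> carrier Y \<Longrightarrow> c \<odot>\<^bsub>Y\<^esub> y \<in> carrier Y"
  shows "(\<lambda>x y. \<phi> (tens x y)) \<in> bilinear_forms X Y"
proof -
  have add: "\<phi> (N.emb u) + \<phi> (N.emb v) = \<phi> (N.emb (\<lambda>B. u B + v B))" if "u \<in> carrier N" "v \<in> carrier N" for u v
  proof -
    have "\<phi> (N.emb u \<oplus>\<^bsub>completion N\<^esub> N.emb v) = \<phi> (N.emb u) + \<phi> (N.emb v)"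
      using \<phi> N.emb_carrier[OF that(1)] N.emb_carrier[OF that(2)]
      by (simp add: bounded_functionals_def proj_tensor_def)
    then show ?thesis unfolding N.emb_add[OF that] N_simps(1) by simp
  qed
  have smult: "c * \<phi> (N.emb u) = \<phi> (N.emb (\<lambda>B. c * u B))" if "u \<in> carrier N" for c u
  proof -
    have "\<phi> (c \<odot>\<^bsub>completion N\<^esub> N.emb u) = c * \<phi> (N.emb u)"
      using \<phi> N.emb_carrier[OF that] by (simp add: bounded_functionals_def proj_tensor_def)
    then show ?thesis unfolding N.emb_smult[OF that] N_simps(2) by simp
  qed
  show ?thesis
    unfolding bilinear_forms_def tens_def
  proof (intro CollectI conjI ballI allI)
    fix x x' y assume "x \<in> carrier X" "x' \<in> carrier X" "y \<in> carrier Y"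
    moreover from this have "tensor_sum X Y [(x \<oplus>\<^bsub>X\<^esub> x', y)] =
        (\<lambda>B. tensor_sum X Y [(x, y)] B + tensor_sum X Y [(x', y)] B)"
      by (auto simp: tensor_sum_def bilinear_forms_def fun_eq_iff)
    ultimately show "\<phi> (N.emb (tensor_sum X Y [(x \<oplus>\<^bsub>X\<^esub> x', y)])) =
        \<phi> (N.emb (tensor_sum X Y [(x, y)])) + \<phi> (N.emb (tensor_sum X Y [(x', y)]))"
      by (simp add: add tensor_carrier)
  next
    fix x y y' assume "x \<in> carrier X" "y \<in> carrier Y" "y' \<in> carrier Y"
    moreover from this have "tensor_sum X Y [(x, y \<oplus>\<^bsub>Y\<^esub> y')] =
        (\<lambda>B. tensor_sum X Y [(x, y)] B + tensor_sum X Y [(x, y')] B)"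
      by (auto simp: tensor_sum_def bilinear_forms_def fun_eq_iff)
    ultimately show "\<phi> (N.emb (tensor_sum X Y [(x, y \<oplus>\<^bsub>Y\<^esub> y')])) =
        \<phi> (N.emb (tensor_sum X Y [(x, y)])) + \<phi> (N.emb (tensor_sum X Y [(x, y')]))"
      by (simp add: add tensor_carrier)
  next
    fix c x y assume xy: "x \<in> carrier X" "y \<in> carrier Y"
    have "tensor_sum X Y [(c \<odot>\<^bsub>X\<^esub> x, y)] = (\<lambda>B. c * tensor_sum X Y [(x, y)] B)"
      "tensor_sum X Y [(x, c \<odot>\<^bsub>Y\<^esub> y)] = (\<lambda>B. c * tensor_sum X Y [(x, y)] B)"
      using xy by (auto simp: tensor_sum_def bilinear_forms_def fun_eq_iff)
    then show "\<phi> (N.emb (tensor_sum X Y [(c \<odot>\<^bsub>X\<^esub> x, y)])) = c * \<phi> (N.emb (tensor_sum X Y [(x, y)]))"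
      "\<phi> (N.emb (tensor_sum X Y [(x, c \<odot>\<^bsub>Y\<^esub> y)])) = c * \<phi> (N.emb (tensor_sum X Y [(x, y)]))"
      using smult[OF tensor_carrier[OF xy], of c] by simp_all
  qed
qed

text \<open>The converse passage. Tensors are functions of bilinear forms, so evaluation at B is
  linear on them; the bound on B dominates it by the weight of every representation, hence by the
  projective norm, and it extends to the completion.\<close>

lemma ex_tens_functional:
  assumes B: "B \<in> bilinear_forms X Y"
    and bound: "\<And>x y. x \<in> carrier X \<Longrightarrow> y \<in> carrier Y \<Longrightarrow> norm (B x y) \<le> nrm X x * nrm Y y"
  shows "\<exists>\<Psi>\<in>dual_ball (X \<otimes>\<^sub>\<pi> Y). \<forall>x\<in>carrier X. \<forall>y\<in>carrier Y. \<Psi> (tens x y) = B x y"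
proof -
  have "\<exists>\<Psi>\<in>dual_ball (completion N). \<forall>u\<in>carrier N. \<Psi> (N.emb u) = u B"
  proof (rule N.ex_extension)
    show "norm (u B) \<le> nrm N u" if u: "u \<in> carrier N" for u
    proof (rule nrm_ge[OF u])
      fix ps assume "ps \<in> reps u"
      then have ps: "set ps \<subseteq> carrier X \<times> carrier Y" "u = tensor_sum X Y ps" by (auto simp: reps_def)
      have "norm (\<Sum>(x, y)\<leftarrow>ps. B x y) \<le> weight ps"
        using ps(1)
      proof (induction ps)
        case (Cons p ps)
        obtain x y where "p = (x, y)" by fastforce
        then show ?case
          using Cons bound[of x y] norm_triangle_ineq[of "B x y" "\<Sum>(x, y)\<leftarrow>ps. B x y"] by (simp add: weight_def)
      qed (simp add: weight_def)
      then show "norm (u B) \<le> weight ps" using B by (simp add: ps(2) tensor_sum_def)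
    qed
  qed (simp_all add: N_simps)
  then obtain \<Psi> where \<Psi>: "\<Psi> \<in> dual_ball (X \<otimes>\<^sub>\<pi> Y)" "\<And>u. u \<in> carrier N \<Longrightarrow> \<Psi> (N.emb u) = u B"
    unfolding proj_tensor_def by blast
  have "\<Psi> (tens x y) = B x y" if "x \<in> carrier X" "y \<in> carrier Y" for x y
    using \<Psi>(2)[OF tensor_carrier[OF that]] B by (simp add: tens_def tensor_sum_def)
  then show ?thesis using \<Psi>(1) by blast
qed

end

section \<open>Trees of ordinal intervals\<close>

text \<open>Vertices are paths of natural-number labels, the latest label first. A vertex whose
  latest label has rank r gets an interval of length \<omega>^r, the root one of length
  \<omega>^\<Theta>; ranks decrease along the paths of interest.\<close>

locale interval_tree =
  fixes rk :: "nat \<Rightarrow> omega1" and \<Theta> :: omega1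
begin

fun top_rank :: "nat list \<Rightarrow> omega1" where
  "top_rank [] = \<Theta>"
| "top_rank (x # t) = rk x"

text \<open>Start of the slot of child j: every smaller label of rank below r reserves its full
  length, whether or not it occurs as a child. By indecomposability these finitely many lengths sum
  to less than \<omega>^r.\<close>

primrec offset :: "omega1 \<Rightarrow> nat \<Rightarrow> omega1" where
  "offset r 0 = 0"
| "offset r (Suc j) = offset r j + (if rk j < r then opow omega (rk j) else 0)"

primrec lft :: "nat list \<Rightarrow> omega1" where
  "lft [] = 0"
| "lft (x # t) = lft t + offset (top_rank t) x"

definition rgt :: "nat list \<Rightarrow> omega1" where
  "rgt t = lft t + opow omega (top_rank t)"

definition cell :: "nat list \<Rightarrow> omega1 set" where
  "cell t = {lft t<..rgt t}"

fun descending :: "nat list \<Rightarrow> bool" where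
  "descending [] \<longleftrightarrow> True"
| "descending (x # t) \<longleftrightarrow> rk x < top_rank t \<and> descending t"

lemma offset_less: "offset r j < opow omega r"
  by (induction j) (auto simp: opow_pos plus_zero intro: opow_add_closed opow_less_mono)

lemma offset_mono: "j \<le> k \<Longrightarrow> offset r j \<le> offset r k"
proof (induction k rule: dec_induct)
  case (step k)
  have "offset r k \<le> offset r (Suc k)" unfolding offset.simps by (rule plus_ge_left)
  then show ?case using step by simp
qed simp

lemma rgt_Cons: "descending (x # t) \<Longrightarrow> rgt (x # t) = lft t + offset (top_rank t) (Suc x)"
  by (simp add: rgt_def plus_assoc_omega1)

lemma lft_less_rgt: "lft t < rgt t"
  unfolding rgt_def using plus_less_mono[OF opow_pos, of "lft t"] by (simp add: plus_zero)

lemma rgt_Cons_less: "descending (x # t) \<Longrightarrow> rgt (x # t) < rgt t"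
  by (simp only: rgt_Cons rgt_def[of t] plus_less_mono offset_less)

lemma cell_Cons: "descending (x # t) \<Longrightarrow> cell (x # t) \<subseteq> cell t"
  using rgt_Cons_less[of x t] plus_ge_left[of "lft t" "offset (top_rank t) x"]
  by (auto simp: cell_def)

lemma cell_Cons_disjoint:
  assumes "descending (x # t)" "descending (y # t)" "x \<noteq> y"
  shows "cell (x # t) \<inter> cell (y # t) = {}"
proof -
  have *: "cell (x # t) \<inter> cell (y # t) = {}" if "descending (x # t)" "x < y" for x y
  proof -
    have "rgt (x # t) \<le> lft (y # t)"
      using offset_mono[of "Suc x" y] that(2) by (simp add: rgt_Cons[OF that(1)] plus_le_mono del: offset.simps)
    then show ?thesis by (auto simp: cell_def)
  qed
  show ?thesis using *[of x y] *[of y x] assms by (cases x y rule: linorder_cases) auto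
qed

text \<open>At equal depth two different paths split below a common vertex; the cells of the two
  children there are disjoint and all deeper cells stay inside them.\<close>

lemma cell_disjoint:
  "length s = length t \<Longrightarrow> descending s \<Longrightarrow> descending t \<Longrightarrow> s \<noteq> t \<Longrightarrow> cell s \<inter> cell t = {}"
proof (induction s t rule: list_induct2)
  case (Cons x s y t)
  show ?case
  proof (cases "s = t")
    case True
    then show ?thesis using Cons cell_Cons_disjoint by blast
  next
    case False
    then have "cell s \<inter> cell t = {}" using Cons by simp
    then show ?thesis using cell_Cons Cons.prems by blast
  qed
qed simp

text \<open>The inequality is strict away from the root, so the indicator of a cell vanishes at the
  endpoint of the interval, as membership in C_0 demands.\<close>

lemma rgt_less: "descending t \<Longrightarrow> t \<noteq> [] \<Longrightarrow> rgt t < opow omega \<Theta>"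
proof (induction t)
  case (Cons x t)
  show ?case
  proof (cases "t = []")
    case True
    then show ?thesis using rgt_Cons_less[OF Cons.prems(1)] by (simp add: rgt_def zero_plus)
  next
    case False
    then show ?thesis using Cons rgt_Cons_less[OF Cons.prems(1)] by (auto intro: order_less_trans)
  qed
qed simp

end

text \<open>Runs through the initial segments of a set, the longest first, and records a label only
  where \<open>new\<close> holds. Sets that grow without a new vertex share their path, hence their
  cell.\<close>

primrec node_list :: "(nat set \<Rightarrow> bool) \<Rightarrow> (nat set \<Rightarrow> nat) \<Rightarrow> nat list \<Rightarrow> nat list" where
  "node_list new lab [] = []"
| "node_list new lab (k # ks) =
    (if new (set (k # ks)) then lab (set (k # ks)) # node_list new lab ks else node_list new lab ks)"

definition node :: "(nat set \<Rightarrow> bool) \<Rightarrow> (nat set \<Rightarrow> nat) \<Rightarrow> nat set \<Rightarrow> nat list" where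
  "node new lab E = node_list new lab (rev (sorted_list_of_set E))"

lemma node_empty: "node new lab {} = []"
  by (simp add: node_def)

lemma node_insert:
  assumes "finite E" "\<forall>m\<in>E. m < k"
  shows "node new lab (insert k E) =
    (if new (insert k E) then lab (insert k E) # node new lab E else node new lab E)"
proof -
  have "insort k (sorted_list_of_set E) = sorted_list_of_set E @ [k]"
    using assms by (intro sorted_insort_is_snoc) (auto intro: less_imp_le)
  then have "rev (sorted_list_of_set (insert k E)) = k # rev (sorted_list_of_set E)"
    using assms by (subst sorted_list_of_set.fold_insort_key.insert) auto
  then show ?thesis using assms by (simp add: node_def)
qed

locale ranked_nodes = regular F + interval_tree rk "\<rho> {}"
  for F :: "nat set set" and rk :: "nat \<Rightarrow> omega1" and \<rho> :: "nat set \<Rightarrow> omega1" +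
  fixes new :: "nat set \<Rightarrow> bool"
  assumes rank_le: "insert k E \<in> F \<Longrightarrow> \<forall>m\<in>E. m < k \<Longrightarrow> \<rho> (insert k E) \<le> \<rho> E"
    and rank_less: "insert k E \<in> F \<Longrightarrow> \<forall>m\<in>E. m < k \<Longrightarrow> new (insert k E) \<Longrightarrow> \<rho> (insert k E) < \<rho> E"
    and new_singleton: "k \<ge> 1 \<Longrightarrow> new {k}"
begin

text \<open>The middle conjunct is the invariant: the rank of the current set never exceeds that of
  the latest label, so the strict drop at the next new vertex makes the path descend.\<close>

lemma descending_node:
  assumes lab: "\<And>E. E \<in> F \<Longrightarrow> rk (lab E) = \<rho> E" and E: "E \<in> F"
  shows "descending (node new lab E) \<and> \<rho> E \<le> top_rank (node new lab E) \<and> (E \<noteq> {} \<longrightarrow> node new lab E \<noteq> [])"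
proof -
  have "E \<in> fin_sets" using E sub_fin by blast
  then show ?thesis using E
  proof (induction rule: fin_sets_induct)
    case empty
    then show ?case by (simp add: node_empty)
  next
    case (insert E k)
    have "E \<in> F" using insert.prems hereditary by blast
    moreover have "finite E" using insert by (simp add: fin_sets_def)
    moreover have "E = {} \<longrightarrow> new (insert k E)" using new_singleton insert by simp
    ultimately show ?case
      using insert rank_le[OF insert.prems insert(2)] rank_less[OF insert.prems insert(2)] lab[OF insert.prems]
      by (auto simp: node_insert intro: order_less_le_trans order_trans)
  qed
qed

lemma cell_insert:
  assumes lab: "\<And>E. E \<in> F \<Longrightarrow> rk (lab E) = \<rho> E" and E: "insert k E \<in> F" "\<forall>m\<in>E. m < k"
  shows "cell (node new lab (insert k E)) \<subseteq> cell (node new lab E)"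
proof -
  have "finite E" using E finite_in by fastforce
  then show ?thesis
    using descending_node[OF lab E(1)] cell_Cons[of "lab (insert k E)" "node new lab E"] E(2)
    by (auto simp: node_insert split: if_splits)
qed

end

section \<open>The two interval systems for the Schreier families\<close>

locale schreier_pair =
  fixes \<kappa> :: "omega1 \<Rightarrow> nat \<Rightarrow> omega1" and \<xi> \<zeta> :: omega1
  assumes \<kappa>: "characteristic_sequences \<kappa>"
begin

abbreviation "top1 \<equiv> opow omega (opow omega \<xi>)"
abbreviation "top2 \<equiv> opow omega (opow omega \<zeta>)"
abbreviation "A \<equiv> schreier \<kappa> \<xi>"
abbreviation "A1 \<equiv> schreier2 \<kappa> \<xi> 1"
abbreviation "FF \<equiv> schreier2 \<kappa> \<xi> (1 + \<zeta>)"

sublocale S2: ladder "schreier2 \<kappa> \<xi>" "\<lambda>\<delta> n. osucc (\<kappa> \<delta> n)"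
  by (rule ladder_schreier2[OF \<kappa>])

lemma A_eq: "schreier2 \<kappa> \<xi> 0 = A"
  by (rule schreier2_zero[OF \<kappa>])

sublocale A: regular A
  using S2.regular_zero unfolding A_eq .

lemma A1_eq: "A1 = schreier_step A"
  using S2.Fm_osucc[of 0] by (simp add: one_omega1_def A_eq)

end

text \<open>
  The interval attached to a set \<open>H\<close> below is \<open>(a H, b H]\<close>; the cell of \<open>E\<close> for the sign pattern \<open>\<omega>\<close> (the set of
  indices of the blocks with sign \<open>+1\<close>) is \<open>(c \<omega> E, d \<omega> E]\<close>.
\<close>

locale first_intervals = schreier_pair +
  fixes a b :: "nat set \<Rightarrow> omega1"
  assumes a_less: "H \<in> A \<Longrightarrow> H \<noteq> {} \<Longrightarrow> a H < b H"
    and b_less: "H \<in> A \<Longrightarrow> H \<noteq> {} \<Longrightarrow> b H < top1"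
    and ab_nested: "insert k H \<in> A \<Longrightarrow> \<forall>m\<in>H. m < k \<Longrightarrow> H \<noteq> {} \<Longrightarrow>
      {a (insert k H)<..b (insert k H)} \<subseteq> {a H<..b H}"
    and ab_disjoint: "insert k H \<in> A \<Longrightarrow> insert l H \<in> A \<Longrightarrow> \<forall>m\<in>H. m < k \<Longrightarrow> \<forall>m\<in>H. m < l \<Longrightarrow> k \<noteq> l \<Longrightarrow>
      {a (insert k H)<..b (insert k H)} \<inter> {a (insert l H)<..b (insert l H)} = {}"

text \<open>The tree of all sets in S_\<xi>, where every element creates a vertex. Labelling by
  \<open>set_encode\<close> makes siblings distinct and lets the rank be recovered from the
  label.\<close>

lemma (in schreier_pair) ex_first_intervals: "\<exists>a b. first_intervals \<kappa> \<xi> a b"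
proof -
  interpret S: ladder "schreier \<kappa>" "\<lambda>\<delta> n. osucc (\<kappa> \<delta> n)" by (rule ladder_schreier[OF \<kappa>])
  obtain \<rho> where \<rho>: "\<rho> {} = opow omega \<xi>"
    "\<And>E k. insert k E \<in> schreier \<kappa> \<xi> \<Longrightarrow> \<forall>m\<in>E. m < k \<Longrightarrow> \<rho> (insert k E) \<le> \<rho> E"
    "\<And>E k. insert k E \<in> schreier \<kappa> \<xi> \<Longrightarrow> \<forall>m\<in>E. m < k \<Longrightarrow> lastb (schreier \<kappa> 0) (insert k E) = {k} \<Longrightarrow> \<rho> (insert k E) < \<rho> E"
    using S.ex_rank[of \<xi>] by blast
  \<comment> \<open>Over the base S_0 all blocks are singletons, so the rank drops at every
    element.\<close>
  have new: "lastb (schreier \<kappa> 0) (insert k E) = {k}"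
    if "insert k E \<in> schreier \<kappa> \<xi>" "\<forall>m\<in>E. m < k" for E k
  proof -
    have E: "E \<in> fin_sets" "insert k E \<in> fin_sets" using that S.sub_fin[of \<xi>] by (auto simp: fin_sets_def)
    show ?thesis
    proof (cases "E = {}")
      case True
      then show ?thesis using that E S.decomp_singleton[of k] by (simp add: fin_sets_def Suc_leI)
    next
      case False
      then have L: "lastb (schreier \<kappa> 0) E \<in> schreier \<kappa> 0" "lastb (schreier \<kappa> 0) E \<noteq> {}"
        using S.lastb_props E by blast+
      then have "lastb (schreier \<kappa> 0) E \<in> maximal_sets (schreier \<kappa> 0)"
        unfolding maximal_sets_def by (auto simp: schreier_zero init_seg_def)
      then show ?thesis using S.lastb_insert[OF E(1) False that(2)] by simp
    qed
  qed
  define rk where "rk c = \<rho> (set_decode c)" for c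
  interpret R: ranked_nodes "schreier \<kappa> \<xi>" rk \<rho> "\<lambda>_. True"
    by unfold_locales (use \<rho> new in auto)
  let ?n = "node (\<lambda>_. True) set_encode"
  have lab: "rk (set_encode E) = \<rho> E" if "E \<in> schreier \<kappa> \<xi>" for E
    using S.finite_in[OF that] by (simp add: rk_def)
  note d = R.descending_node[of set_encode, OF lab]
  have "first_intervals \<kappa> \<xi> (\<lambda>H. R.lft (?n H)) (\<lambda>H. R.rgt (?n H))"
  proof unfold_locales
    fix H assume H: "H \<in> schreier \<kappa> \<xi>" "H \<noteq> {}"
    show "R.lft (?n H) < R.rgt (?n H)" by (rule R.lft_less_rgt)
    show "R.rgt (?n H) < opow omega (opow omega \<xi>)" using d[OF _ H(1)] H R.rgt_less \<rho>(1) by auto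
  next
    fix H k assume H: "insert k H \<in> schreier \<kappa> \<xi>" "\<forall>m\<in>H. m < k"
    show "{R.lft (?n (insert k H))<..R.rgt (?n (insert k H))} \<subseteq> {R.lft (?n H)<..R.rgt (?n H)}"
      using R.cell_insert[OF lab H] by (simp add: R.cell_def)
  next
    fix H k l assume H: "insert k H \<in> schreier \<kappa> \<xi>" "insert l H \<in> schreier \<kappa> \<xi>"
      "\<forall>m\<in>H. m < k" "\<forall>m\<in>H. m < l" "k \<noteq> l"
    have fin: "finite H" "finite (insert k H)" "finite (insert l H)" using H(1) S.finite_in by fastforce+
    have "insert k H \<noteq> insert l H" using H(3-5) by auto
    then have ne: "set_encode (insert k H) \<noteq> set_encode (insert l H)"
      using fin set_encode_inverse by metis
    have n: "?n (insert k H) = set_encode (insert k H) # ?n H" "?n (insert l H) = set_encode (insert l H) # ?n H"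
      using H(3,4) fin(1) by (simp_all add: node_insert)
    have "R.descending (?n (insert k H))" "R.descending (?n (insert l H))" using d[OF _ H(1)] d[OF _ H(2)] by auto
    then show "{R.lft (?n (insert k H))<..R.rgt (?n (insert k H))} \<inter> {R.lft (?n (insert l H))<..R.rgt (?n (insert l H))} = {}"
      unfolding n R.cell_def[symmetric] using R.cell_Cons_disjoint ne by blast
  qed
  then show ?thesis by blast
qed

context schreier_pair
begin

text \<open>The largest element of E opens an S_1[S_\<xi>]-block; the sign tree branches exactly at
  these sets.\<close>

definition fresh :: "nat set \<Rightarrow> bool" where
  "fresh E \<longleftrightarrow> lastb A1 E = {Max E}"

lemma fresh_insert:
  assumes "finite E" "\<forall>m\<in>E. m < k"
  shows "fresh (insert k E) \<longleftrightarrow> lastb A1 (insert k E) = {k}"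
proof -
  have "Max (insert k E) = k" using assms by (intro Max_eqI) (auto intro: less_imp_le)
  then show ?thesis by (simp add: fresh_def)
qed

lemma fresh_iff:
  assumes "E \<in> fin_sets" "E \<noteq> {}" "\<forall>m\<in>E. m < k"
  shows "fresh (insert k E) \<longleftrightarrow> lastb A1 E \<in> maximal_sets A1"
proof -
  have "lastb A1 E \<noteq> {}" "lastb A1 E \<subseteq> E" using S2.lastb_props[OF assms(1,2)] by auto
  then have "insert k (lastb A1 E) \<noteq> {k}" using assms(3) by blast
  then show ?thesis
    using fresh_insert[of E k] S2.lastb_insert[OF assms, of 1] assms by (auto simp: fin_sets_def)
qed

text \<open>When \<open>Max E\<close> opens an \<open>A1\<close>-block, that block has minimum
  \<open>Max E\<close> and hence at most \<open>Max E\<close> many A-blocks, the first of which is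
  number \<open>nb A E\<close>. So all its block numbers lie below this bound.\<close>

definition lbound :: "nat set \<Rightarrow> nat" where
  "lbound E = nb A E + Max E"

text \<open>Records the set and the signs up to the bound only. The truncation leaves finitely many
  labels for each E, while the bound still covers all signs needed until the next fresh set.\<close>

definition lab :: "nat set \<Rightarrow> nat set \<Rightarrow> nat" where
  "lab \<omega> E = prod_encode (set_encode E, set_encode (\<omega> \<inter> {..<lbound E}))"

abbreviation "nd \<omega> E \<equiv> node fresh (lab \<omega>) E"

lemma length_nd: "E \<in> fin_sets \<Longrightarrow> length (nd \<omega> E) = length (nd \<omega>' E)"
  by (induction rule: fin_sets_induct) (auto simp: node_empty node_insert fin_sets_def)

lemma finite_range_nd: "E \<in> fin_sets \<Longrightarrow> finite (range (\<lambda>\<omega>. nd \<omega> E))"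
proof (induction rule: fin_sets_induct)
  case (insert E k)
  have "range (\<lambda>\<omega>. lab \<omega> E) \<subseteq> (\<lambda>\<sigma>. prod_encode (set_encode E, set_encode \<sigma>)) ` Pow {..<lbound E}" for E
    by (auto simp: lab_def)
  then have fin: "finite (range (\<lambda>\<omega>. lab \<omega> (insert k E)))" by (rule finite_subset) simp
  have "range (\<lambda>\<omega>. lab \<omega> (insert k E) # nd \<omega> E) \<subseteq>
     (\<lambda>(x, t). x # t) ` (range (\<lambda>\<omega>. lab \<omega> (insert k E)) \<times> range (\<lambda>\<omega>. nd \<omega> E))" by auto
  then have "finite (range (\<lambda>\<omega>. lab \<omega> (insert k E) # nd \<omega> E))"
    by (rule finite_subset) (use fin insert in simp)
  then show ?case using insert by (simp add: node_insert fin_sets_def)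
qed (simp add: node_empty)

text \<open>The head label of \<open>nd \<omega> E\<close> determines whether \<open>nb A E \<in> \<omega>\<close>: a set in \<open>A1\<close> consists of at
  most as many \<open>A\<close>-blocks as its minimum, which is known when the label is created.\<close>

lemma head_label:
  assumes "E \<in> fin_sets" "E \<noteq> {}"
  shows "\<exists>E'. finite E' \<and> (\<forall>\<omega>. \<exists>t. nd \<omega> E = lab \<omega> E' # t) \<and> nb A E < lbound E'"
proof -
  \<comment> \<open>E' is the segment at which the current \<open>A1\<close>-block opened. The last
    A-block of E' and the first A-block of \<open>lastb A1 E\<close> are the same block of E,
    counted twice on the right; hence the \<open>Suc\<close> on the left.\<close>
  have "E \<noteq> {} \<longrightarrow> (\<exists>E'. finite E' \<and> (\<forall>\<omega>. \<exists>t. nd \<omega> E = lab \<omega> E' # t) \<and> Max E' = Min (lastb A1 E) \<and>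
      Suc (nb A E) = nb A E' + nb A (lastb A1 E))"
    using assms(1)
  proof (induction rule: fin_sets_induct)
    case (insert E k)
    have fin: "finite E" using insert by (simp add: fin_sets_def)
    have Mx: "Max (insert k E) = k" using insert fin by (intro Max_eqI) (auto intro: less_imp_le)
    have k: "nb A {k} = 1" using A.decomp_singleton insert by simp
    show ?case
    proof (cases "fresh (insert k E)")
      case True
      then have L: "lastb A1 (insert k E) = {k}" using fresh_insert[OF fin insert(2)] by blast
      have "nd \<omega> (insert k E) = lab \<omega> (insert k E) # nd \<omega> E" for \<omega>
        using True node_insert[OF fin insert(2)] by simp
      then show ?thesis using L Mx k fin by (intro impI exI[of _ "insert k E"]) simp
    next
      case False
      have ne: "E \<noteq> {}"
      proof
        assume "E = {}"
        then have "fresh (insert k E)"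
          using S2.decomp_singleton[OF insert(3), of 1] by (simp add: fresh_def)
        then show False using False by blast
      qed
      then obtain E' where E': "finite E'" "\<forall>\<omega>. \<exists>t. nd \<omega> E = lab \<omega> E' # t" "Max E' = Min (lastb A1 E)"
        "Suc (nb A E) = nb A E' + nb A (lastb A1 E)"
        using insert by blast
      let ?D = "lastb A1 E"
      have D: "?D \<in> A1" "?D \<noteq> {}" "?D \<subseteq> E" using S2.lastb_props[OF insert(1) ne] by auto
      have Df: "?D \<in> fin_sets" "finite ?D" "\<forall>m\<in>?D. m < k"
        using D(1,3) S2.sub_fin S2.finite_in insert(2) by blast+
      have L: "lastb A1 (insert k E) = insert k ?D"
        using S2.lastb_insert[OF insert(1) ne insert(2), of 1] fresh_iff[OF insert(1) ne insert(2)] False by simp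
      have al: "lastb A E = lastb A ?D" using S2.lastb_aligned[OF insert(1) ne, of 1] by (simp add: A_eq)
      have nb: "Suc (nb A (insert k E)) = nb A E' + nb A (lastb A1 (insert k E))"
        unfolding L A.nb_insert[OF insert(1) ne insert(2)] A.nb_insert[OF Df(1) D(2) Df(3)] al using E'(4) by simp
      have "nd \<omega> (insert k E) = nd \<omega> E" for \<omega>
        using False node_insert[OF fin insert(2)] by simp
      moreover have "Min (lastb A1 (insert k E)) = Min ?D"
        unfolding L by (rule Min_insert_above[OF Df(2) D(2) Df(3)])
      ultimately show ?thesis using E' nb by (intro impI exI[of _ E']) simp
    qed
  qed simp
  then obtain E' where E': "finite E'" "\<forall>\<omega>. \<exists>t. nd \<omega> E = lab \<omega> E' # t" "Max E' = Min (lastb A1 E)"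
        "Suc (nb A E) = nb A E' + nb A (lastb A1 E)"
    using assms by blast
  have "lastb A1 E \<in> schreier_step A" "lastb A1 E \<noteq> {}" using S2.lastb_props[OF assms, of 1] by (auto simp: A1_eq)
  then have "nb A (lastb A1 E) \<le> Min (lastb A1 E)" using A.step_iff by blast
  then show ?thesis using E' by (intro exI[of _ E']) (simp add: lbound_def)
qed

end

text \<open>\<open>cd_sign\<close> makes the sign of the current block well defined on cells that
  may coincide for different patterns; \<open>cd_const\<close> and \<open>cd_disjoint\<close> are
  the two cases of the weak nullity argument. Disjointness is asked across all pairs of patterns, so
  that the whole supports are separated.\<close>

locale second_intervals = schreier_pair +
  fixes c d :: "nat set \<Rightarrow> nat set \<Rightarrow> omega1"
  assumes c_less: "E \<in> FF \<Longrightarrow> E \<noteq> {} \<Longrightarrow> c \<omega> E < d \<omega> E"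
    and d_less: "E \<in> FF \<Longrightarrow> E \<noteq> {} \<Longrightarrow> d \<omega> E < top2"
    and cd_nested: "insert k E \<in> FF \<Longrightarrow> \<forall>m\<in>E. m < k \<Longrightarrow> E \<noteq> {} \<Longrightarrow>
      {c \<omega> (insert k E)<..d \<omega> (insert k E)} \<subseteq> {c \<omega> E<..d \<omega> E}"
    and cd_sign: "E \<in> FF \<Longrightarrow> E \<noteq> {} \<Longrightarrow> {c \<omega> E<..d \<omega> E} \<inter> {c \<omega>' E<..d \<omega>' E} \<noteq> {} \<Longrightarrow>
      nb A E \<in> \<omega> \<longleftrightarrow> nb A E \<in> \<omega>'"
    and cd_finite: "E \<in> FF \<Longrightarrow> finite (range (\<lambda>\<omega>. (c \<omega> E, d \<omega> E)))"
    and cd_const: "insert k E \<in> FF \<Longrightarrow> \<forall>m\<in>E. m < k \<Longrightarrow> \<not> fresh (insert k E) \<Longrightarrow>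
      c \<omega> (insert k E) = c \<omega> E \<and> d \<omega> (insert k E) = d \<omega> E"
    and cd_disjoint: "insert k E \<in> FF \<Longrightarrow> insert l E \<in> FF \<Longrightarrow> \<forall>m\<in>E. m < k \<Longrightarrow> \<forall>m\<in>E. m < l \<Longrightarrow> k \<noteq> l \<Longrightarrow>
      fresh (insert k E) \<Longrightarrow> fresh (insert l E) \<Longrightarrow>
      {c \<omega> (insert k E)<..d \<omega> (insert k E)} \<inter> {c \<omega>' (insert l E)<..d \<omega>' (insert l E)} = {}"

text \<open>The ladder is shifted so that its base is S_1[S_\<xi>]; the rank then drops at fresh
  sets only and starts at \<omega>^\<zeta>, as the space allows.\<close>

lemma (in schreier_pair) ex_second_intervals: "\<exists>c d. second_intervals \<kappa> \<xi> \<zeta> c d"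
proof -
  obtain \<nu>' where "ladder (\<lambda>\<zeta>. schreier2 \<kappa> \<xi> (1 + \<zeta>)) \<nu>'"
    using S2.ladder_shift osucc_neq_zero by metis
  then interpret L: ladder "\<lambda>\<zeta>. schreier2 \<kappa> \<xi> (1 + \<zeta>)" \<nu>' .
  obtain \<rho> where \<rho>: "\<rho> {} = opow omega \<zeta>"
    "\<And>E k. insert k E \<in> FF \<Longrightarrow> \<forall>m\<in>E. m < k \<Longrightarrow> \<rho> (insert k E) \<le> \<rho> E"
    "\<And>E k. insert k E \<in> FF \<Longrightarrow> \<forall>m\<in>E. m < k \<Longrightarrow> lastb A1 (insert k E) = {k} \<Longrightarrow> \<rho> (insert k E) < \<rho> E"
    using L.ex_rank[of \<zeta>] by (auto simp: plus_zero)
  have finE: "finite E" "E \<in> fin_sets" if "insert k E \<in> FF" for E k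
    using that S2.sub_fin[of "1 + \<zeta>"] by (auto simp: fin_sets_def)
  \<comment> \<open>The rank reads only the set stored in the label; all sign patterns of one set
    have the same rank.\<close>
  define rk where "rk c = \<rho> (set_decode (fst (prod_decode c)))" for c
  interpret R: ranked_nodes FF rk \<rho> fresh
  proof unfold_locales
    show "\<rho> (insert k E) < \<rho> E" if "insert k E \<in> FF" "\<forall>m\<in>E. m < k" "fresh (insert k E)" for k E
      using that \<rho>(3) fresh_insert finE by blast
    show "fresh {k}" if "1 \<le> k" for k using that S2.decomp_singleton by (simp add: fresh_def)
  qed (use \<rho>(2) in auto)
  have lab: "rk (lab \<omega> E) = \<rho> E" if "E \<in> FF" for E \<omega>
    using S2.finite_in[OF that] by (simp add: rk_def lab_def)
  note d = R.descending_node[of "lab _", OF lab]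
  have lab_inj: "E = E' \<and> \<omega> \<inter> {..<lbound E} = \<omega>' \<inter> {..<lbound E'}"
    if "lab \<omega> E = lab \<omega>' E'" "finite E" "finite E'" for \<omega> \<omega>' E E'
  proof -
    have "set_encode E = set_encode E'" "set_encode (\<omega> \<inter> {..<lbound E}) = set_encode (\<omega>' \<inter> {..<lbound E'})"
      using that by (auto simp: lab_def)
    then show ?thesis using set_encode_inverse that(2,3) by (metis finite_Int finite_lessThan)
  qed
  have "second_intervals \<kappa> \<xi> \<zeta> (\<lambda>\<omega> E. R.lft (nd \<omega> E)) (\<lambda>\<omega> E. R.rgt (nd \<omega> E))"
  proof unfold_locales
    fix E \<omega> assume E: "E \<in> FF" "E \<noteq> {}"
    show "R.lft (nd \<omega> E) < R.rgt (nd \<omega> E)" by (rule R.lft_less_rgt)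
    show "R.rgt (nd \<omega> E) < opow omega (opow omega \<zeta>)" using d[OF _ E(1)] E R.rgt_less \<rho>(1) by auto
  next
    fix E k \<omega> assume "insert k E \<in> FF" "\<forall>m\<in>E. m < k"
    then show "{R.lft (nd \<omega> (insert k E))<..R.rgt (nd \<omega> (insert k E))} \<subseteq> {R.lft (nd \<omega> E)<..R.rgt (nd \<omega> E)}"
      using R.cell_insert[OF lab] by (simp add: R.cell_def)
  next
    fix E \<omega> \<omega>' assume E: "E \<in> FF" "E \<noteq> {}"
      "{R.lft (nd \<omega> E)<..R.rgt (nd \<omega> E)} \<inter> {R.lft (nd \<omega>' E)<..R.rgt (nd \<omega>' E)} \<noteq> {}"
    have Ef: "E \<in> fin_sets" using E S2.sub_fin by blast
    \<comment> \<open>Both paths have the same depth, so cells that meet belong to the same path;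
      the head label then reveals the common sign.\<close>
    have eq: "nd \<omega> E = nd \<omega>' E"
      using R.cell_disjoint[OF length_nd[OF Ef]] d[OF _ E(1)] E(3) unfolding R.cell_def by blast
    obtain E' where E': "finite E'" "\<forall>\<omega>. \<exists>t. nd \<omega> E = lab \<omega> E' # t" "nb A E < lbound E'"
      using head_label[OF Ef E(2)] by blast
    then have "lab \<omega> E' = lab \<omega>' E'" using eq by (metis list.inject)
    then show "nb A E \<in> \<omega> \<longleftrightarrow> nb A E \<in> \<omega>'" using lab_inj[of \<omega> E' \<omega>' E'] E' by blast
  next
    fix E assume "E \<in> FF"
    then have "finite ((\<lambda>n. (R.lft n, R.rgt n)) ` range (\<lambda>\<omega>. nd \<omega> E))"
      using finite_range_nd S2.sub_fin by blast
    then show "finite (range (\<lambda>\<omega>. (R.lft (nd \<omega> E), R.rgt (nd \<omega> E))))" by (simp add: image_image)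
  next
    fix E k \<omega> assume E: "insert k E \<in> FF" "\<forall>m\<in>E. m < k" "\<not> fresh (insert k E)"
    then have "nd \<omega> (insert k E) = nd \<omega> E" using node_insert[OF finE(1)[OF E(1)] E(2)] by simp
    then show "R.lft (nd \<omega> (insert k E)) = R.lft (nd \<omega> E) \<and> R.rgt (nd \<omega> (insert k E)) = R.rgt (nd \<omega> E)"
      by simp
  next
    fix E k l \<omega> \<omega>' assume E: "insert k E \<in> FF" "insert l E \<in> FF" "\<forall>m\<in>E. m < k" "\<forall>m\<in>E. m < l" "k \<noteq> l"
      "fresh (insert k E)" "fresh (insert l E)"
    have n: "nd \<omega> (insert k E) = lab \<omega> (insert k E) # nd \<omega> E" "nd \<omega>' (insert l E) = lab \<omega>' (insert l E) # nd \<omega>' E"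
      using node_insert[OF finE(1)[OF E(1)] E(3)] node_insert[OF finE(1)[OF E(2)] E(4)] E(6,7) by auto
    have "insert k E \<noteq> insert l E" using E(3-5) by auto
    then have "lab \<omega> (insert k E) \<noteq> lab \<omega>' (insert l E)"
      using lab_inj[of \<omega> "insert k E" \<omega>' "insert l E"] finE(1)[OF E(1)] by auto
    then have "nd \<omega> (insert k E) \<noteq> nd \<omega>' (insert l E)" "length (nd \<omega> (insert k E)) = length (nd \<omega>' (insert l E))"
      using n length_nd[OF finE(2)[OF E(1)]] by auto
    then show "{R.lft (nd \<omega> (insert k E))<..R.rgt (nd \<omega> (insert k E))} \<inter>
        {R.lft (nd \<omega>' (insert l E))<..R.rgt (nd \<omega>' (insert l E))} = {}"
      using R.cell_disjoint d[OF _ E(1)] d[OF _ E(2)] unfolding R.cell_def by blast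
  qed
  then show ?thesis by blast
qed

section \<open>The weakly null collection\<close>

text \<open>The i-th Rademacher function, with a point of the sign cube given by the set of its
  positive coordinates.\<close>

definition sg :: "nat \<Rightarrow> nat set \<Rightarrow> real" where
  "sg i \<omega> = (if i \<in> \<omega> then 1 else - 1)"

lemma sum_sg_sg:
  assumes "finite I" "i \<in> I" "j \<in> I"
  shows "(\<Sum>\<omega>\<in>Pow I. sg i \<omega> * sg j \<omega>) = (if i = j then real (card (Pow I)) else 0)"
proof (cases "i = j")
  case True
  have "sg i \<omega> * sg i \<omega> = 1" for \<omega> by (simp add: sg_def)
  then show ?thesis using True by simp
next
  case False
  \<comment> \<open>Flipping the i-th sign is an involution of the cube that negates the product
    when j differs from i.\<close>
  define h where "h \<omega> = (if i \<in> \<omega> then \<omega> - {i} else insert i \<omega>)" for \<omega> :: "nat set"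
  have "bij_betw h (Pow I) (Pow I)"
    by (rule bij_betw_byWitness[where f' = h]) (use assms in \<open>auto simp: h_def\<close>)
  then have "(\<Sum>\<omega>\<in>Pow I. sg i \<omega> * sg j \<omega>) = (\<Sum>\<omega>\<in>Pow I. sg i (h \<omega>) * sg j (h \<omega>))"
    by (rule sum.reindex_bij_betw[symmetric])
  also have "\<dots> = (\<Sum>\<omega>\<in>Pow I. - (sg i \<omega> * sg j \<omega>))"
    using False by (intro sum.cong) (auto simp: sg_def h_def)
  also have "\<dots> = - (\<Sum>\<omega>\<in>Pow I. sg i \<omega> * sg j \<omega>)" by (rule sum_negf)
  finally show ?thesis using False by simp
qed

text \<open>The i-th Rademacher coefficient of y for the uniform measure on the finite cube: the
  integral of r y of the overview.\<close>

definition sg_coeff :: "nat set \<Rightarrow> (nat set \<Rightarrow> 'v::real_vector) \<Rightarrow> nat \<Rightarrow> 'v" where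
  "sg_coeff I y i = (1 / real (card (Pow I))) *\<^sub>R (\<Sum>\<omega>\<in>Pow I. sg i \<omega> *\<^sub>R y \<omega>)"

text \<open>Here z is the orthogonal projection of y to the span of the chosen Rademacher functions;
  expanding the nonnegative sum of |y - z|^2 gives the claim. Values in a real inner product space
  cover complex scalars as well.\<close>

lemma bessel_sg:
  fixes y :: "nat set \<Rightarrow> 'v::real_inner"
  assumes I: "finite I" and "K \<subseteq> I" and y: "\<And>\<omega>. \<omega> \<in> Pow I \<Longrightarrow> norm (y \<omega>) \<le> m"
  shows "(\<Sum>i\<in>K. (norm (sg_coeff I y i))\<^sup>2) \<le> m\<^sup>2"
proof -
  define c where "c = real (card (Pow I))"
  have "card (Pow I) > 0" using I by (subst card_gt_0_iff) auto
  then have c: "c > 0" by (simp add: c_def)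
  have K: "finite K" using assms finite_subset by blast
  define R where "R = sg_coeff I y"
  have R: "(\<Sum>\<omega>\<in>Pow I. sg i \<omega> *\<^sub>R y \<omega>) = c *\<^sub>R R i" for i
    using c by (simp add: R_def sg_coeff_def c_def)
  define z where "z \<omega> = (\<Sum>i\<in>K. sg i \<omega> *\<^sub>R R i)" for \<omega>
  define Q where "Q = (\<Sum>i\<in>K. R i \<bullet> R i)"
  have yz: "(\<Sum>\<omega>\<in>Pow I. y \<omega> \<bullet> z \<omega>) = c * Q"
  proof -
    have "(\<Sum>\<omega>\<in>Pow I. y \<omega> \<bullet> z \<omega>) = (\<Sum>\<omega>\<in>Pow I. \<Sum>i\<in>K. (sg i \<omega> *\<^sub>R y \<omega>) \<bullet> R i)"
      by (simp add: z_def inner_sum_right)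
    also have "\<dots> = (\<Sum>i\<in>K. (\<Sum>\<omega>\<in>Pow I. sg i \<omega> *\<^sub>R y \<omega>) \<bullet> R i)"
      by (subst sum.swap) (simp add: inner_sum_left)
    also have "\<dots> = c * Q" by (simp add: R Q_def sum_distrib_left)
    finally show ?thesis .
  qed
  have zz: "(\<Sum>\<omega>\<in>Pow I. z \<omega> \<bullet> z \<omega>) = c * Q"
  proof -
    have "(\<Sum>\<omega>\<in>Pow I. z \<omega> \<bullet> z \<omega>) = (\<Sum>\<omega>\<in>Pow I. \<Sum>i\<in>K. \<Sum>j\<in>K. (sg i \<omega> * sg j \<omega>) * (R i \<bullet> R j))"
      by (simp add: z_def inner_sum_right inner_sum_left sum_distrib_left inner_commute mult_ac)
    also have "\<dots> = (\<Sum>i\<in>K. \<Sum>j\<in>K. (\<Sum>\<omega>\<in>Pow I. sg i \<omega> * sg j \<omega>) * (R i \<bullet> R j))"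
      by (subst sum.swap, rule sum.cong[OF refl], subst sum.swap) (simp add: sum_distrib_right)
    also have "\<dots> = (\<Sum>i\<in>K. \<Sum>j\<in>K. if j = i then c * (R i \<bullet> R i) else 0)"
      using assms(2) by (intro sum.cong) (auto simp: sum_sg_sg[OF I subsetD[OF assms(2)] subsetD[OF assms(2)]] c_def)
    also have "\<dots> = c * Q" using K by (simp add: Q_def sum_distrib_left)
    finally show ?thesis .
  qed
  have "0 \<le> (\<Sum>\<omega>\<in>Pow I. (y \<omega> - z \<omega>) \<bullet> (y \<omega> - z \<omega>))" by (intro sum_nonneg) simp
  also have "\<dots> = (\<Sum>\<omega>\<in>Pow I. y \<omega> \<bullet> y \<omega>) - 2 * (\<Sum>\<omega>\<in>Pow I. y \<omega> \<bullet> z \<omega>) + (\<Sum>\<omega>\<in>Pow I. z \<omega> \<bullet> z \<omega>)"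
    by (simp add: inner_diff inner_commute sum_subtractf sum.distrib sum_distrib_left algebra_simps)
  also have "\<dots> = (\<Sum>\<omega>\<in>Pow I. y \<omega> \<bullet> y \<omega>) - c * Q" by (simp add: yz zz)
  finally have "c * Q \<le> (\<Sum>\<omega>\<in>Pow I. y \<omega> \<bullet> y \<omega>)" by simp
  also have "\<dots> \<le> (\<Sum>\<omega>\<in>Pow I. m\<^sup>2)"
    using y by (intro sum_mono) (simp add: power2_norm_eq_inner[symmetric] power_mono)
  also have "\<dots> = c * m\<^sup>2" by (simp add: c_def)
  finally have "Q \<le> m\<^sup>2" using c by simp
  then show ?thesis by (simp add: Q_def R_def power2_norm_eq_inner)
qed

lemma sg_coeff_sg:
  assumes "finite I" "i \<in> I" "j \<in> I"
  shows "sg_coeff I (\<lambda>\<omega>. of_real (sg j \<omega>) :: 'k::real_normed_field) i = (if i = j then 1 else 0)"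
proof -
  have "card (Pow I) > 0" using assms(1) by (subst card_gt_0_iff) auto
  moreover have "(\<Sum>\<omega>\<in>Pow I. sg i \<omega> *\<^sub>R (of_real (sg j \<omega>) :: 'k)) = of_real (\<Sum>\<omega>\<in>Pow I. sg i \<omega> * sg j \<omega>)"
    by (simp add: scaleR_conv_of_real)
  ultimately show ?thesis by (simp add: sg_coeff_def sum_sg_sg[OF assms] scaleR_conv_of_real)
qed

lemma sg_coeff_add: "sg_coeff I (\<lambda>\<omega>. x \<omega> + y \<omega>) i = sg_coeff I x i + sg_coeff I y i"
  by (simp add: sg_coeff_def scaleR_add_right sum.distrib)

lemma sg_coeff_mult:
  "sg_coeff I (\<lambda>\<omega>. c * y \<omega>) i = (c :: 'k::real_normed_field) * sg_coeff I y i"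
  by (simp add: sg_coeff_def sum_distrib_left)

locale interval_system = first_intervals + second_intervals

context interval_system
begin

definition fun1 :: "nat set \<Rightarrow> omega1 \<Rightarrow> 'k::real_normed_field" where
  "fun1 H = (\<lambda>\<beta>. if \<beta> \<in> {a H<..b H} then 1 else 0)"

definition pos :: "nat set \<Rightarrow> omega1 set" where
  "pos E = (\<Union>\<omega>\<in>{\<omega>. nb A E \<in> \<omega>}. {c \<omega> E<..d \<omega> E})"

definition neg :: "nat set \<Rightarrow> omega1 set" where
  "neg E = (\<Union>\<omega>\<in>{\<omega>. nb A E \<notin> \<omega>}. {c \<omega> E<..d \<omega> E})"

definition fun2 :: "nat set \<Rightarrow> omega1 \<Rightarrow> 'k::real_normed_field" where
  "fun2 E = (\<lambda>\<beta>. (if \<beta> \<in> pos E then 1 else 0) - (if \<beta> \<in> neg E then 1 else 0))"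

lemma fun1_carrier: "H \<in> A \<Longrightarrow> H \<noteq> {} \<Longrightarrow> fun1 H \<in> carrier (C0_space top1)"
  using b_less[of H] continuous_on_If_clopen[OF open_interval_omega1, of _ "a H" "b H"]
  by (auto simp: C0_carrier fun1_def)

lemma fun1_le: "norm (fun1 H \<beta> :: 'k::real_normed_field) \<le> 1"
  by (simp add: fun1_def)

text \<open>The patterns \<omega> are infinitely many, but by \<open>cd_finite\<close> only finitely
  many intervals occur, so the complement of the union is open too.\<close>

lemma clopen_cells:
  assumes "E \<in> FF"
  shows "open (\<Union>\<omega>\<in>W. {c \<omega> E<..d \<omega> E}) \<and> open (- (\<Union>\<omega>\<in>W. {c \<omega> E<..d \<omega> E}))"
proof -
  define P where "P = (\<lambda>\<omega>. (c \<omega> E, d \<omega> E)) ` W"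
  have P: "finite P" using cd_finite[OF assms] unfolding P_def by (rule rev_finite_subset) auto
  have eq: "(\<Union>\<omega>\<in>W. {c \<omega> E<..d \<omega> E}) = (\<Union>(p, q)\<in>P. {p<..q})" by (auto simp: P_def)
  have "open (\<Inter>(p, q)\<in>P. - {p<..q})"
    using P open_interval_omega1(2) by (intro open_INT) auto
  moreover have "- (\<Union>(p, q)\<in>P. {p<..q}) = (\<Inter>(p, q)\<in>P. - {p<..q})" by auto
  moreover have "open (\<Union>(p, q)\<in>P. {p<..q})" using open_interval_omega1(1) by (intro open_UN) auto
  ultimately show ?thesis unfolding eq by simp
qed

lemma fun2_carrier:
  assumes "E \<in> FF" "E \<noteq> {}"
  shows "(fun2 E :: omega1 \<Rightarrow> 'k::real_normed_field) \<in> carrier (C0_space top2)"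
proof -
  have "continuous_on S (fun2 E :: omega1 \<Rightarrow> 'k)" for S
    unfolding fun2_def pos_def neg_def
    using clopen_cells[OF assms(1)] by (intro continuous_on_diff continuous_on_If_clopen) auto
  moreover have "fun2 E \<beta> = (0 :: 'k)" if "\<beta> \<ge> top2" for \<beta>
  proof -
    have "\<beta> \<notin> {c \<omega> E<..d \<omega> E}" for \<omega> using d_less[OF assms, of \<omega>] that by auto
    then show ?thesis by (simp add: fun2_def pos_def neg_def)
  qed
  ultimately show ?thesis by (simp add: C0_carrier)
qed

lemma fun2_le: "norm (fun2 E \<beta> :: 'k::real_normed_field) \<le> 1"
  by (simp add: fun2_def)

lemma fun2_value:
  assumes "E \<in> FF" "E \<noteq> {}" "\<beta> \<in> {c \<omega> E<..d \<omega> E}"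
  shows "fun2 E \<beta> = (of_real (sg (nb A E) \<omega>) :: 'k::real_normed_field)"
proof -
  have same: "nb A E \<in> \<omega>' \<longleftrightarrow> nb A E \<in> \<omega>" if "\<beta> \<in> {c \<omega>' E<..d \<omega>' E}" for \<omega>'
    using cd_sign[OF assms(1,2), of \<omega>' \<omega>] that assms(3) by blast
  have "\<beta> \<in> pos E \<longleftrightarrow> nb A E \<in> \<omega>" "\<beta> \<in> neg E \<longleftrightarrow> nb A E \<notin> \<omega>"
    unfolding pos_def neg_def using same assms(3) by blast+
  then show ?thesis by (simp add: fun2_def sg_def)
qed

lemma FF_fin_sets: "E \<in> FF \<Longrightarrow> E \<in> fin_sets"
  using S2.sub_fin by blast

lemma lastb_in_A: "E \<in> FF \<Longrightarrow> E \<noteq> {} \<Longrightarrow> lastb A E \<in> A \<and> lastb A E \<noteq> {}"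
  using A.lastb_props FF_fin_sets by blast

text \<open>For fixed E, the last A-blocks of all extensions are siblings over one H, which is empty
  when a new block opens and the current block otherwise. This makes the first factors
  disjoint.\<close>

lemma fun1_siblings:
  assumes "E \<in> fin_sets"
  shows "\<exists>H. \<forall>k. insert k E \<in> FF \<longrightarrow> (\<forall>m\<in>E. m < k) \<longrightarrow>
    lastb A (insert k E) = insert k H \<and> (\<forall>m\<in>H. m < k)"
proof (cases "E = {} \<or> lastb A E \<in> maximal_sets A")
  case True
  have "lastb A (insert k E) = {k}" if "insert k E \<in> FF" "\<forall>m\<in>E. m < k" for k
  proof (cases "E = {}")
    case e: True
    then have "k \<ge> 1" using FF_fin_sets[OF that(1)] by (auto simp: fin_sets_def Suc_le_eq intro: gr0I)
    then show ?thesis using A.decomp_singleton e by simp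
  next
    case False
    then show ?thesis using True A.lastb_insert[OF assms False that(2)] by simp
  qed
  then show ?thesis by (intro exI[of _ "{}"]) simp
next
  case False
  then show ?thesis
    using A.lastb_insert[OF assms] A.lastb_props[OF assms] by (intro exI[of _ "lastb A E"]) auto
qed

lemma fun1_disjoint:
  assumes "E \<in> fin_sets" "insert k E \<in> FF" "insert l E \<in> FF" "\<forall>m\<in>E. m < k" "\<forall>m\<in>E. m < l" "k \<noteq> l"
  shows "fun1 (lastb A (insert k E)) \<beta> = (0::'k::real_normed_field) \<or> fun1 (lastb A (insert l E)) \<beta> = (0::'k)"
proof -
  obtain H where H: "\<And>k. insert k E \<in> FF \<Longrightarrow> \<forall>m\<in>E. m < k \<Longrightarrow>
      lastb A (insert k E) = insert k H \<and> (\<forall>m\<in>H. m < k)"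
    using fun1_siblings[OF assms(1)] by blast
  have "insert k H \<in> A" "insert l H \<in> A"
    using H[OF assms(2,4)] H[OF assms(3,5)] lastb_in_A[OF assms(2)] lastb_in_A[OF assms(3)] by auto
  then show ?thesis
    using ab_disjoint[of k H l] H[OF assms(2,4)] H[OF assms(3,5)] assms(6) by (auto simp: fun1_def)
qed

lemma fun2_disjoint:
  assumes "insert k E \<in> FF" "insert l E \<in> FF" "\<forall>m\<in>E. m < k" "\<forall>m\<in>E. m < l" "k \<noteq> l"
    "fresh (insert k E)" "fresh (insert l E)"
  shows "fun2 (insert k E) \<beta> = (0::'k::real_normed_field) \<or> fun2 (insert l E) \<beta> = (0::'k)"
proof -
  have "\<beta> \<notin> {c \<omega> (insert k E)<..d \<omega> (insert k E)} \<or> \<beta> \<notin> {c \<omega>' (insert l E)<..d \<omega>' (insert l E)}" for \<omega> \<omega>'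
    using cd_disjoint[OF assms, of \<omega> \<omega>'] by blast
  then have "\<beta> \<notin> pos (insert k E) \<union> neg (insert k E) \<or> \<beta> \<notin> pos (insert l E) \<union> neg (insert l E)"
    unfolding pos_def neg_def by blast
  then show ?thesis by (auto simp: fun2_def)
qed

text \<open>Freshness of an extension depends only on whether the current \<open>A1\<close>-block is
  complete. Hence the same alternative, equal or disjoint second factors, holds for all k at
  once.\<close>

lemma fresh_siblings:
  assumes "E \<in> fin_sets" "insert k E \<in> FF" "insert l E \<in> FF" "\<forall>m\<in>E. m < k" "\<forall>m\<in>E. m < l"
  shows "fresh (insert k E) \<longleftrightarrow> fresh (insert l E)"
proof (cases "E = {}")
  case True
  have "k \<ge> 1" "l \<ge> 1"
    using True FF_fin_sets[OF assms(2)] FF_fin_sets[OF assms(3)] by (auto simp: fin_sets_def Suc_le_eq intro: gr0I)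
  then show ?thesis using True S2.decomp_singleton by (simp add: fresh_def)
next
  case False
  then show ?thesis using fresh_iff[OF assms(1)] assms(4,5) by blast
qed

lemma fun2_const:
  assumes "E \<in> fin_sets" "insert k E \<in> FF" "insert l E \<in> FF" "\<forall>m\<in>E. m < k" "\<forall>m\<in>E. m < l"
    "\<not> fresh (insert k E)"
  shows "fun2 (insert k E) = (fun2 (insert l E) :: omega1 \<Rightarrow> 'k::real_normed_field)"
proof -
  have nf: "\<not> fresh (insert l E)" using fresh_siblings[OF assms(1-5)] assms(6) by blast
  have ne: "E \<noteq> {}"
  proof
    assume "E = {}"
    then have "k \<ge> 1" using FF_fin_sets[OF assms(2)] by (auto simp: fin_sets_def Suc_le_eq intro: gr0I)
    then show False using \<open>E = {}\<close> assms(6) S2.decomp_singleton by (simp add: fresh_def)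
  qed
  have "nb A (insert k E) = nb A (insert l E)"
    using A.nb_insert[OF assms(1) ne] assms(4,5) by simp
  then have "pos (insert k E) = pos (insert l E)" "neg (insert k E) = neg (insert l E)"
    unfolding pos_def neg_def
    using cd_const[OF assms(2,4,6)] cd_const[OF assms(3,5) nf] by auto
  then show ?thesis by (simp add: fun2_def)
qed

text \<open>Suitable unimodular scalars dominate the sum by one value of B. If the second factors
  coincide, scalars on the left suffice; if they are disjoint, both sides get scalars. Disjointness
  keeps the combinations in the unit balls.\<close>

lemma bilinear_sum_le:
  fixes B :: "(omega1 \<Rightarrow> 'k::real_normed_field) \<Rightarrow> (omega1 \<Rightarrow> 'k) \<Rightarrow> 'k"
  assumes B: "B \<in> bilinear_forms (C0_space top1) (C0_space top2)"
    and C: "C \<ge> 0" "\<And>x y. x \<in> carrier (C0_space top1) \<Longrightarrow>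
      y \<in> carrier (C0_space top2) \<Longrightarrow>
      norm (B x y) \<le> C * (nrm (C0_space top1) x * nrm (C0_space top2) y)"
    and E: "E \<in> fin_sets" and K: "finite K" "\<And>k. k \<in> K \<Longrightarrow> insert k E \<in> FF \<and> (\<forall>m\<in>E. m < k)"
  shows "(\<Sum>k\<in>K. norm (B (fun1 (lastb A (insert k E))) (fun2 (insert k E)))) \<le> C"
proof -
  let ?X = "C0_space top1 :: ('k, omega1 \<Rightarrow> 'k) nspace"
  let ?Y = "C0_space top2 :: ('k, omega1 \<Rightarrow> 'k) nspace"
  define f where "f k = (fun1 (lastb A (insert k E)) :: omega1 \<Rightarrow> 'k)" for k
  define g where "g k = (fun2 (insert k E) :: omega1 \<Rightarrow> 'k)" for k
  have f: "f k \<in> carrier ?X" if "k \<in> K" for k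
    unfolding f_def using K(2)[OF that] lastb_in_A by (intro fun1_carrier) auto
  have g: "g k \<in> carrier ?Y" if "k \<in> K" for k
    unfolding g_def using K(2)[OF that] by (intro fun2_carrier) auto
  have fd: "nrm ?X (\<lambda>\<beta>. \<Sum>k\<in>K. e k * f k \<beta>) \<le> 1" if "\<And>k. k \<in> K \<Longrightarrow> norm (e k) = 1" for e
  proof (rule C0_lincomb_disjoint)
    fix k l \<beta> assume "k \<in> K" "l \<in> K" "k \<noteq> l"
    then show "f k \<beta> = 0 \<or> f l \<beta> = 0"
      using fun1_disjoint[OF E, of k l \<beta>] K(2)[of k] K(2)[of l] by (simp add: f_def)
  qed (use that fun1_le in \<open>auto simp: f_def\<close>)
  have bound: "norm (B x y) \<le> C" if "x \<in> carrier ?X" "y \<in> carrier ?Y" "nrm ?X x \<le> 1" "nrm ?Y y \<le> 1" for x y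
  proof -
    have "nrm ?X x * nrm ?Y y \<le> 1 * 1"
      using that C0_nrm_nonneg by (intro mult_mono) auto
    then have "C * (nrm ?X x * nrm ?Y y) \<le> C * 1" using C(1) by (intro mult_left_mono) auto
    then show ?thesis using C(2)[OF that(1,2)] by simp
  qed
  have "(\<Sum>k\<in>K. norm (B (f k) (g k))) \<le> C"
  proof (cases "\<exists>k\<in>K. \<not> fresh (insert k E)")
    case True
    then obtain l where l: "l \<in> K" "\<not> fresh (insert l E)" by blast
    have eq: "g k = g l" if "k \<in> K" for k
      unfolding g_def using fun2_const[where ?'k = 'k, OF E, of l k] K(2)[OF l(1)] K(2)[OF that] l(2) by auto
    obtain e where e: "\<forall>k\<in>K. norm (e k) = 1"
      "(\<Sum>k\<in>K. norm (B (f k) (g l))) \<le> norm (B (\<lambda>\<gamma>. \<Sum>k\<in>K. e k * f k \<gamma>) (g l))"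
      using bilinear_signs_left[OF B K(1), of f "g l", OF f g[OF l(1)]] by blast
    have gl: "nrm ?Y (g l) \<le> 1" unfolding g_def by (intro C0_nrm_leI fun2_le)
    have "(\<Sum>k\<in>K. norm (B (f k) (g k))) = (\<Sum>k\<in>K. norm (B (f k) (g l)))"
      using eq by (intro sum.cong) simp_all
    also have "\<dots> \<le> norm (B (\<lambda>\<gamma>. \<Sum>k\<in>K. e k * f k \<gamma>) (g l))" by (rule e(2))
    also have "\<dots> \<le> C" using f g[OF l(1)] gl e(1) fd by (intro bound C0_lincomb) auto
    finally show ?thesis .
  next
    case False
    obtain e e' where e: "\<forall>k\<in>K. norm (e k) = 1 \<and> norm (e' k) = 1"
      "(\<Sum>k\<in>K. norm (B (f k) (g k))) \<le> norm (B (\<lambda>\<gamma>. \<Sum>k\<in>K. e k * f k \<gamma>) (\<lambda>\<gamma>. \<Sum>k\<in>K. e' k * g k \<gamma>))"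
      using bilinear_signs[OF B K(1), of f g, OF f g] by blast
    have "nrm ?Y (\<lambda>\<beta>. \<Sum>k\<in>K. e' k * g k \<beta>) \<le> 1"
    proof (rule C0_lincomb_disjoint)
      fix k l \<beta> assume "k \<in> K" "l \<in> K" "k \<noteq> l"
      then show "g k \<beta> = 0 \<or> g l \<beta> = 0"
        using fun2_disjoint[of k E l \<beta>] K(2)[of k] K(2)[of l] False by (simp add: g_def)
    qed (use e(1) fun2_le in \<open>auto simp: g_def\<close>)
    then have "norm (B (\<lambda>\<gamma>. \<Sum>k\<in>K. e k * f k \<gamma>) (\<lambda>\<gamma>. \<Sum>k\<in>K. e' k * g k \<gamma>)) \<le> C"
      using f g e(1) fd by (intro bound C0_lincomb) auto
    then show ?thesis using e(2) by linarith
  qed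
  then show ?thesis by (simp add: f_def g_def)
qed

end

section \<open>The norming functional\<close>

lemma tensor_pair_C0:
  "tensor_pair (C0_space \<alpha> :: ('k::{real_normed_field,banach}, omega1 \<Rightarrow> 'k) nspace) (C0_space \<beta>)"
  by unfold_locales (simp_all add: C0_smult_closed C0_nrm_smult C0_nrm_nonneg)

context interval_system
begin

lemma init_seg_FF: "G \<in> FF \<Longrightarrow> init_seg E G \<Longrightarrow> E \<in> FF"
  using S2.hereditary by (auto simp: init_seg_def)

lemma init_seg_next:
  assumes "init_seg E G" "E \<noteq> G" "finite G"
  obtains k where "\<forall>m\<in>E. m < k" "init_seg (insert k E) G" "k \<in> G" "k \<notin> E"
proof -
  define k where "k = Min (G - E)"
  have ne: "G - E \<noteq> {}" "finite (G - E)" using assms by (auto simp: init_seg_def)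
  then have k: "k \<in> G" "k \<notin> E" "\<And>x. x \<in> G - E \<Longrightarrow> k \<le> x" using Min_in[OF ne(2,1)] by (auto simp: k_def)
  have "\<forall>m\<in>E. m < k" using assms(1) k unfolding init_seg_def by (meson not_le)
  moreover have "init_seg (insert k E) G"
    unfolding init_seg_def
  proof (intro conjI ballI impI)
    show "insert k E \<subseteq> G" using assms(1) k by (auto simp: init_seg_def)
    fix m n assume mn: "m \<in> insert k E" "n \<in> G" "n \<le> m"
    show "n \<in> insert k E"
    proof (cases "n \<in> E")
      case False
      then have "k \<le> n" using k mn by blast
      then show ?thesis using mn assms(1) False unfolding init_seg_def by auto
    qed simp
  qed
  ultimately show ?thesis using that k by blast
qed

lemma cell_init_seg:
  assumes "G \<in> FF" "init_seg E G" "E \<noteq> {}"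
  shows "{c \<omega> G<..d \<omega> G} \<subseteq> {c \<omega> E<..d \<omega> E}"
  using assms(2,3)
proof (induction "card (G - E)" arbitrary: E rule: less_induct)
  case less
  have fin: "finite G" using assms(1) S2.finite_in by blast
  show ?case
  proof (cases "E = G")
    case False
    then obtain k where k: "\<forall>m\<in>E. m < k" "init_seg (insert k E) G" "k \<in> G" "k \<notin> E"
      using init_seg_next[OF less.prems(1) _ fin] by blast
    have "card (G - insert k E) < card (G - E)" using k fin by (intro psubset_card_mono) auto
    then have "{c \<omega> G<..d \<omega> G} \<subseteq> {c \<omega> (insert k E)<..d \<omega> (insert k E)}" using less.hyps k by blast
    also have "\<dots> \<subseteq> {c \<omega> E<..d \<omega> E}"
      using cd_nested[OF init_seg_FF[OF assms(1) k(2)] k(1) less.prems(2)] .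
    finally show ?thesis .
  qed simp
qed

abbreviation "q \<equiv> qw0 \<kappa> \<xi> (1 + \<zeta>)"

text \<open>One set for each A-block of G, namely the initial segment that ends with the block.
  These index the terms of the form.\<close>

definition full :: "nat set \<Rightarrow> nat set set" where
  "full G = {E \<in> init_segs G. lastb A E \<in> maximal_sets A}"

text \<open>Continue E inside G until its current A-block is complete, which happens because G
  itself ends in a complete block. On the way the block number and the q-weight stay fixed and the
  first interval shrinks.\<close>

lemma ex_full:
  assumes G: "G \<in> maximal_sets FF" and E: "E \<in> init_segs G"
  shows "\<exists>E'\<in>full G. nb A E' = nb A E \<and> q E' = q E \<and>
    {a (lastb A E')<..b (lastb A E')} \<subseteq> {a (lastb A E)<..b (lastb A E)}"
  using E
proof (induction "card (G - E)" arbitrary: E rule: less_induct)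
  case less
  have GF: "G \<in> FF" and fin: "finite G" using G S2.maximal_in S2.finite_in by blast+
  have E: "init_seg E G" "E \<noteq> {}" using less.prems by (auto simp: init_segs_def)
  have Ef: "E \<in> fin_sets" using init_seg_FF[OF GF E(1)] FF_fin_sets by blast
  show ?case
  proof (cases "lastb A E \<in> maximal_sets A")
    case True
    then show ?thesis using less.prems by (auto simp: full_def)
  next
    case False
    have "lastb A G \<in> maximal_sets A" using S2.lastb_maximal[OF G] by (simp add: A_eq)
    then have "E \<noteq> G" using False by blast
    then obtain k where k: "\<forall>m\<in>E. m < k" "init_seg (insert k E) G" "k \<in> G" "k \<notin> E"
      using init_seg_next[OF E(1) _ fin] by blast
    have kF: "insert k E \<in> FF" using init_seg_FF[OF GF k(2)] .
    have "card (G - insert k E) < card (G - E)" using k fin by (intro psubset_card_mono) auto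
    then obtain E' where E': "E' \<in> full G" "nb A E' = nb A (insert k E)" "q E' = q (insert k E)"
      "{a (lastb A E')<..b (lastb A E')} \<subseteq> {a (lastb A (insert k E))<..b (lastb A (insert k E))}"
      using less.hyps[of "insert k E"] k(2) by (auto simp: init_segs_def)
    have L: "lastb A (insert k E) = insert k (lastb A E)" "nb A (insert k E) = nb A E"
      using A.lastb_insert[OF Ef E(2) k(1)] A.nb_insert[OF Ef E(2) k(1)] False by auto
    have ab: "\<forall>m\<in>lastb A E. m < k" using A.lastb_props(3)[OF Ef E(2)] k(1) by blast
    have "insert k (lastb A E) \<in> A" using lastb_in_A[OF kF] L by auto
    then have "{a (lastb A (insert k E))<..b (lastb A (insert k E))} \<subseteq> {a (lastb A E)<..b (lastb A E)}"
      unfolding L using ab_nested ab A.lastb_props(2)[OF Ef E(2)] by blast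
    moreover have "q (insert k E) = q E" using qw0_insert[OF \<kappa> kF E(2) k(1) False] .
    ultimately show ?thesis using E' L(2) by (intro bexI[of _ E']) auto
  qed
qed

lemma nb_inj_full:
  assumes G: "G \<in> FF"
  shows "inj_on (nb A) (full G)"
proof -
  have *: "E = E'" if E: "E \<in> full G" "E' \<in> full G" "nb A E = nb A E'" "init_seg E E'" for E E'
  proof (rule ccontr)
    assume "E \<noteq> E'"
    have E': "E \<noteq> {}" "E \<in> FF" "E' \<in> FF" using E init_seg_FF[OF G] by (auto simp: full_def init_segs_def)
    obtain k where k: "\<forall>m\<in>E. m < k" "init_seg (insert k E) E'"
      using init_seg_next[OF E(4) \<open>E \<noteq> E'\<close> S2.finite_in[OF E'(3)]] by blast
    have "nb A (insert k E) = Suc (nb A E)"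
      using A.nb_insert[OF FF_fin_sets[OF E'(2)] E'(1) k(1)] E(1) by (simp add: full_def)
    moreover have "nb A (insert k E) \<le> nb A E'"
      using k(2) FF_fin_sets[OF E'(3)] by (intro A.nb_mono) (auto simp: init_seg_def)
    ultimately show False using E(3) by simp
  qed
  show ?thesis
  proof (rule inj_onI)
    fix E E' assume E: "E \<in> full G" "E' \<in> full G" "nb A E = nb A E'"
    then have "init_seg E E' \<or> init_seg E' E"
      using init_seg_linear[of E G E'] by (simp add: full_def init_segs_def)
    then show "E = E'" using *[OF E] *[OF E(2,1) E(3)[symmetric]] by blast
  qed
qed

lemma sum_q_full:
  assumes G: "G \<in> maximal_sets FF"
  shows "(\<Sum>E\<in>full G. (q E)\<^sup>2) = 1"
proof -
  \<comment> \<open>With this w each A-block gives all its weight to its completion, so the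
    normalised sum runs over complete blocks only.\<close>
  define w where "w E = (if E \<in> maximal_sets A then 1 else 0 :: real)" for E
  have "sum w (init_segs H) = 1" if H: "H \<in> maximal_sets A" for H
  proof -
    have "finite (init_segs H)" using H A.maximal_in A.finite_in finite_init_segs by blast
    moreover have "E = H" if "E \<in> init_segs H" "E \<in> maximal_sets A" for E
      using that A.maximal_in[OF H] unfolding init_segs_def maximal_sets_def by blast
    moreover have "H \<in> init_segs H" using A.maximal_nonempty[OF H] by (simp add: init_segs_def init_seg_refl)
    ultimately have "sum w (init_segs H) = (\<Sum>E\<in>init_segs H. if E = H then 1 else 0)"
      using H by (intro sum.cong) (auto simp: w_def)
    also have "\<dots> = 1" using \<open>finite (init_segs H)\<close> \<open>H \<in> init_segs H\<close> by simp
    finally show ?thesis .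
  qed
  then have "(\<Sum>E\<in>init_segs G. (q E)\<^sup>2 * w (lastb A E)) = 1" using sum_qw0[OF \<kappa> G] by blast
  moreover have "(\<Sum>E\<in>init_segs G. (q E)\<^sup>2 * w (lastb A E)) = (\<Sum>E\<in>full G. (q E)\<^sup>2)"
    using finite_init_segs[of G] S2.finite_in[OF S2.maximal_in[OF G]]
    by (intro sum.mono_neutral_cong_right) (auto simp: full_def w_def)
  ultimately show ?thesis by simp
qed

text \<open>The bilinear form pairs the blocks of \<open>G\<close> with independent signs; Bessel's inequality and
  the normalisation of the \<open>q\<close>-weights bound it by one.\<close>

definition form :: "nat set \<Rightarrow> (omega1 \<Rightarrow> 'k::real_normed_field) \<Rightarrow> (omega1 \<Rightarrow> 'k) \<Rightarrow> 'k" where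
  "form G x y = (\<Sum>E\<in>full G. of_real (q E) * (x (b (lastb A E)) *
     sg_coeff {..nb A G} (\<lambda>\<omega>. y (d \<omega> G)) (nb A E)))"

lemma form_bilinear: "form G \<in> bilinear_forms (C0_space \<alpha>) (C0_space \<beta>)"
  by (auto simp: bilinear_forms_def form_def C0_ops sg_coeff_add sg_coeff_mult distrib_left distrib_right
      sum.distrib sum_distrib_left mult_ac)

text \<open>Point values of x are bounded by its norm; Cauchy-Schwarz then splits the rest into the
  l2 norm of the q-weights, which is one, and that of the Rademacher coefficients, which Bessel
  bounds by the norm of y.\<close>

lemma form_le:
  fixes x y :: "omega1 \<Rightarrow> 'k::{real_normed_field,real_inner}"
  assumes G: "G \<in> maximal_sets FF" and x: "x \<in> carrier (C0_space \<alpha>)" and y: "y \<in> carrier (C0_space \<beta>)"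
  shows "norm (form G x y) \<le> nrm (C0_space \<alpha>) x * nrm (C0_space \<beta>) y"
proof -
  let ?I = "{..nb A G}" and ?J = "full G"
  have GF: "G \<in> FF" using S2.maximal_in[OF G] .
  define R where "R i = sg_coeff ?I (\<lambda>\<omega>. y (d \<omega> G)) i" for i
  have sub: "nb A ` ?J \<subseteq> ?I"
    using FF_fin_sets[OF GF] by (auto simp: full_def init_segs_def init_seg_def intro: A.nb_mono)
  have "(\<Sum>E\<in>?J. (norm (R (nb A E)))\<^sup>2) = (\<Sum>i\<in>nb A ` ?J. (norm (R i))\<^sup>2)"
    by (simp add: sum.reindex[OF nb_inj_full[OF GF]])
  also have "\<dots> \<le> (nrm (C0_space \<beta>) y)\<^sup>2"
    unfolding R_def by (rule bessel_sg[OF _ sub]) (simp_all add: C0_norm_le[OF y])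
  finally have R: "L2_set (\<lambda>E. norm (R (nb A E))) ?J \<le> nrm (C0_space \<beta>) y"
    unfolding L2_set_def using real_sqrt_le_mono C0_nrm_nonneg[OF y] by fastforce
  have "norm (form G x y) \<le> (\<Sum>E\<in>?J. norm (of_real (q E) * (x (b (lastb A E)) * R (nb A E))))"
    unfolding form_def R_def by (rule norm_sum)
  also have "\<dots> \<le> (\<Sum>E\<in>?J. nrm (C0_space \<alpha>) x * (\<bar>q E\<bar> * \<bar>norm (R (nb A E))\<bar>))"
  proof (rule sum_mono)
    fix E assume "E \<in> ?J"
    have "norm (x (b (lastb A E))) * (\<bar>q E\<bar> * norm (R (nb A E))) \<le> nrm (C0_space \<alpha>) x * (\<bar>q E\<bar> * norm (R (nb A E)))"
      using C0_norm_le[OF x] by (intro mult_right_mono) auto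
    then show "norm (of_real (q E) * (x (b (lastb A E)) * R (nb A E))) \<le> nrm (C0_space \<alpha>) x * (\<bar>q E\<bar> * \<bar>norm (R (nb A E))\<bar>)"
      by (simp add: norm_mult mult_ac)
  qed
  also have "\<dots> = nrm (C0_space \<alpha>) x * (\<Sum>E\<in>?J. \<bar>q E\<bar> * \<bar>norm (R (nb A E))\<bar>)" by (simp add: sum_distrib_left)
  also have "(\<Sum>E\<in>?J. \<bar>q E\<bar> * \<bar>norm (R (nb A E))\<bar>) \<le> L2_set q ?J * L2_set (\<lambda>E. norm (R (nb A E))) ?J"
    by (rule L2_set_mult_ineq)
  also have "L2_set q ?J * L2_set (\<lambda>E. norm (R (nb A E))) ?J \<le> nrm (C0_space \<beta>) y"
    using R unfolding L2_set_def[of q] sum_q_full[OF G] by simp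
  finally show ?thesis using C0_nrm_nonneg[OF x] by (simp add: mult_left_mono)
qed

text \<open>Along the points \<open>d \<omega> G\<close> the second factor is the Rademacher
  function of the current block, so orthogonality leaves only the term of the completed block F.
  There the first factor is one, because the interval of F lies in that of E.\<close>

lemma form_value:
  assumes G: "G \<in> maximal_sets FF" and E: "E \<in> init_segs G"
  shows "form G (fun1 (lastb A E)) (fun2 E) = (of_real (q E) :: 'k::real_normed_field)"
proof -
  have GF: "G \<in> FF" using S2.maximal_in[OF G] .
  have E': "init_seg E G" "E \<noteq> {}" using E by (auto simp: init_segs_def)
  have EF: "E \<in> FF" using init_seg_FF[OF GF E'(1)] .
  have Gne: "G \<noteq> {}" using S2.maximal_nonempty[OF G] .
  obtain F where F: "F \<in> full G" "nb A F = nb A E" "q F = q E"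
    "{a (lastb A F)<..b (lastb A F)} \<subseteq> {a (lastb A E)<..b (lastb A E)}"
    using ex_full[OF G E] by blast
  have "fun2 E (d \<omega> G) = (of_real (sg (nb A E) \<omega>) :: 'k)" for \<omega>
  proof (rule fun2_value[OF EF E'(2)])
    have "d \<omega> G \<in> {c \<omega> G<..d \<omega> G}" using c_less[OF GF Gne] by simp
    then show "d \<omega> G \<in> {c \<omega> E<..d \<omega> E}" using cell_init_seg[OF GF E'] by blast
  qed
  then have R: "sg_coeff {..nb A G} (\<lambda>\<omega>. fun2 E (d \<omega> G)) (nb A E') = (if E' = F then 1 else 0 :: 'k)"
    if "E' \<in> full G" for E'
  proof -
    have le: "nb A D \<le> nb A G" if "D \<in> init_segs G" for D
      using that FF_fin_sets[OF GF] by (intro A.nb_mono) (auto simp: init_segs_def init_seg_def)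
    have "nb A E' = nb A E \<longleftrightarrow> E' = F"
      using nb_inj_full[OF GF] F(1,2) that unfolding inj_on_def by metis
    then show ?thesis
      using sg_coeff_sg[of "{..nb A G}" "nb A E'" "nb A E"] le[OF E] le[of E'] that
        \<open>\<And>\<omega>. fun2 E (d \<omega> G) = (of_real (sg (nb A E) \<omega>) :: 'k)\<close> by (simp add: full_def)
  qed
  have finJ: "finite (full G)"
    using finite_init_segs[OF S2.finite_in[OF GF]] by (simp add: full_def)
  have "form G (fun1 (lastb A E)) (fun2 E) =
      (\<Sum>E'\<in>full G. if E' = F then of_real (q F) * (fun1 (lastb A E) (b (lastb A F)) :: 'k) else 0)"
    unfolding form_def by (intro sum.cong) (simp_all add: R)
  also have "\<dots> = of_real (q F) * fun1 (lastb A E) (b (lastb A F))" using finJ F(1) by simp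
  also have "fun1 (lastb A E) (b (lastb A F)) = (1 :: 'k)"
  proof -
    have "F \<in> FF" "F \<noteq> {}" using F(1) init_seg_FF[OF GF] by (auto simp: full_def init_segs_def)
    then have "a (lastb A F) < b (lastb A F)" using lastb_in_A a_less by blast
    then show ?thesis using F(4) by (force simp: fun1_def)
  qed
  finally show ?thesis using F(3) by simp
qed

lemma sum_q_p:
  assumes G: "G \<in> maximal_sets FF"
  shows "(\<Sum>E\<in>init_segs G. (qw \<kappa> \<xi> (1 + \<zeta>) E * pw \<kappa> \<xi> E) * q E) = 1"
proof -
  have "(qw \<kappa> \<xi> (1 + \<zeta>) E * pw \<kappa> \<xi> E) * q E = (q E)\<^sup>2 * pw0 \<kappa> \<xi> (lastb A E)" if "E \<in> init_segs G" for E
  proof -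
    have "E \<in> FF" "E \<noteq> {}" using that init_seg_FF[OF S2.maximal_in[OF G]] by (auto simp: init_segs_def)
    then show ?thesis using S2.decomp_in by (simp add: qw_def pw_def power2_eq_square)
  qed
  then show ?thesis using sum_qw0[OF \<kappa> G, of "pw0 \<kappa> \<xi>"] sum_pw0[OF \<kappa>] by simp
qed

lemma g_space_ge_one:
  "1 \<le> g_space \<kappa> \<xi> (1 + \<zeta>)
     ((C0_space top1 :: ('k::{real_normed_field,banach,real_inner}, omega1 \<Rightarrow> 'k) nspace) \<otimes>\<^sub>\<pi>
      C0_space top2)"
proof -
  let ?X = "C0_space top1 :: ('k, omega1 \<Rightarrow> 'k) nspace"
  let ?Y = "C0_space top2 :: ('k, omega1 \<Rightarrow> 'k) nspace"
  interpret T: tensor_pair ?X ?Y by (rule tensor_pair_C0)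
  let ?U = "?X \<otimes>\<^sub>\<pi> ?Y"
  \<comment> \<open>The collection must be defined on all nonempty finite sets; off
    \<open>FF\<close> it is the tensor of zero functions.\<close>
  define x where "x E = (if E \<in> FF \<and> E \<noteq> {} then fun1 (lastb A E) else (\<lambda>_. 0 :: 'k))" for E
  define y where "y E = (if E \<in> FF \<and> E \<noteq> {} then fun2 E else (\<lambda>_. 0 :: 'k))" for E
  define u where "u E = T.tens (x E) (y E)" for E
  have xX: "x E \<in> carrier ?X" for E
    using fun1_carrier[of "lastb A E"] lastb_in_A[of E] by (auto simp: x_def C0_carrier)
  have yY: "y E \<in> carrier ?Y" for E
    using fun2_carrier[of E] by (auto simp: y_def C0_carrier)
  have nx: "nrm ?X (x E) \<le> 1" for E by (rule C0_nrm_leI) (simp add: x_def fun1_le)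
  have ny: "nrm ?Y (y E) \<le> 1" for E by (rule C0_nrm_leI) (simp add: y_def fun2_le)
  have ball: "collection_in_ball ?U u"
    unfolding collection_in_ball_def
  proof (intro ballI conjI)
    fix E
    show "u E \<in> carrier ?U" unfolding u_def by (intro T.tens_carrier xX yY)
    have "nrm ?U (u E) \<le> nrm ?X (x E) * nrm ?Y (y E)" unfolding u_def by (intro T.tens_nrm xX yY)
    also have "\<dots> \<le> 1 * 1" using nx ny C0_nrm_nonneg[OF xX] C0_nrm_nonneg[OF yY] by (intro mult_mono) auto
    finally show "nrm ?U (u E) \<le> 1" by simp
  qed
  have null: "weakly_null_collection ?U u"
    unfolding weakly_null_collection_def weakly_null_seq_def
  proof (intro ballI)
    fix E \<phi> assume E: "E \<in> fin_sets" and \<phi>: "\<phi> \<in> bounded_functionals ?U"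
    define B where "B x y = \<phi> (T.tens x y)" for x y
    have B: "B \<in> bilinear_forms ?X ?Y"
      unfolding B_def
      by (rule T.tens_bilinear[OF \<phi>]) (auto simp: C0_carrier C0_ops intro!: continuous_intros)
    obtain C where C: "\<And>t. t \<in> carrier ?U \<Longrightarrow> norm (\<phi> t) \<le> C * nrm ?U t"
      using \<phi> unfolding bounded_functionals_def by blast
    have bound: "norm (B x y) \<le> \<bar>C\<bar> * (nrm ?X x * nrm ?Y y)" if "x \<in> carrier ?X" "y \<in> carrier ?Y" for x y
    proof -
      have "0 \<le> nrm ?U (T.tens x y)"
        unfolding T.tens_def proj_tensor_def using T.N.emb_nrm T.tensor_carrier[OF that] T.nrm_nonneg_N by simp
      then have "C * nrm ?U (T.tens x y) \<le> \<bar>C\<bar> * nrm ?U (T.tens x y)" by (intro mult_right_mono) auto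
      also have "\<dots> \<le> \<bar>C\<bar> * (nrm ?X x * nrm ?Y y)" by (intro mult_left_mono T.tens_nrm that) auto
      finally show ?thesis using C[OF T.tens_carrier[OF that]] by (simp add: B_def)
    qed
    have B0: "B (\<lambda>_. 0) (\<lambda>_. 0) = 0"
      using bilinear_formsD(3)[OF B, of "\<lambda>_. 0" "\<lambda>_. 0" "\<lambda>_. 0" "\<lambda>_. 0" 0] by (simp add: C0_carrier)
    have fE: "finite E" using E by (simp add: fin_sets_def)
    show "(\<lambda>k. \<phi> (u (insert k E))) \<longlonglongrightarrow> 0"
    \<comment> \<open>The inserted 0 gives a threshold for empty E and confines k to positive
      integers beyond E.\<close>
    proof (rule bounded_sums_tendsto_zero[where N = "Max (insert 0 E)" and C = "\<bar>C\<bar>"])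
      fix n
      let ?K = "{k. Max (insert 0 E) < k \<and> k < n}"
      let ?K' = "{k \<in> ?K. insert k E \<in> FF}"
      have ab: "\<forall>m\<in>E. m < k" if "k \<in> ?K" for k
        using that fE by (auto intro: le_less_trans[OF Max_ge])
      have "(\<Sum>k\<in>?K. norm (\<phi> (u (insert k E)))) = (\<Sum>k\<in>?K'. norm (B (fun1 (lastb A (insert k E))) (fun2 (insert k E))))"
      proof (rule sum.mono_neutral_cong_right)
        show "\<forall>k\<in>?K - ?K'. norm (\<phi> (u (insert k E))) = 0"
          using B0 by (simp add: u_def x_def y_def B_def)
        show "norm (\<phi> (u (insert k E))) = norm (B (fun1 (lastb A (insert k E))) (fun2 (insert k E)))"
          if "k \<in> ?K'" for k
          using that by (simp add: u_def x_def y_def B_def)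
      qed auto
      also have "\<dots> \<le> \<bar>C\<bar>"
      proof (rule bilinear_sum_le[OF B _ bound E])
        show "insert k E \<in> FF \<and> (\<forall>m\<in>E. m < k)" if "k \<in> ?K'" for k using that ab[of k] by blast
      qed simp_all
      finally show "(\<Sum>k\<in>?K. norm (\<phi> (u (insert k E)))) \<le> \<bar>C\<bar>" .
    qed
  qed
  \<comment> \<open>The first average alone already has value one under a functional of the dual
    ball, whatever M is.\<close>
  have key: "1 \<le> weak_l1_norm ?U (\<lambda>i. avg2 \<kappa> \<xi> (1 + \<zeta>) ?U M u (Suc i))" if M: "M \<in> inf_subsets {1..}" for M
  proof -
    define G where "G = inf_decomp FF M 0"
    have G: "G \<in> maximal_sets FF" unfolding G_def by (rule S2.inf_decomp_maximal[OF M])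
    have seg: "segment \<kappa> \<xi> (1 + \<zeta>) M 0 = {}" "segment \<kappa> \<xi> (1 + \<zeta>) M (Suc 0) = G"
      by (simp_all add: segment_def G_def lessThan_Suc)
    have dom: "{E. proper_init_seg {} E \<and> init_seg E G} = init_segs G"
      by (auto simp: init_segs_def proper_init_seg_def init_seg_def)
    have EF: "E \<in> FF \<and> E \<noteq> {}" if "E \<in> init_segs G" for E
      using that init_seg_FF[OF S2.maximal_in[OF G]] by (auto simp: init_segs_def)
    obtain \<Psi> where \<Psi>: "\<Psi> \<in> dual_ball ?U"
      "\<And>x y. x \<in> carrier ?X \<Longrightarrow> y \<in> carrier ?Y \<Longrightarrow> \<Psi> (T.tens x y) = form G x y"
      using T.ex_tens_functional[OF form_bilinear form_le[OF G]] by blast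
    have "\<Psi> (avg2 \<kappa> \<xi> (1 + \<zeta>) ?U M u (Suc 0)) =
        (\<Sum>E\<in>init_segs G. of_real (qw \<kappa> \<xi> (1 + \<zeta>) E * pw \<kappa> \<xi> E) * \<Psi> (u E))"
      unfolding avg2_def diff_Suc_1 seg dom proj_tensor_def
    proof (rule T.N.functional_finsum)
      show "\<Psi> \<in> bounded_functionals (completion (proj_tensor_alg ?X ?Y))"
        using \<Psi>(1) by (simp add: dual_ball_def proj_tensor_def)
      show "finite (init_segs G)" using finite_init_segs S2.finite_in[OF S2.maximal_in[OF G]] by blast
      show "u E \<in> carrier (completion (proj_tensor_alg ?X ?Y))" for E
        using T.tens_carrier[OF xX yY] by (simp add: u_def proj_tensor_def)
    qed
    also have "\<dots> = (\<Sum>E\<in>init_segs G. of_real ((qw \<kappa> \<xi> (1 + \<zeta>) E * pw \<kappa> \<xi> E) * q E))"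
    proof (rule sum.cong)
      fix E assume E: "E \<in> init_segs G"
      have "\<Psi> (u E) = form G (x E) (y E)" unfolding u_def by (rule \<Psi>(2)[OF xX yY])
      also have "\<dots> = of_real (q E)" using EF[OF E] form_value[OF G E] by (simp add: x_def y_def)
      finally show "of_real (qw \<kappa> \<xi> (1 + \<zeta>) E * pw \<kappa> \<xi> E) * \<Psi> (u E) =
          (of_real ((qw \<kappa> \<xi> (1 + \<zeta>) E * pw \<kappa> \<xi> E) * q E) :: 'k)" by simp
    qed simp
    also have "\<dots> = 1" unfolding of_real_sum[symmetric] sum_q_p[OF G] by simp
    finally have one: "\<Psi> (avg2 \<kappa> \<xi> (1 + \<zeta>) ?U M u (Suc 0)) = 1" .
    let ?e = "\<lambda>i. ennreal (norm (\<Psi> (avg2 \<kappa> \<xi> (1 + \<zeta>) ?U M u (Suc i))))"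
    have "1 = (\<Sum>i\<in>{0}. ?e i)" by (simp add: one)
    also have "\<dots> \<le> (\<Sum>i. ?e i)" by (rule sum_le_suminf) auto
    also have "\<dots> \<le> weak_l1_norm ?U (\<lambda>i. avg2 \<kappa> \<xi> (1 + \<zeta>) ?U M u (Suc i))"
      unfolding weak_l1_norm_def by (rule SUP_upper[OF \<Psi>(1)])
    finally show ?thesis .
  qed
  show ?thesis
    unfolding g_space_def g_op_def
  proof (rule Inf_greatest)
    fix r assume "r \<in> {ennreal \<gamma> |\<gamma>. 0 \<le> \<gamma> \<and> G_property \<kappa> \<xi> (1 + \<zeta>) ?U ?U (\<lambda>x. x) \<gamma>}"
    then obtain \<gamma> where \<gamma>: "r = ennreal \<gamma>" "G_property \<kappa> \<xi> (1 + \<zeta>) ?U ?U (\<lambda>x. x) \<gamma>" by blast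
    \<comment> \<open>The lower bound holds for every M, so testing the property at the full set of
      positive integers is enough.\<close>
    have "{1..} \<in> inf_subsets {1..}" by (simp add: inf_subsets_def infinite_Ici)
    then obtain M where "M \<in> inf_subsets {1..}"
      "weak_l1_norm ?U (\<lambda>i. avg2 \<kappa> \<xi> (1 + \<zeta>) ?U M u (Suc i)) \<le> ennreal \<gamma>"
      using \<gamma>(2) null ball unfolding G_property_def by blast
    then show "1 \<le> r" using key \<gamma>(1) order_trans by blast
  qed
qed

end

theorem theorem21p2:
  fixes \<kappa> :: "omega1 \<Rightarrow> nat \<Rightarrow> omega1" and \<xi> \<zeta> :: omega1
  assumes "characteristic_sequences \<kappa>"
    and "\<zeta> \<le> \<xi>"
  shows "g_space \<kappa> \<xi> (1 + \<zeta>)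
           ((C0_space (opow omega (opow omega \<xi>)) :: (real, omega1 \<Rightarrow> real) nspace) \<otimes>\<^sub>\<pi>
            C0_space (opow omega (opow omega \<zeta>))) \<ge> 1
       \<and> g_space \<kappa> \<xi> (1 + \<zeta>)
           ((C0_space (opow omega (opow omega \<xi>)) :: (complex, omega1 \<Rightarrow> complex) nspace) \<otimes>\<^sub>\<pi>
            C0_space (opow omega (opow omega \<zeta>))) \<ge> 1"
proof -
  interpret schreier_pair \<kappa> \<xi> \<zeta> using assms(1) by unfold_locales
  obtain a b where "first_intervals \<kappa> \<xi> a b" using ex_first_intervals by blast
  then interpret first_intervals \<kappa> \<xi> \<zeta> a b .
  obtain c d where "second_intervals \<kappa> \<xi> \<zeta> c d" using ex_second_intervals by blast
  then interpret second_intervals \<kappa> \<xi> \<zeta> c d .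
  interpret interval_system \<kappa> \<xi> \<zeta> a b c d ..
  \<comment> \<open>The bound holds over any Banach scalar field that is also a real inner product
    space, which covers both scalar fields.\<close>
  show ?thesis by (intro conjI g_space_ge_one)
qed

end
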